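(* Let $(M,L)$ be a Ricci recurrent Finsler manifold of dimension $n\ge3$ (with non-zero horizontal Ricci tensor). Then $(M,L)$ is m-projectively recurrent if and only if it is projectively recurrent with the same recurrence form.
   Context: Setting. $(M,L)$ is a smooth Finsler manifold of dimension $n$ (with positive definite Finsler metric), $\mathcal{T}M$ is the bundle of nonzero tangent vectors, $\pi:\mathcal{T}M\to M$, and $\pi^{-1}(TM)\to\mathcal{T}M$ is the pullback bundle, whose sections $\overline X$ are called $\pi$-vector fields (1-forms on this bundle are $\pi$-forms). $g$ is the Finsler metric on $\pi^{-1}(TM)$ defined by $L$ (in coordinates $g_{ij}=\frac12\partial^2L^2/\partial y^i\partial y^j$). $\overline\eta(u)=(u,u)$ is the fundamental $\pi$-vector field. $\rho:T(\mathcal{T}M)\to\pi^{-1}(TM)$ is the morphism induced by $d\pi$ and $\gamma:\pi^{-1}(TM)\to T(\mathcal{T}M)$ is the vertical lift. A linear connection $D$ on $\pi^{-1}(TM)$ is regular if $T_u(\mathcal{T}M)=V_u\oplus H_u$ for all $u$, where $V_u=\ker d\pi$ and $H_u=\{X: D_X\overline\eta=0\}$; then $\beta:=(\rho|_{H})^{-1}$ is its horizontal map. The Cartan connection $\nabla$ is the unique regular connection with $\nabla g=0$, $Q(\overline X,\overline Y):=\mathbf T(\beta\overline X,\beta\overline Y)=0$, and $T(\overline X,\overline Y):=\mathbf T(\gamma\overline X,\beta\overline Y)$ satisfying $g(T(\overline X,\overline Y),\overline Z)=g(T(\overline X,\overline Z),\overline Y)$, where $\mathbf T(X,Y)=\nabla_X\rho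 Y-\nabla_Y\rho X-\rho[X,Y]$. Curvature. $\mathbf K(X,Y)\overline Z=-\nabla_X\nabla_Y\overline Z+\nabla_Y\nabla_X\overline Z+\nabla_{[X,Y]}\overline Z$; $R(\overline X,\overline Y)\overline Z=\mathbf K(\beta\overline X,\beta\overline Y)\overline Z$. The horizontal Ricci tensor is $\mathrm{Ric}(\overline X,\overline Y)=\mathrm{trace}\{\overline Z\mapsto R(\overline X,\overline Z)\overline Y\}$; $\mathrm{Ric}_o$ is the $(1,1)$ tensor with $g(\mathrm{Ric}_o\overline X,\overline Y)=\mathrm{Ric}(\overline X,\overline Y)$. Define the projective curvature tensor $\mathbb P(\overline X,\overline Y)\overline Z=R(\overline X,\overline Y)\overline Z-\frac1{n-1}\{\mathrm{Ric}(\overline X,\overline Z)\overline Y-\mathrm{Ric}(\overline Y,\overline Z)\overline X\}$ and the m-projective curvature tensor $\mathbb H(\overline X,\overline Y)\overline Z=R(\overline X,\overline Y)\overline Z-\frac{1}{2(n-1)}\{\mathrm{Ric}(\overline X,\overline Z)\overline Y-\mathrm{Ric}(\overline Y,\overline Z)\overline X+g(\overline X,\overline Z)\mathrm{Ric}_o\overline Y-g(\overline Y,\overline Z)\mathrm{Ric}_o\overline X\}$. Recurrence. The $h$-covariant derivative of a $\pi$-tensor field $B$ is $(\stackrel{h}{\nabla}B)(\overline W,\dots)=(\nabla_{\beta\overline W}B)(\dots)$. $(M,L)$ is Ricci recurrent (resp. projectively recurrent, m-projectively recurrent) if there is a non-zero $\pi$-form $A$, called the recurrence form, such that $\stackrel{h}{\nabla}\mathrm{Ric}=A\otimes\mathrm{Ric}$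 with $\mathrm{Ric}$ non-zero (resp. $\stackrel{h}{\nabla}\mathbb P=A\otimes\mathbb P$, $\stackrel{h}{\nabla}\mathbb H=A\otimes\mathbb H$). *)

theory Defs
  imports "HOL-Analysis.Analysis" "HOL-Library.Function_Algebras"
begin

text \<open>
  Tangent vectors are represented as operators on functions, so the pointwise real vector space
  structure on a function space is needed. Addition comes from \<open>Function_Algebras\<close>.
\<close>

instantiation "fun" :: (type, real_vector) real_vector
begin

definition scaleR_fun :: "real \<Rightarrow> ('a \<Rightarrow> 'b) \<Rightarrow> 'a \<Rightarrow> 'b"
  where "scaleR_fun r f = (\<lambda>x. r *\<^sub>R f x)"

instance
  by standard (auto simp: scaleR_fun_def fun_eq_iff scaleR_add_right scaleR_add_left)

end


section \<open>Smooth manifolds\<close>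

text \<open>On open sets this is the usual notion of a $C^k$ map between finite-dimensional spaces.\<close>

primrec Ck_on :: "nat \<Rightarrow> 'e::euclidean_space set \<Rightarrow> ('e \<Rightarrow> 'f::real_normed_vector) \<Rightarrow> bool" where
  "Ck_on 0 S f \<longleftrightarrow> continuous_on S f"
| "Ck_on (Suc k) S f \<longleftrightarrow>
     (\<forall>x\<in>S. f differentiable (at x)) \<and> (\<forall>v. Ck_on k S (\<lambda>x. frechet_derivative f (at x) v))"

definition smooth_on :: "'e::euclidean_space set \<Rightarrow> ('e \<Rightarrow> 'f::real_normed_vector) \<Rightarrow> bool"
  where "smooth_on S f \<longleftrightarrow> (\<forall>k. Ck_on k S f)"

text \<open>A chart is a pair of its domain and its coordinate map; only the values of the coordinate
  map on the domain matter.\<close>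

type_synonym ('a, 'e) chart = "'a set \<times> ('a \<Rightarrow> 'e)"

definition smooth_manifold ::
  "('m::{t2_space, second_countable_topology}, 'e::euclidean_space) chart set \<Rightarrow> bool" where
  "smooth_manifold atl \<longleftrightarrow>
     (\<Union>(fst ` atl) = UNIV) \<and>
     (\<forall>(U, \<phi>)\<in>atl. open U \<and> open (\<phi> ` U) \<and> homeomorphism U (\<phi> ` U) \<phi> (inv_into U \<phi>)) \<and>
     (\<forall>(U, \<phi>)\<in>atl. \<forall>(V, \<psi>)\<in>atl. smooth_on (\<phi> ` (U \<inter> V)) (\<psi> \<circ> inv_into U \<phi>))"

text \<open>
  The following notions refer to the atlas only (with the topology induced by the charts). They are
  used both for $M$ and for the slit tangent bundle, which is given by its atlas below.
\<close>

definition near :: "('a, 'e::euclidean_space) chart set \<Rightarrow> 'a \<Rightarrow> ('a \<Rightarrow> bool) \<Rightarrow> bool" where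
  "near atl p P \<longleftrightarrow>
     (\<exists>(U, \<phi>)\<in>atl. p \<in> U \<and> (\<exists>N. open N \<and> \<phi> p \<in> N \<and> N \<subseteq> \<phi> ` U \<and> (\<forall>q\<in>U. \<phi> q \<in> N \<longrightarrow> P q)))"

text \<open>The function is smooth on some neighbourhood of the point.\<close>

definition smooth_near ::
  "('a, 'e::euclidean_space) chart set \<Rightarrow> 'a \<Rightarrow> ('a \<Rightarrow> 'f::real_normed_vector) \<Rightarrow> bool" where
  "smooth_near atl p f \<longleftrightarrow>
     (\<exists>(U, \<phi>)\<in>atl. p \<in> U \<and>
        (\<exists>N. open N \<and> \<phi> p \<in> N \<and> N \<subseteq> \<phi> ` U \<and> smooth_on N (f \<circ> inv_into U \<phi>)))"

text \<open>
  A tangent vector at $p$ is the directional derivative operator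
  $\sum_i y^i\,\partial/\partial x^i|_p$ on functions that are smooth near $p$, extended by $0$ to
  all other functions. \<open>coord_vec atl c p y\<close> is the vector with components $y$ in the chart $c$, and
  \<open>vec_coords \<phi> v\<close> recovers the components $v(x^i)$ of $v$ in the chart with coordinate map
  $\varphi=(x^i)$.
\<close>

type_synonym 'a tvec = "('a \<Rightarrow> real) \<Rightarrow> real"

definition coord_vec ::
  "('a, 'e::euclidean_space) chart set \<Rightarrow> ('a, 'e) chart \<Rightarrow> 'a \<Rightarrow> 'e \<Rightarrow> 'a tvec" where
  "coord_vec atl c p y = (\<lambda>f.
     if smooth_near atl p f
     then frechet_derivative (f \<circ> inv_into (fst c) (snd c)) (at (snd c p)) y
     else 0)"

definition tangent_space :: "('a, 'e::euclidean_space) chart set \<Rightarrow> 'a \<Rightarrow> 'a tvec set" where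
  "tangent_space atl p = {coord_vec atl c p y | c y. c \<in> atl \<and> p \<in> fst c}"

definition vec_coords :: "('a \<Rightarrow> 'e::euclidean_space) \<Rightarrow> 'a tvec \<Rightarrow> 'e" where
  "vec_coords \<phi> v = (\<Sum>b\<in>Basis. v (\<lambda>q. \<phi> q \<bullet> b) *\<^sub>R b)"

text \<open>\<open>X\<close> is a smooth vector field on some neighbourhood of \<open>p\<close>.\<close>

definition vector_field_near ::
  "('a, 'e::euclidean_space) chart set \<Rightarrow> 'a \<Rightarrow> ('a \<Rightarrow> 'a tvec) \<Rightarrow> bool" where
  "vector_field_near atl p X \<longleftrightarrow>
     near atl p (\<lambda>q. X q \<in> tangent_space atl q) \<and>
     (\<forall>(U, \<phi>)\<in>atl. p \<in> U \<longrightarrow> smooth_near atl p (\<lambda>q. vec_coords \<phi> (X q)))"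

definition lie_bracket ::
  "('a, 'e::euclidean_space) chart set \<Rightarrow> ('a \<Rightarrow> 'a tvec) \<Rightarrow> ('a \<Rightarrow> 'a tvec) \<Rightarrow> 'a \<Rightarrow> 'a tvec" where
  "lie_bracket atl X Y = (\<lambda>p f.
     if smooth_near atl p f then X p (\<lambda>q. Y q f) - Y p (\<lambda>q. X q f) else 0)"


section \<open>The slit tangent bundle and the pullback bundle\<close>

text \<open>Points of the slit tangent bundle are pairs \<open>u = (p, v)\<close>; the bundle projection is \<open>fst\<close>. The
  fibre over \<open>u\<close> of the pullback bundle is \<open>tangent_space atl (fst u)\<close>.\<close>

type_synonym 'm tb = "'m \<times> 'm tvec"

definition slit_tb :: "('m, 'e::euclidean_space) chart set \<Rightarrow> 'm tb set" where
  "slit_tb atl = {(p, v). v \<in> tangent_space atl p \<and> v \<noteq> 0}"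

definition slit_atlas ::
  "('m, 'e::euclidean_space) chart set \<Rightarrow> ('m tb, 'e \<times> 'e) chart set" where
  "slit_atlas atl =
     (\<lambda>(U, \<phi>). ({u \<in> slit_tb atl. fst u \<in> U}, \<lambda>u. (\<phi> (fst u), vec_coords \<phi> (snd u)))) ` atl"

abbreviation fibre :: "('m, 'e::euclidean_space) chart set \<Rightarrow> 'm tb \<Rightarrow> 'm tvec set" where
  "fibre atl u \<equiv> tangent_space atl (fst u)"

abbreviation tspace :: "('m, 'e::euclidean_space) chart set \<Rightarrow> 'm tb \<Rightarrow> 'm tb tvec set" where
  "tspace atl u \<equiv> tangent_space (slit_atlas atl) u"

text \<open>\<open>X\<close> is a smooth $\pi$-vector field on some neighbourhood of \<open>u\<close>.\<close>

definition pi_field_near ::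
  "('m, 'e::euclidean_space) chart set \<Rightarrow> 'm tb \<Rightarrow> ('m tb \<Rightarrow> 'm tvec) \<Rightarrow> bool" where
  "pi_field_near atl u X \<longleftrightarrow>
     near (slit_atlas atl) u (\<lambda>w. X w \<in> fibre atl w) \<and>
     (\<forall>(U, \<phi>)\<in>atl. fst u \<in> U \<longrightarrow> smooth_near (slit_atlas atl) u (\<lambda>w. vec_coords \<phi> (X w)))"

definition pi_form ::
  "('m, 'e::euclidean_space) chart set \<Rightarrow> ('m tb \<Rightarrow> 'm tvec \<Rightarrow> real) \<Rightarrow> bool" where
  "pi_form atl A \<longleftrightarrow>
     (\<forall>u\<in>slit_tb atl. \<forall>x\<in>fibre atl u. \<forall>y\<in>fibre atl u. \<forall>a b.
        A u (a *\<^sub>R x + b *\<^sub>R y) = a * A u x + b * A u y) \<and>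
     (\<forall>u\<in>slit_tb atl. \<forall>X. pi_field_near atl u X \<longrightarrow>
        smooth_near (slit_atlas atl) u (\<lambda>w. A w (X w)))"

definition nonzero_form ::
  "('m, 'e::euclidean_space) chart set \<Rightarrow> ('m tb \<Rightarrow> 'm tvec \<Rightarrow> real) \<Rightarrow> bool" where
  "nonzero_form atl A \<longleftrightarrow> (\<exists>u\<in>slit_tb atl. \<exists>x\<in>fibre atl u. A u x \<noteq> 0)"

text \<open>The morphism $\rho$ induced by $d\pi$, and the vertical lift $\gamma$, which sends $x$ to the
  velocity at $t=0$ of the curve $t\mapsto(p,v+tx)$.\<close>

definition rho :: "('m, 'e::euclidean_space) chart set \<Rightarrow> 'm tb \<Rightarrow> 'm tb tvec \<Rightarrow> 'm tvec" where
  "rho atl u X = (\<lambda>f. if smooth_near atl (fst u) f then X (f \<circ> fst) else 0)"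

definition vlift :: "('m, 'e::euclidean_space) chart set \<Rightarrow> 'm tb \<Rightarrow> 'm tvec \<Rightarrow> 'm tb tvec" where
  "vlift atl u x = (\<lambda>f.
     if smooth_near (slit_atlas atl) u f
     then deriv (\<lambda>t. f (fst u, snd u + t *\<^sub>R x)) 0
     else 0)"

definition vertical_space :: "('m, 'e::euclidean_space) chart set \<Rightarrow> 'm tb \<Rightarrow> 'm tb tvec set" where
  "vertical_space atl u = {X \<in> tspace atl u. rho atl u X = 0}"


section \<open>Finsler metrics\<close>

text \<open>
  $g_u(x,y)=\frac12\,\partial_s\partial_t\,L^2(p,v+sx+ty)|_{s=t=0}$, which in coordinates is
  $g_{ij}x^iy^j$ with $g_{ij}=\frac12\,\partial^2L^2/\partial y^i\partial y^j$.
\<close>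

definition finsler_g :: "('m tb \<Rightarrow> real) \<Rightarrow> 'm tb \<Rightarrow> 'm tvec \<Rightarrow> 'm tvec \<Rightarrow> real" where
  "finsler_g L u x y =
     deriv (\<lambda>s. deriv (\<lambda>t. (L (fst u, snd u + s *\<^sub>R x + t *\<^sub>R y))\<^sup>2) 0) 0 / 2"

text \<open>Homogeneity with \<open>r = 0\<close> gives \<open>L (p, 0) = 0\<close>, hence continuity of $L$ on the whole of $TM$.\<close>

definition finsler_manifold ::
  "('m::{t2_space, second_countable_topology}, 'e::euclidean_space) chart set
    \<Rightarrow> ('m tb \<Rightarrow> real) \<Rightarrow> bool" where
  "finsler_manifold atl L \<longleftrightarrow>
     smooth_manifold atl \<and>
     (\<forall>u\<in>slit_tb atl. smooth_near (slit_atlas atl) u L) \<and>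
     (\<forall>u\<in>slit_tb atl. L u > 0) \<and>
     (\<forall>p. \<forall>v\<in>tangent_space atl p. \<forall>r\<ge>0. L (p, r *\<^sub>R v) = r * L (p, v)) \<and>
     (\<forall>u\<in>slit_tb atl. \<forall>x\<in>fibre atl u. x \<noteq> 0 \<longrightarrow> finsler_g L u x x > 0)"


section \<open>Linear connections on the pullback bundle\<close>

text \<open>
  \<open>D u x Y\<close> is the covariant derivative $(D_xY)(u)$ of a $\pi$-vector field \<open>Y\<close>, defined and smooth
  near \<open>u\<close>, along the tangent vector \<open>x\<close> of the slit tangent bundle at \<open>u\<close>. A linear connection on
  global sections induces such an operator and conversely, because $D_XY$ is tensorial in $X$ and
  local in $Y$. (Locality is contained in the Leibniz rule below: \<open>f\<close> may be the indicator function
  of a neighbourhood of \<open>u\<close>.)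
\<close>

type_synonym 'm connection = "'m tb \<Rightarrow> 'm tb tvec \<Rightarrow> ('m tb \<Rightarrow> 'm tvec) \<Rightarrow> 'm tvec"

definition linear_connection ::
  "('m, 'e::euclidean_space) chart set \<Rightarrow> 'm connection \<Rightarrow> bool" where
  "linear_connection atl D \<longleftrightarrow>
     (\<forall>u\<in>slit_tb atl. \<forall>x\<in>tspace atl u. \<forall>Y. pi_field_near atl u Y \<longrightarrow> D u x Y \<in> fibre atl u) \<and>
     (\<forall>u\<in>slit_tb atl. \<forall>x\<in>tspace atl u. \<forall>y\<in>tspace atl u. \<forall>a b. \<forall>Y. pi_field_near atl u Y \<longrightarrow>
        D u (a *\<^sub>R x + b *\<^sub>R y) Y = a *\<^sub>R D u x Y + b *\<^sub>R D u y Y) \<and>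
     (\<forall>u\<in>slit_tb atl. \<forall>x\<in>tspace atl u. \<forall>Y Z. pi_field_near atl u Y \<and> pi_field_near atl u Z \<longrightarrow>
        D u x (\<lambda>w. Y w + Z w) = D u x Y + D u x Z) \<and>
     (\<forall>u\<in>slit_tb atl. \<forall>x\<in>tspace atl u. \<forall>f Y.
        smooth_near (slit_atlas atl) u f \<and> pi_field_near atl u Y \<longrightarrow>
        D u x (\<lambda>w. f w *\<^sub>R Y w) = x f *\<^sub>R Y u + f u *\<^sub>R D u x Y) \<and>
     (\<forall>u\<in>slit_tb atl. \<forall>X Y.
        vector_field_near (slit_atlas atl) u X \<and> pi_field_near atl u Y \<longrightarrow>
        pi_field_near atl u (\<lambda>w. D w (X w) Y))"

text \<open>The fundamental $\pi$-vector field $\overline\eta$ is \<open>snd\<close>.\<close>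

definition horizontal_space ::
  "('m, 'e::euclidean_space) chart set \<Rightarrow> 'm connection \<Rightarrow> 'm tb \<Rightarrow> 'm tb tvec set" where
  "horizontal_space atl D u = {X \<in> tspace atl u. D u X snd = 0}"

definition regular_connection ::
  "('m, 'e::euclidean_space) chart set \<Rightarrow> 'm connection \<Rightarrow> bool" where
  "regular_connection atl D \<longleftrightarrow>
     linear_connection atl D \<and>
     (\<forall>u\<in>slit_tb atl.
        vertical_space atl u \<inter> horizontal_space atl D u = {0} \<and>
        tspace atl u = {x + y | x y. x \<in> vertical_space atl u \<and> y \<in> horizontal_space atl D u})"

definition hmap ::
  "('m, 'e::euclidean_space) chart set \<Rightarrow> 'm connection \<Rightarrow> 'm tb \<Rightarrow> 'm tvec \<Rightarrow> 'm tb tvec" where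
  "hmap atl D u x = (THE h. h \<in> horizontal_space atl D u \<and> rho atl u h = x)"

definition torsion ::
  "('m, 'e::euclidean_space) chart set \<Rightarrow> 'm connection
    \<Rightarrow> ('m tb \<Rightarrow> 'm tb tvec) \<Rightarrow> ('m tb \<Rightarrow> 'm tb tvec) \<Rightarrow> 'm tb \<Rightarrow> 'm tvec" where
  "torsion atl D X Y u =
     D u (X u) (\<lambda>w. rho atl w (Y w)) - D u (Y u) (\<lambda>w. rho atl w (X w))
     - rho atl u (lie_bracket (slit_atlas atl) X Y u)"

definition Q_torsion ::
  "('m, 'e::euclidean_space) chart set \<Rightarrow> 'm connection
    \<Rightarrow> ('m tb \<Rightarrow> 'm tvec) \<Rightarrow> ('m tb \<Rightarrow> 'm tvec) \<Rightarrow> 'm tb \<Rightarrow> 'm tvec" where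
  "Q_torsion atl D X Y = torsion atl D (\<lambda>w. hmap atl D w (X w)) (\<lambda>w. hmap atl D w (Y w))"

definition T_torsion ::
  "('m, 'e::euclidean_space) chart set \<Rightarrow> 'm connection
    \<Rightarrow> ('m tb \<Rightarrow> 'm tvec) \<Rightarrow> ('m tb \<Rightarrow> 'm tvec) \<Rightarrow> 'm tb \<Rightarrow> 'm tvec" where
  "T_torsion atl D X Y = torsion atl D (\<lambda>w. vlift atl w (X w)) (\<lambda>w. hmap atl D w (Y w))"

text \<open>Covariant derivatives of $\pi$-tensor fields of types $(0,2)$ and $(1,3)$, along \<open>x\<close> and
  evaluated on $\pi$-vector fields.\<close>

definition cov_deriv2 ::
  "'m connection \<Rightarrow> ('m tb \<Rightarrow> 'm tvec \<Rightarrow> 'm tvec \<Rightarrow> real) \<Rightarrow> 'm tb \<Rightarrow> 'm tb tvec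
    \<Rightarrow> ('m tb \<Rightarrow> 'm tvec) \<Rightarrow> ('m tb \<Rightarrow> 'm tvec) \<Rightarrow> real" where
  "cov_deriv2 D B u x Y Z =
     x (\<lambda>w. B w (Y w) (Z w)) - B u (D u x Y) (Z u) - B u (Y u) (D u x Z)"

definition cov_deriv13 ::
  "'m connection \<Rightarrow> ('m tb \<Rightarrow> 'm tvec \<Rightarrow> 'm tvec \<Rightarrow> 'm tvec \<Rightarrow> 'm tvec) \<Rightarrow> 'm tb \<Rightarrow> 'm tb tvec
    \<Rightarrow> ('m tb \<Rightarrow> 'm tvec) \<Rightarrow> ('m tb \<Rightarrow> 'm tvec) \<Rightarrow> ('m tb \<Rightarrow> 'm tvec) \<Rightarrow> 'm tvec" where
  "cov_deriv13 D B u x X Y Z =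
     D u x (\<lambda>w. B w (X w) (Y w) (Z w))
     - B u (D u x X) (Y u) (Z u) - B u (X u) (D u x Y) (Z u) - B u (X u) (Y u) (D u x Z)"

definition cartan_connection ::
  "('m, 'e::euclidean_space) chart set \<Rightarrow> ('m tb \<Rightarrow> real) \<Rightarrow> 'm connection \<Rightarrow> bool" where
  "cartan_connection atl L D \<longleftrightarrow>
     regular_connection atl D \<and>
     (\<forall>u\<in>slit_tb atl. \<forall>x\<in>tspace atl u. \<forall>Y Z. pi_field_near atl u Y \<and> pi_field_near atl u Z \<longrightarrow>
        cov_deriv2 D (finsler_g L) u x Y Z = 0) \<and>
     (\<forall>u\<in>slit_tb atl. \<forall>X Y. pi_field_near atl u X \<and> pi_field_near atl u Y \<longrightarrow>
        Q_torsion atl D X Y u = 0) \<and>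
     (\<forall>u\<in>slit_tb atl. \<forall>X Y Z.
        pi_field_near atl u X \<and> pi_field_near atl u Y \<and> pi_field_near atl u Z \<longrightarrow>
        finsler_g L u (T_torsion atl D X Y u) (Z u) = finsler_g L u (T_torsion atl D X Z u) (Y u))"


section \<open>Curvature\<close>

definition curvature ::
  "('m, 'e::euclidean_space) chart set \<Rightarrow> 'm connection
    \<Rightarrow> ('m tb \<Rightarrow> 'm tb tvec) \<Rightarrow> ('m tb \<Rightarrow> 'm tb tvec) \<Rightarrow> ('m tb \<Rightarrow> 'm tvec) \<Rightarrow> 'm tb \<Rightarrow> 'm tvec" where
  "curvature atl D X Y Z u =
     - D u (X u) (\<lambda>w. D w (Y w) Z) + D u (Y u) (\<lambda>w. D w (X w) Z)
     + D u (lie_bracket (slit_atlas atl) X Y u) Z"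

text \<open>The curvature is tensorial, so its value on vectors is obtained by extending them to arbitrary
  $\pi$-vector fields.\<close>

definition pi_extension ::
  "('m, 'e::euclidean_space) chart set \<Rightarrow> 'm tb \<Rightarrow> 'm tvec \<Rightarrow> 'm tb \<Rightarrow> 'm tvec" where
  "pi_extension atl u x = (SOME X. pi_field_near atl u X \<and> X u = x)"

definition hcurv ::
  "('m, 'e::euclidean_space) chart set \<Rightarrow> 'm connection
    \<Rightarrow> 'm tb \<Rightarrow> 'm tvec \<Rightarrow> 'm tvec \<Rightarrow> 'm tvec \<Rightarrow> 'm tvec" where
  "hcurv atl D u x y z =
     curvature atl D (\<lambda>w. hmap atl D w (pi_extension atl u x w))
       (\<lambda>w. hmap atl D w (pi_extension atl u y w)) (pi_extension atl u z) u"

text \<open>The trace of an endomorphism \<open>F\<close> of the finite-dimensional subspace \<open>V\<close>, computed in an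
  arbitrary basis.\<close>

definition trace_on :: "'v::real_vector set \<Rightarrow> ('v \<Rightarrow> 'v) \<Rightarrow> real" where
  "trace_on V F =
     (let B = (SOME B. independent B \<and> span B = V) in \<Sum>b\<in>B. representation B (F b) b)"

definition Ric ::
  "('m, 'e::euclidean_space) chart set \<Rightarrow> 'm connection \<Rightarrow> 'm tb \<Rightarrow> 'm tvec \<Rightarrow> 'm tvec \<Rightarrow> real" where
  "Ric atl D u x y = trace_on (fibre atl u) (\<lambda>z. hcurv atl D u x z y)"

definition Ric_o ::
  "('m, 'e::euclidean_space) chart set \<Rightarrow> ('m tb \<Rightarrow> real) \<Rightarrow> 'm connection
    \<Rightarrow> 'm tb \<Rightarrow> 'm tvec \<Rightarrow> 'm tvec" where
  "Ric_o atl L D u x =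
     (THE z. z \<in> fibre atl u \<and> (\<forall>y\<in>fibre atl u. finsler_g L u z y = Ric atl D u x y))"

text \<open>From here on the dimension $n$ is \<open>CARD('n)\<close>.\<close>

definition proj_curv ::
  "('m, real^'n) chart set \<Rightarrow> 'm connection \<Rightarrow> 'm tb \<Rightarrow> 'm tvec \<Rightarrow> 'm tvec \<Rightarrow> 'm tvec \<Rightarrow> 'm tvec" where
  "proj_curv atl D u x y z =
     hcurv atl D u x y z
     - (1 / (real CARD('n) - 1)) *\<^sub>R (Ric atl D u x z *\<^sub>R y - Ric atl D u y z *\<^sub>R x)"

definition m_proj_curv ::
  "('m, real^'n) chart set \<Rightarrow> ('m tb \<Rightarrow> real) \<Rightarrow> 'm connection
    \<Rightarrow> 'm tb \<Rightarrow> 'm tvec \<Rightarrow> 'm tvec \<Rightarrow> 'm tvec \<Rightarrow> 'm tvec" where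
  "m_proj_curv atl L D u x y z =
     hcurv atl D u x y z
     - (1 / (2 * (real CARD('n) - 1))) *\<^sub>R
         (Ric atl D u x z *\<^sub>R y - Ric atl D u y z *\<^sub>R x
          + finsler_g L u x z *\<^sub>R Ric_o atl L D u y - finsler_g L u y z *\<^sub>R Ric_o atl L D u x)"


section \<open>Recurrence\<close>

text \<open>\<open>D\<close> is meant to be the Cartan connection of $(M,L)$, and \<open>A\<close> is the recurrence form. The
  $h$-covariant derivative in the direction \<open>w\<close> is the one along the horizontal vector
  \<open>hmap atl D u w\<close>.\<close>

definition ricci_recurrent ::
  "('m, real^'n) chart set \<Rightarrow> 'm connection \<Rightarrow> ('m tb \<Rightarrow> 'm tvec \<Rightarrow> real) \<Rightarrow> bool" where
  "ricci_recurrent atl D A \<longleftrightarrow>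
     pi_form atl A \<and> nonzero_form atl A \<and>
     (\<exists>u\<in>slit_tb atl. \<exists>x\<in>fibre atl u. \<exists>y\<in>fibre atl u. Ric atl D u x y \<noteq> 0) \<and>
     (\<forall>u\<in>slit_tb atl. \<forall>w\<in>fibre atl u. \<forall>X Y. pi_field_near atl u X \<and> pi_field_near atl u Y \<longrightarrow>
        cov_deriv2 D (Ric atl D) u (hmap atl D u w) X Y = A u w * Ric atl D u (X u) (Y u))"

definition recurrent13 ::
  "('m, real^'n) chart set \<Rightarrow> 'm connection
    \<Rightarrow> ('m tb \<Rightarrow> 'm tvec \<Rightarrow> 'm tvec \<Rightarrow> 'm tvec \<Rightarrow> 'm tvec) \<Rightarrow> ('m tb \<Rightarrow> 'm tvec \<Rightarrow> real) \<Rightarrow> bool" where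
  "recurrent13 atl D B A \<longleftrightarrow>
     pi_form atl A \<and> nonzero_form atl A \<and>
     (\<forall>u\<in>slit_tb atl. \<forall>w\<in>fibre atl u. \<forall>X Y Z.
        pi_field_near atl u X \<and> pi_field_near atl u Y \<and> pi_field_near atl u Z \<longrightarrow>
        cov_deriv13 D B u (hmap atl D u w) X Y Z = A u w *\<^sub>R B u (X u) (Y u) (Z u))"

definition projectively_recurrent ::
  "('m, real^'n) chart set \<Rightarrow> 'm connection \<Rightarrow> ('m tb \<Rightarrow> 'm tvec \<Rightarrow> real) \<Rightarrow> bool" where
  "projectively_recurrent atl D A \<longleftrightarrow> recurrent13 atl D (proj_curv atl D) A"

definition m_projectively_recurrent ::
  "('m, real^'n) chart set \<Rightarrow> ('m tb \<Rightarrow> real) \<Rightarrow> 'm connection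
    \<Rightarrow> ('m tb \<Rightarrow> 'm tvec \<Rightarrow> real) \<Rightarrow> bool" where
  "m_projectively_recurrent atl L D A \<longleftrightarrow> recurrent13 atl D (m_proj_curv atl L D) A"

end

theory Submission
  imports Defs
begin

text \<open>
  Write $c=\frac1{n-1}$. Lowering the last index with \<open>g\<close> makes the relation between the two tensors
  visible. Since the connection is metric, $R(\overline X,\overline Y)$ is skew for \<open>g\<close>. The
  Ricci part of $\mathbb H$ is the skew part of the Ricci part of $\mathbb P$, so that
  $\mathbb H$ is the skew part of $\mathbb P$:
  $2g(\mathbb H(\overline X,\overline Y)\overline Z,\overline W)=g(\mathbb P(\overline X,\overline Y)\overline Z,\overline W)
  -g(\mathbb P(\overline X,\overline Y)\overline W,\overline Z)$ (\<open>H_skew_part_of_P\<close>). As \<open>g\<close> is parallel, taking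
  skew parts commutes with the covariant derivative, and a recurrence form of $\mathbb P$ is one of
  $\mathbb H$ (\<open>P_recurrent_imp_H_recurrent\<close>).

  For the converse let \<open>A\<close> be the recurrence form of \<open>Ric\<close> and \<open>B\<close> that of $\mathbb H$. All products of \<open>Ric\<close> with \<open>g\<close>
  are recurrent with the form \<open>A\<close> (\<open>ricci_product_recurrent\<close>), and
  $\mathbb P=\mathbb H-\frac c2U$, where \<open>U\<close> is built from such products. Hence $\mathbb P$ is recurrent with the
  form \<open>B\<close> as soon as $(A-B)\otimes U=0$. Now $R=\mathbb H+\frac c2S$ with a tensor \<open>S\<close> of the same kind, which gives
  $\stackrel{h}{\nabla}R=B\otimes R+\frac c2(A-B)\otimes S$. Contraction commutes with the covariant derivative
  (\<open>cov_deriv_ric\<close>), and contracting this equation yields $(A-B)\otimes(n\,\mathrm{Ric}-r\,g)=0$, where $r$ is the trace of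
  $\mathrm{Ric}_o$. At a point and in a direction in which \<open>A\<close> and \<open>B\<close> differ, \<open>Ric\<close> is therefore a multiple of \<open>g\<close>,
  and for such a \<open>Ric\<close> the tensor \<open>U\<close> vanishes (\<open>H_recurrent_imp_P_recurrent\<close>).

  These computations differentiate \<open>R\<close>, \<open>Ric\<close>, \<open>Ric_o\<close> and \<open>g\<close>, so they need that these are smooth tensor fields, and
  most of the text below establishes that. The curvature is tensorial (\<open>hcurv_eq\<close>); its smoothness rests on that of
  horizontal lifts (\<open>hmap_smooth\<close>) and of Lie brackets (\<open>lie_bracket_vector_field\<close>). Horizontal lifts and \<open>Ric_o\<close> are
  solutions of linear systems, to which Cramer's rule applies. The metric is a second fibre derivative of $L^2$
  (\<open>g_coords\<close>), and the trace that defines \<open>Ric\<close> can be taken in a local frame (\<open>trace_on_fibre\<close>).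
\<close>

section \<open>Smooth maps between Euclidean spaces\<close>

lemma Ck_on_subset: "Ck_on k S f \<Longrightarrow> T \<subseteq> S \<Longrightarrow> Ck_on k T f"
  by (induction k arbitrary: f) (auto intro: continuous_on_subset)

lemma Ck_on_cong:
  assumes "open S" "\<And>x. x \<in> S \<Longrightarrow> f x = g x" "Ck_on k S f"
  shows "Ck_on k S g"
  using assms(2,3)
proof (induction k arbitrary: f g)
  case 0
  then show ?case by (metis Ck_on.simps(1) continuous_on_cong)
next
  case (Suc k)
  have "g differentiable (at x)" "frechet_derivative f (at x) = frechet_derivative g (at x)"
    if "x \<in> S" for x
  proof -
    have "f differentiable (at x)" using Suc.prems that by auto
    then show "g differentiable (at x)"
      by (meson Suc.prems(1) assms(1) differentiable_def has_derivative_transform_within_open that)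
    show "frechet_derivative f (at x) = frechet_derivative g (at x)"
      using Suc.prems(1) \<open>f differentiable (at x)\<close> assms(1)
        frechet_derivative_transform_within_open that by blast
  qed
  then show ?case
    using Suc.prems Suc.IH[of "\<lambda>x. frechet_derivative f (at x) _" "\<lambda>x. frechet_derivative g (at x) _"]
    by auto
qed

lemma Ck_on_SucI:
  assumes "open S" "\<And>x. x \<in> S \<Longrightarrow> (f has_derivative f' x) (at x)"
    and "\<And>v. Ck_on k S (\<lambda>x. f' x v)"
  shows "Ck_on (Suc k) S f"
proof -
  have "frechet_derivative f (at x) = f' x" if "x \<in> S" for x
    using assms(2)[OF that] frechet_derivative_at by metis
  then have "Ck_on k S (\<lambda>x. frechet_derivative f (at x) v)" for v
    using Ck_on_cong[OF assms(1) _ assms(3)[of v]] by auto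
  then show ?thesis using assms(2) by (auto simp: differentiable_def)
qed

lemma Ck_on_SucD: "Ck_on (Suc k) S f \<Longrightarrow> Ck_on k S f"
proof (induction k arbitrary: f)
  case 0
  then show ?case
    by (auto intro!: continuous_at_imp_continuous_on differentiable_imp_continuous_within)
next
  case (Suc k)
  then show ?case by simp
qed

lemma Ck_on_has_derivative:
  "Ck_on (Suc k) S f \<Longrightarrow> x \<in> S \<Longrightarrow> (f has_derivative frechet_derivative f (at x)) (at x)"
  by (simp add: frechet_derivative_works[symmetric])

lemma Ck_on_const: "open S \<Longrightarrow> Ck_on k S (\<lambda>x. c)"
proof (induction k arbitrary: c)
  case (Suc k)
  show ?case by (rule Ck_on_SucI[where f'="\<lambda>x v. 0"]) (use Suc in auto)
qed auto

lemma Ck_on_bounded_linear: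
  assumes "open S" "bounded_linear h" "Ck_on k S f"
  shows "Ck_on k S (\<lambda>x. h (f x))"
  using assms(3)
proof (induction k arbitrary: f)
  case 0
  then show ?case using assms bounded_linear.continuous_on by auto
next
  case (Suc k)
  show ?case
  proof (rule Ck_on_SucI[OF assms(1)])
    show "((\<lambda>x. h (f x)) has_derivative (\<lambda>v. h (frechet_derivative f (at x) v))) (at x)" 
      if "x \<in> S" for x
      using bounded_linear.has_derivative[OF assms(2) Ck_on_has_derivative[OF Suc.prems that]] .
  qed (use Suc in auto)
qed

lemma Ck_on_ident: "open S \<Longrightarrow> Ck_on k S (\<lambda>x. x)"
proof (cases k)
  case (Suc k)
  assume "open S"
  then show ?thesis unfolding Suc
    by (intro Ck_on_SucI[where f'="\<lambda>x v. v"] Ck_on_const) auto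
qed auto

lemma Ck_on_add:
  assumes "open S" "Ck_on k S f" "Ck_on k S g"
  shows "Ck_on k S (\<lambda>x. f x + g x)"
  using assms(2,3)
proof (induction k arbitrary: f g)
  case 0
  then show ?case by (auto intro: continuous_on_add)
next
  case (Suc k)
  show ?case
  proof (rule Ck_on_SucI[OF assms(1)])
    show "((\<lambda>x. f x + g x) has_derivative
      (\<lambda>v. frechet_derivative f (at x) v + frechet_derivative g (at x) v)) (at x)" 
      if "x \<in> S" for x
      using that Suc.prems by (intro has_derivative_add Ck_on_has_derivative)
  qed (use Suc in auto)
qed

lemma Ck_on_scaleR:
  assumes "open S" "Ck_on k S f" "Ck_on k S g"
  shows "Ck_on k S (\<lambda>x. f x *\<^sub>R g x)"
  using assms(2,3)
proof (induction k arbitrary: f g)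
  case 0
  then show ?case by (auto intro: continuous_on_scaleR)
next
  case (Suc k)
  show ?case
  proof (rule Ck_on_SucI[OF assms(1)])
    show "((\<lambda>x. f x *\<^sub>R g x) has_derivative
      (\<lambda>v. f x *\<^sub>R frechet_derivative g (at x) v + frechet_derivative f (at x) v *\<^sub>R g x)) (at x)" 
      if "x \<in> S" for x
      using that Suc.prems by (intro has_derivative_scaleR Ck_on_has_derivative)
    show "Ck_on k S (\<lambda>x. f x *\<^sub>R frechet_derivative g (at x) v + frechet_derivative f (at x) v *\<^sub>R g x)" for v
      using Suc.prems Ck_on_SucD[of k S f] Ck_on_SucD[of k S g]
      by (intro Ck_on_add assms Suc.IH) auto
  qed
qed

lemma Ck_on_sum:
  assumes "open S" "\<And>i. i \<in> I \<Longrightarrow> Ck_on k S (f i)"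
  shows "Ck_on k S (\<lambda>x. \<Sum>i\<in>I. f i x)"
  using assms(2)
  by (induction I rule: infinite_finite_induct) (auto intro: Ck_on_const Ck_on_add assms)

lemma linear_eq_sum_Basis:
  fixes h :: "'a::euclidean_space \<Rightarrow> 'b::real_vector"
  assumes "linear h"
  shows "h v = (\<Sum>b\<in>Basis. (v \<bullet> b) *\<^sub>R h b)"
proof -
  have "h v = h (\<Sum>b\<in>Basis. (v \<bullet> b) *\<^sub>R b)" by (simp add: euclidean_representation)
  also have "\<dots> = (\<Sum>b\<in>Basis. (v \<bullet> b) *\<^sub>R h b)"
    using assms by (simp add: linear_sum linear_scale)
  finally show ?thesis .
qed

text \<open>\<open>Ck_on\<close> speaks of derivatives in constant directions only, whereas the chain rule differentiates \<open>g\<close> in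
  the direction \<open>f'(x) v\<close>, which varies. Expanding this direction in the standard basis gives products of
  functions to which the induction hypothesis applies.\<close>

lemma Ck_on_compose:
  assumes "open S" "open T" "Ck_on k S f" "Ck_on k T g" "f ` S \<subseteq> T"
  shows "Ck_on k S (\<lambda>x. g (f x))"
  using assms(3-)
proof (induction k arbitrary: f g)
  case 0
  then show ?case by (auto intro: continuous_on_compose2)
next
  case (Suc k)
  show ?case
  proof (rule Ck_on_SucI[OF assms(1)])
    fix x assume x: "x \<in> S"
    have f: "(f has_derivative frechet_derivative f (at x)) (at x)"
      using Suc.prems x by (intro Ck_on_has_derivative)
    have g: "(g has_derivative frechet_derivative g (at (f x))) (at (f x))"
      using Suc.prems x by (intro Ck_on_has_derivative) auto
    have "linear (frechet_derivative g (at (f x)))"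
      using g has_derivative_linear by blast
    then have "(\<lambda>v. frechet_derivative g (at (f x)) (frechet_derivative f (at x) v)) =
       (\<lambda>v. \<Sum>b\<in>Basis. (frechet_derivative f (at x) v \<bullet> b) *\<^sub>R frechet_derivative g (at (f x)) b)"
      using linear_eq_sum_Basis by blast
    then show "((\<lambda>x. g (f x)) has_derivative 
       (\<lambda>v. \<Sum>b\<in>Basis. (frechet_derivative f (at x) v \<bullet> b) *\<^sub>R frechet_derivative g (at (f x)) b)) (at x)"
      using has_derivative_compose[OF f g] by simp
  next
    have "Ck_on k S f" using Suc.prems Ck_on_SucD by blast
    then show "Ck_on k S (\<lambda>x. \<Sum>b\<in>Basis. (frechet_derivative f (at x) v \<bullet> b) *\<^sub>R frechet_derivative g (at (f x)) b)" for v
      using Suc.prems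
      by (intro Ck_on_sum Ck_on_scaleR assms(1) Suc.IH[of f "\<lambda>y. frechet_derivative g (at y) _"] 
           Ck_on_bounded_linear[OF assms(1) bounded_linear_inner_left]) auto
  qed
qed

lemma Ck_on_inverse:
  fixes f :: "'a::euclidean_space \<Rightarrow> real"
  assumes "open S" "Ck_on k S f" "\<And>x. x \<in> S \<Longrightarrow> f x \<noteq> 0"
  shows "Ck_on k S (\<lambda>x. inverse (f x))"
  using assms(2)
proof (induction k)
  case 0
  then show ?case using assms by (auto intro: continuous_on_inverse)
next
  case (Suc k)
  show ?case
  proof (rule Ck_on_SucI[OF assms(1)])
    show "((\<lambda>x. inverse (f x)) has_derivative
      (\<lambda>v. - (inverse (f x) * frechet_derivative f (at x) v * inverse (f x)))) (at x)" 
      if "x \<in> S" for x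
      using Derivative.has_derivative_inverse assms(3)[OF that]
        Ck_on_has_derivative[OF Suc.prems that] Deriv.has_derivative_inverse by blast
    have *: "Ck_on k S (\<lambda>x. inverse (f x))" using Suc.IH Suc.prems Ck_on_SucD by blast
    have "Ck_on k S (\<lambda>x. - ((inverse (f x) *\<^sub>R frechet_derivative f (at x) v) *\<^sub>R inverse (f x)))" for v
      by (intro Ck_on_bounded_linear[OF assms(1) bounded_linear_minus[OF bounded_linear_ident]] Ck_on_scaleR assms(1) *)
        (use Suc.prems in auto)
    then show "Ck_on k S (\<lambda>x. - (inverse (f x) * frechet_derivative f (at x) v * inverse (f x)))" for v
      by simp
  qed
qed

text \<open>Smoothness of a germ. It agrees with \<open>smooth_near\<close> once a chart is fixed, and it frees the calculus below
  from keeping track of neighbourhoods.\<close>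

definition smooth_at :: "'e::euclidean_space \<Rightarrow> ('e \<Rightarrow> 'f::real_normed_vector) \<Rightarrow> bool"
  where "smooth_at x F \<longleftrightarrow> (\<exists>N. open N \<and> x \<in> N \<and> smooth_on N F)"

lemma smooth_on_subset: "smooth_on S f \<Longrightarrow> T \<subseteq> S \<Longrightarrow> smooth_on T f"
  unfolding smooth_on_def using Ck_on_subset by blast

lemma smooth_at_eventually: "smooth_at x F \<Longrightarrow> eventually (\<lambda>z. smooth_at z F) (nhds x)"
  unfolding smooth_at_def eventually_nhds by blast

lemma smooth_at_cong:
  assumes "smooth_at x F" "eventually (\<lambda>z. F z = G z) (nhds x)"
  shows "smooth_at x G"
proof -
  obtain N where N: "open N" "x \<in> N" "smooth_on N F" using assms(1) smooth_at_def by blast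
  obtain S where S: "open S" "x \<in> S" "\<And>z. z \<in> S \<Longrightarrow> F z = G z"
    using assms(2) unfolding eventually_nhds by blast
  have "smooth_on (N \<inter> S) G"
    using N S Ck_on_cong[of "N \<inter> S" F G] smooth_on_subset[OF N(3), of "N \<inter> S"]
    unfolding smooth_on_def by (simp add: open_Int)
  then show ?thesis unfolding smooth_at_def using N S by (meson IntI open_Int)
qed

lemma smooth_at_binary:
  assumes "smooth_at x F" "smooth_at x G"
    and "\<And>k S. open S \<Longrightarrow> Ck_on k S F \<Longrightarrow> Ck_on k S G \<Longrightarrow> Ck_on k S H"
  shows "smooth_at x H"
proof -
  obtain M where M: "open M" "x \<in> M" "smooth_on M F" using assms(1) smooth_at_def by blast
  obtain N where N: "open N" "x \<in> N" "smooth_on N G" using assms(2) smooth_at_def by blast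
  have "smooth_on (M \<inter> N) H"
    using assms(3)[of "M \<inter> N"] smooth_on_subset[OF M(3), of "M \<inter> N"] 
      smooth_on_subset[OF N(3), of "M \<inter> N"] M N
    unfolding smooth_on_def by (simp add: open_Int)
  then show ?thesis unfolding smooth_at_def using N M by (meson IntI open_Int)
qed

lemma smooth_at_const: "smooth_at x (\<lambda>z. c)"
  unfolding smooth_at_def smooth_on_def by (intro exI[of _ UNIV]) (simp add: Ck_on_const)

lemma smooth_at_ident: "smooth_at x (\<lambda>z. z)"
  unfolding smooth_at_def smooth_on_def by (intro exI[of _ UNIV]) (simp add: Ck_on_ident)

lemma smooth_at_bounded_linear: "bounded_linear h \<Longrightarrow> smooth_at x F \<Longrightarrow> smooth_at x (\<lambda>z. h (F z))"
  by (rule smooth_at_binary[of x F F]) (auto intro: Ck_on_bounded_linear)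

lemma smooth_at_add: "smooth_at x F \<Longrightarrow> smooth_at x G \<Longrightarrow> smooth_at x (\<lambda>z. F z + G z)"
  by (rule smooth_at_binary[of x F G]) (auto intro: Ck_on_add)

lemma smooth_at_scaleR: "smooth_at x F \<Longrightarrow> smooth_at x G \<Longrightarrow> smooth_at x (\<lambda>z. F z *\<^sub>R G z)"
  by (rule smooth_at_binary[of x F G]) (auto intro: Ck_on_scaleR)

lemma smooth_at_mult:
  fixes F G :: "_ \<Rightarrow> real"
  shows "smooth_at x F \<Longrightarrow> smooth_at x G \<Longrightarrow> smooth_at x (\<lambda>z. F z * G z)"
  using smooth_at_scaleR[of x F G] by simp

lemma smooth_at_minus: "smooth_at x F \<Longrightarrow> smooth_at x (\<lambda>z. - F z)"
  using smooth_at_bounded_linear[OF bounded_linear_minus[OF bounded_linear_ident]] .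

lemma smooth_at_diff: "smooth_at x F \<Longrightarrow> smooth_at x G \<Longrightarrow> smooth_at x (\<lambda>z. F z - G z)"
  using smooth_at_add[of x F "\<lambda>z. - G z"] smooth_at_minus[of x G] by simp

lemma smooth_at_sum:
  "(\<And>i. i \<in> I \<Longrightarrow> smooth_at x (F i)) \<Longrightarrow> smooth_at x (\<lambda>z. \<Sum>i\<in>I. F i z)"
  by (induction I rule: infinite_finite_induct) (auto intro: smooth_at_const smooth_at_add)

lemma smooth_at_prod:
  fixes F :: "_ \<Rightarrow> _ \<Rightarrow> real"
  shows "(\<And>i. i \<in> I \<Longrightarrow> smooth_at x (F i)) \<Longrightarrow> smooth_at x (\<lambda>z. \<Prod>i\<in>I. F i z)"
  by (induction I rule: infinite_finite_induct) (auto intro: smooth_at_const smooth_at_mult)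

lemma smooth_at_inner_const: "smooth_at x F \<Longrightarrow> smooth_at x (\<lambda>z. F z \<bullet> b)"
  using smooth_at_bounded_linear[OF bounded_linear_inner_left] .

lemma smooth_at_componentwise:
  fixes F :: "_ \<Rightarrow> 'b::euclidean_space"
  shows "(\<And>b. b \<in> Basis \<Longrightarrow> smooth_at x (\<lambda>z. F z \<bullet> b)) \<Longrightarrow> smooth_at x F"
  using smooth_at_sum[of Basis x "\<lambda>b z. (F z \<bullet> b) *\<^sub>R b", OF smooth_at_scaleR[OF _ smooth_at_const]]
  by (simp add: euclidean_representation)

lemma smooth_at_Pair:
  assumes "smooth_at x F" "smooth_at x G"
  shows "smooth_at x (\<lambda>z. (F z, G z))"
proof -
  have 1: "bounded_linear (\<lambda>a. (a, 0))" "bounded_linear (\<lambda>b. (0, b))"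
    by (intro bounded_linear_Pair bounded_linear_ident bounded_linear_zero)+
  show ?thesis
    using smooth_at_add[OF smooth_at_bounded_linear[OF 1(1) assms(1)] smooth_at_bounded_linear[OF 1(2) assms(2)]]
    by simp
qed

lemma smooth_at_fst: "smooth_at x F \<Longrightarrow> smooth_at x (\<lambda>z. fst (F z))"
  and smooth_at_snd: "smooth_at x F \<Longrightarrow> smooth_at x (\<lambda>z. snd (F z))"
  using smooth_at_bounded_linear[OF bounded_linear_fst] smooth_at_bounded_linear[OF bounded_linear_snd]
  by blast+

lemma smooth_at_differentiable: "smooth_at x F \<Longrightarrow> F differentiable (at x)"
  unfolding smooth_at_def smooth_on_def using Ck_on.simps(2) by blast

lemma smooth_at_has_derivative:
  "smooth_at x F \<Longrightarrow> (F has_derivative frechet_derivative F (at x)) (at x)"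
  by (simp add: frechet_derivative_works[symmetric] smooth_at_differentiable)

lemma smooth_at_isCont: "smooth_at x F \<Longrightarrow> isCont F x"
  using smooth_at_differentiable differentiable_imp_continuous_within by blast

lemma smooth_at_tendsto: "smooth_at x F \<Longrightarrow> (F \<longlongrightarrow> F x) (nhds x)"
  using smooth_at_isCont isCont_def tendsto_at_iff_tendsto_nhds by blast

lemma smooth_at_linear_derivative: "smooth_at x F \<Longrightarrow> linear (frechet_derivative F (at x))"
  using linear_frechet_derivative smooth_at_differentiable by blast

lemma smooth_at_compose:
  assumes "smooth_at x F" "smooth_at (F x) G"
  shows "smooth_at x (\<lambda>z. G (F z))"
proof -
  obtain M where M: "open M" "x \<in> M" "smooth_on M F" using assms(1) smooth_at_def by blast
  obtain N where N: "open N" "F x \<in> N" "smooth_on N G" using assms(2) smooth_at_def by blast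
  have "eventually (\<lambda>z. F z \<in> N) (nhds x)"
    using smooth_at_tendsto[OF assms(1)] N topological_tendstoD by blast
  then obtain S where S: "open S" "x \<in> S" "\<And>z. z \<in> S \<Longrightarrow> F z \<in> N"
    unfolding eventually_nhds by blast
  have "smooth_on (M \<inter> S) (\<lambda>z. G (F z))"
    unfolding smooth_on_def
  proof
    fix k
    show "Ck_on k (M \<inter> S) (\<lambda>z. G (F z))"
      by (rule Ck_on_compose[of _ N])
        (use M N S smooth_on_subset[OF M(3), of "M \<inter> S"] in \<open>auto simp: smooth_on_def\<close>)
  qed
  then show ?thesis unfolding smooth_at_def using S M by (meson IntI open_Int)
qed

lemma smooth_at_inverse:
  fixes F :: "_ \<Rightarrow> real"
  assumes "smooth_at x F" "F x \<noteq> 0"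
  shows "smooth_at x (\<lambda>z. inverse (F z))"
proof -
  have "smooth_on (-{0}) (\<lambda>r::real. inverse r)"
    unfolding smooth_on_def by (intro allI Ck_on_inverse[of "-{0}" _ "\<lambda>r. r"] Ck_on_ident) (auto simp: open_Compl)
  then have "smooth_at (F x) (\<lambda>r. inverse r)"
    unfolding smooth_at_def using assms(2) by (intro exI[of _ "-{0}"]) (auto simp: open_Compl)
  then show ?thesis using smooth_at_compose assms(1) by blast
qed

lemma smooth_at_divide:
  fixes F :: "_ \<Rightarrow> real"
  assumes "smooth_at x F" "smooth_at x G" "G x \<noteq> 0"
  shows "smooth_at x (\<lambda>z. F z / G z)"
  using smooth_at_mult[OF assms(1) smooth_at_inverse[OF assms(2,3)]] by (simp add: divide_inverse)

lemma smooth_at_derivative: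
  fixes F :: "'a::euclidean_space \<Rightarrow> 'b::real_normed_vector"
  assumes "smooth_at x F" "smooth_at x G"
  shows "smooth_at x (\<lambda>z. frechet_derivative F (at z) (G z))"
proof -
  obtain M where M: "open M" "x \<in> M" "smooth_on M F" using assms(1) smooth_at_def by blast
  have "Ck_on k M (\<lambda>z. frechet_derivative F (at z) b)" for b k
    using M(3) unfolding smooth_on_def by (metis Ck_on.simps(2))
  then have "smooth_at x (\<lambda>z. frechet_derivative F (at z) b)" for b
    using M unfolding smooth_at_def smooth_on_def by blast
  then have "smooth_at x (\<lambda>z. \<Sum>b\<in>Basis. (G z \<bullet> b) *\<^sub>R frechet_derivative F (at z) b)"
    by (intro smooth_at_sum smooth_at_scaleR smooth_at_inner_const assms(2)) auto
  moreover have "eventually (\<lambda>z. (\<Sum>b\<in>Basis. (G z \<bullet> b) *\<^sub>R frechet_derivative F (at z) b) =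
      frechet_derivative F (at z) (G z)) (nhds x)"
    using smooth_at_eventually[OF assms(1)]
    by eventually_elim (use linear_eq_sum_Basis smooth_at_linear_derivative in metis)
  ultimately show ?thesis by (rule smooth_at_cong)
qed

lemma frechet_derivative_cong:
  fixes F G :: "'a::real_normed_vector \<Rightarrow> 'b::real_normed_vector"
  assumes "eventually (\<lambda>z. F z = G z) (nhds x)"
  shows "frechet_derivative F (at x) = frechet_derivative G (at x)"
proof -
  have *: "(G has_derivative D) (at x)" 
    if "(F has_derivative D) (at x)" "eventually (\<lambda>z. F z = G z) (nhds x)" for D and F G :: "'a \<Rightarrow> 'b"
    using that eventually_nhds_x_imp_x[OF that(2)]
    by (intro has_derivative_transform_eventually[OF that(1)]) (auto simp: eventually_at_filter elim: eventually_mono)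
  have "eventually (\<lambda>z. G z = F z) (nhds x)" using assms by eventually_elim simp
  then have "(F has_derivative D) (at x) \<longleftrightarrow> (G has_derivative D) (at x)" for D
    using *[of F D G] *[of G D F] assms by blast
  then show ?thesis unfolding frechet_derivative_def by simp
qed

lemma frechet_derivative_chain:
  assumes "smooth_at x F" "smooth_at (F x) G"
  shows "frechet_derivative (\<lambda>z. G (F z)) (at x) v =
    frechet_derivative G (at (F x)) (frechet_derivative F (at x) v)"
  using frechet_derivative_at[OF has_derivative_compose[OF smooth_at_has_derivative[OF assms(1)]
      smooth_at_has_derivative[OF assms(2)]]] by metis

lemma frechet_derivative_scaleR:
  assumes "smooth_at x F" "smooth_at x G"
  shows "frechet_derivative (\<lambda>z. F z *\<^sub>R G z) (at x) v =
    F x *\<^sub>R frechet_derivative G (at x) v + frechet_derivative F (at x) v *\<^sub>R G x"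
  using frechet_derivative_at[OF has_derivative_scaleR[OF smooth_at_has_derivative[OF assms(1)]
      smooth_at_has_derivative[OF assms(2)]]] by metis

lemma frechet_derivative_add:
  assumes "smooth_at x F" "smooth_at x G"
  shows "frechet_derivative (\<lambda>z. F z + G z) (at x) v =
    frechet_derivative F (at x) v + frechet_derivative G (at x) v"
  using frechet_derivative_at[OF has_derivative_add[OF smooth_at_has_derivative[OF assms(1)]
      smooth_at_has_derivative[OF assms(2)]]] by metis

lemma frechet_derivative_bounded_linear:
  assumes "bounded_linear h" "smooth_at x F"
  shows "frechet_derivative (\<lambda>z. h (F z)) (at x) v = h (frechet_derivative F (at x) v)"
  using frechet_derivative_at[OF bounded_linear.has_derivative[OF assms(1) smooth_at_has_derivative[OF assms(2)]]]
  by metis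

text \<open>Both second derivatives are limits of the same second difference quotient: two applications of
  the mean value theorem, in either order of the two directions.\<close>

lemma second_difference:
  fixes F :: "'a::euclidean_space \<Rightarrow> real"
  assumes F: "\<And>z. z \<in> ball x r \<Longrightarrow> smooth_at z F" 
    and t: "t > 0" "t * norm a + t * norm b < r"
  shows "\<exists>z. dist x z \<le> t * norm a + t * norm b \<and> 
    F (x + t *\<^sub>R a + t *\<^sub>R b) - F (x + t *\<^sub>R a) - F (x + t *\<^sub>R b) + F x =
      t\<^sup>2 * frechet_derivative (\<lambda>z. frechet_derivative F (at z) a) (at z) b"
proof -
  have inball: "x + s *\<^sub>R a + s' *\<^sub>R b \<in> ball x r" if "0 \<le> s" "s \<le> t" "0 \<le> s'" "s' \<le> t" for s s'
  proof -
    have "norm (s *\<^sub>R a + s' *\<^sub>R b) \<le> s * norm a + s' * norm b"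
      using that norm_triangle_ineq[of "s *\<^sub>R a" "s' *\<^sub>R b"] by simp
    also have "\<dots> \<le> t * norm a + t * norm b" using that by (intro add_mono mult_right_mono) auto
    finally show ?thesis using t by (simp add: dist_norm algebra_simps norm_minus_commute)
  qed
  define G where "G = (\<lambda>s. F (x + s *\<^sub>R a + t *\<^sub>R b) - F (x + s *\<^sub>R a))"
  have line: "((\<lambda>s. H (c + s *\<^sub>R d)) has_derivative (\<lambda>h. h *\<^sub>R frechet_derivative H (at (c + s *\<^sub>R d)) d)) (at s)" 
    if "smooth_at (c + s *\<^sub>R d) H" for H :: "'a \<Rightarrow> real" and c d s
  proof -
    have 1: "((\<lambda>s. c + s *\<^sub>R d) has_derivative (\<lambda>h. h *\<^sub>R d)) (at s)"
      by (auto intro!: derivative_eq_intros)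
    have "linear (frechet_derivative H (at (c + s *\<^sub>R d)))" using smooth_at_linear_derivative that by blast
    then show ?thesis using has_derivative_compose[OF 1 smooth_at_has_derivative[OF that]]
      by (simp add: linear_scale)
  qed
  have "\<exists>\<xi>\<in>{0<..<t}. G t - G 0 = (\<lambda>h. h *\<^sub>R (frechet_derivative F (at (x + \<xi> *\<^sub>R a + t *\<^sub>R b)) a - frechet_derivative F (at (x + \<xi> *\<^sub>R a)) a)) (t - 0)"
  proof (rule mvt_simple[OF t(1)])
    fix s assume s: "0 \<le> s" "s \<le> t"
    have "smooth_at ((x + t *\<^sub>R b) + s *\<^sub>R a) F" "smooth_at (x + s *\<^sub>R a) F"
      using inball[of s t] inball[of s 0] s t F by (auto simp: algebra_simps)
    from has_derivative_diff[OF line[OF this(1)] line[OF this(2)]]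
    show "(G has_derivative (\<lambda>h. h *\<^sub>R (frechet_derivative F (at (x + s *\<^sub>R a + t *\<^sub>R b)) a - frechet_derivative F (at (x + s *\<^sub>R a)) a))) (at s within {0..t})"
      unfolding G_def by (auto simp: algebra_simps intro: has_derivative_at_withinI)
  qed
  then obtain \<xi> where \<xi>: "0 < \<xi>" "\<xi> < t" "G t - G 0 = t * (frechet_derivative F (at (x + \<xi> *\<^sub>R a + t *\<^sub>R b)) a - frechet_derivative F (at (x + \<xi> *\<^sub>R a)) a)"
    by auto
  define K where "K = (\<lambda>s. frechet_derivative F (at (x + \<xi> *\<^sub>R a + s *\<^sub>R b)) a)"
  have "\<exists>\<zeta>\<in>{0<..<t}. K t - K 0 = (\<lambda>h. h *\<^sub>R frechet_derivative (\<lambda>z. frechet_derivative F (at z) a) (at (x + \<xi> *\<^sub>R a + \<zeta> *\<^sub>R b)) b) (t - 0)"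
  proof (rule mvt_simple[OF t(1)])
    fix s assume s: "0 \<le> s" "s \<le> t"
    have "smooth_at ((x + \<xi> *\<^sub>R a) + s *\<^sub>R b) F"
      using inball[of \<xi> s] s t F \<xi> by (auto simp: algebra_simps)
    then have "smooth_at ((x + \<xi> *\<^sub>R a) + s *\<^sub>R b) (\<lambda>z. frechet_derivative F (at z) a)"
      using smooth_at_derivative smooth_at_const by blast
    from line[OF this]
    show "(K has_derivative (\<lambda>h. h *\<^sub>R frechet_derivative (\<lambda>z. frechet_derivative F (at z) a) (at (x + \<xi> *\<^sub>R a + s *\<^sub>R b)) b)) (at s within {0..t})"
      unfolding K_def by (auto simp: algebra_simps intro: has_derivative_at_withinI)
  qed
  then obtain \<zeta> where \<zeta>: "0 < \<zeta>" "\<zeta> < t" "K t - K 0 = t * frechet_derivative (\<lambda>z. frechet_derivative F (at z) a) (at (x + \<xi> *\<^sub>R a + \<zeta> *\<^sub>R b)) b"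
    by auto
  have "norm (\<xi> *\<^sub>R a + \<zeta> *\<^sub>R b) \<le> \<xi> * norm a + \<zeta> * norm b"
    using \<xi> \<zeta> norm_triangle_ineq[of "\<xi> *\<^sub>R a" "\<zeta> *\<^sub>R b"] by simp
  also have "\<dots> \<le> t * norm a + t * norm b" using \<xi> \<zeta> by (intro add_mono mult_right_mono) auto
  finally have "dist x (x + \<xi> *\<^sub>R a + \<zeta> *\<^sub>R b) \<le> t * norm a + t * norm b"
    by (simp add: dist_norm algebra_simps norm_minus_commute)
  moreover have "F (x + t *\<^sub>R a + t *\<^sub>R b) - F (x + t *\<^sub>R a) - F (x + t *\<^sub>R b) + F x = G t - G 0"
    by (simp add: G_def)
  moreover have "G t - G 0 = t * (K t - K 0)" using \<xi> by (simp add: K_def)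
  ultimately show ?thesis using \<zeta> by (intro exI[of _ "x + \<xi> *\<^sub>R a + \<zeta> *\<^sub>R b"]) (simp add: power2_eq_square)
qed

lemma second_derivative_symmetric:
  fixes F :: "'a::euclidean_space \<Rightarrow> real"
  assumes "smooth_at x F"
  shows "frechet_derivative (\<lambda>z. frechet_derivative F (at z) a) (at x) b =
    frechet_derivative (\<lambda>z. frechet_derivative F (at z) b) (at x) a"
proof -
  obtain r where r: "r > 0" "\<And>z. z \<in> ball x r \<Longrightarrow> smooth_at z F"
    using smooth_at_eventually[OF assms] unfolding eventually_nhds_metric
    by (auto simp: dist_commute)
  define D where "D = (\<lambda>a b z. frechet_derivative (\<lambda>z. frechet_derivative F (at z) a) (at z) b)"
  have cont: "isCont (D a b) x" for a b
    unfolding D_def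
    by (intro smooth_at_isCont smooth_at_derivative[OF smooth_at_derivative] smooth_at_const assms)
  have "dist (D a b x) (D b a x) < e" if e: "e > 0" for e
  proof -
    obtain d1 where d1: "d1 > 0" "\<And>z. dist z x < d1 \<Longrightarrow> dist (D a b z) (D a b x) < e / 2"
      using cont[of a b] e unfolding continuous_at_eps_delta by (meson half_gt_zero)
    obtain d2 where d2: "d2 > 0" "\<And>z. dist z x < d2 \<Longrightarrow> dist (D b a z) (D b a x) < e / 2"
      using cont[of b a] e unfolding continuous_at_eps_delta by (meson half_gt_zero)
    define m where "m = min r (min d1 d2)"
    \<comment> \<open>This \<open>t\<close> keeps the parallelogram within distance \<open>m\<close> of \<open>x\<close>; the summand 1 covers \<open>a = b = 0\<close>.\<close>
    define t where "t = m / (norm a + norm b + 1)"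
    have pos: "norm a + norm b + 1 > 0" by (simp add: add_nonneg_pos)
    have m: "m > 0" using r d1 d2 by (simp add: m_def)
    have t: "t > 0" using m pos by (simp add: t_def)
    have "t * (norm a + norm b + 1) = m" using pos by (simp add: t_def)
    then have tm: "t * norm a + t * norm b < m" using t by (simp add: algebra_simps)
    then have tr: "t * norm a + t * norm b < r" by (simp add: m_def)
    obtain z1 where z1: "dist x z1 \<le> t * norm a + t * norm b"
      "F (x + t *\<^sub>R a + t *\<^sub>R b) - F (x + t *\<^sub>R a) - F (x + t *\<^sub>R b) + F x = t\<^sup>2 * D a b z1"
      using second_difference[OF r(2) t tr] unfolding D_def by blast
    obtain z2 where z2: "dist x z2 \<le> t * norm b + t * norm a"
      "F (x + t *\<^sub>R b + t *\<^sub>R a) - F (x + t *\<^sub>R b) - F (x + t *\<^sub>R a) + F x = t\<^sup>2 * D b a z2"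
      using second_difference[where a=b and b=a, OF r(2) t] tr unfolding D_def by (auto simp: add.commute)
    have "x + t *\<^sub>R b + t *\<^sub>R a = x + t *\<^sub>R a + t *\<^sub>R b" by simp
    then have "F (x + t *\<^sub>R a + t *\<^sub>R b) - F (x + t *\<^sub>R b) - F (x + t *\<^sub>R a) + F x = t\<^sup>2 * D b a z2"
      using z2(2) by metis
    then have "t\<^sup>2 * D a b z1 = t\<^sup>2 * D b a z2" using z1(2) by linarith
    then have eq: "D a b z1 = D b a z2" using t by simp
    have "dist z1 x < d1" "dist z2 x < d2" using z1 z2 tm by (auto simp: m_def dist_commute)
    then have "dist (D a b z1) (D a b x) < e / 2" "dist (D b a z2) (D b a x) < e / 2"
      using d1 d2 by auto
    then show ?thesis using eq dist_triangle_half_r by metis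
  qed
  then have "D a b x = D b a x" using dist_pos_lt by blast
  then show ?thesis by (simp add: D_def)
qed

lemma smooth_at_det:
  fixes M :: "'a::euclidean_space \<Rightarrow> real^'n^'n"
  assumes "\<And>i j. smooth_at x (\<lambda>z. M z $ i $ j)"
  shows "smooth_at x (\<lambda>z. det (M z))"
  unfolding det_def by (intro smooth_at_sum smooth_at_mult smooth_at_prod smooth_at_const assms)

text \<open>By Cramer's rule, the solution of a linear system is a quotient of polynomials in its data.\<close>

lemma smooth_at_linear_system:
  fixes M :: "'a::euclidean_space \<Rightarrow> real^'n^'n" and b y :: "'a \<Rightarrow> real^'n"
  assumes "\<And>i j. smooth_at x (\<lambda>z. M z $ i $ j)" "\<And>i. smooth_at x (\<lambda>z. b z $ i)"
    and "det (M x) \<noteq> 0" and "eventually (\<lambda>z. M z *v y z = b z) (nhds x)"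
  shows "smooth_at x (\<lambda>z. y z $ k)"
proof -
  let ?c = "\<lambda>z. det (\<chi> i j. if j = k then b z $ i else M z $ i $ j) / det (M z)"
  have "smooth_at x (\<lambda>z. if j = k then b z $ i else M z $ i $ j)" for i j
    using assms(1,2) by (cases "j = k") auto
  then have "smooth_at x ?c"
    using assms by (intro smooth_at_divide smooth_at_det) auto
  moreover have "eventually (\<lambda>z. det (M z) \<noteq> 0) (nhds x)"
    using smooth_at_tendsto[OF smooth_at_det[OF assms(1)]] assms(3) tendsto_imp_eventually_ne by blast
  then have "eventually (\<lambda>z. ?c z = y z $ k) (nhds x)"
    using assms(4)
  proof eventually_elim
    case (elim z)
    then show ?case using cramer[of "M z" "y z" "b z"] by simp
  qed
  ultimately show ?thesis by (rule smooth_at_cong)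
qed

text \<open>The product rule for the pairing of \<open>F'\<close> with \<open>G\<close>. Its first summand is a second derivative of \<open>F\<close>; this is
  the term that cancels in a Lie bracket.\<close>

lemma frechet_derivative_derivative:
  fixes F :: "'a::euclidean_space \<Rightarrow> 'b::real_normed_vector"
  assumes F: "smooth_at x F" and G: "smooth_at x G"
  shows "frechet_derivative (\<lambda>z. frechet_derivative F (at z) (G z)) (at x) v =
    frechet_derivative (\<lambda>z. frechet_derivative F (at z) (G x)) (at x) v +
    frechet_derivative F (at x) (frechet_derivative G (at x) v)"
proof -
  let ?D = "\<lambda>b z. frechet_derivative F (at z) b"
  have lin: "linear (frechet_derivative F (at x))"
    using F smooth_at_linear_derivative by blast
  have sD: "smooth_at x (?D b)" for b using F smooth_at_derivative smooth_at_const by blast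
  have ev: "eventually (\<lambda>z. linear (frechet_derivative F (at z))) (nhds x)"
    using smooth_at_eventually[OF F] by eventually_elim (rule smooth_at_linear_derivative)
  have exp: "eventually (\<lambda>z. frechet_derivative F (at z) (H z) = (\<Sum>b\<in>Basis. (H z \<bullet> b) *\<^sub>R ?D b z)) (nhds x)" for H
    using ev by eventually_elim (rule linear_eq_sum_Basis)
  have comp: "frechet_derivative (\<lambda>z. G z \<bullet> b) (at x) v = frechet_derivative G (at x) v \<bullet> b" for b
    using frechet_derivative_bounded_linear[OF bounded_linear_inner_left G] .
  have sum: "frechet_derivative (\<lambda>z. \<Sum>b\<in>Basis. (h b z) *\<^sub>R ?D b z) (at x) v =
      (\<Sum>b\<in>Basis. h b x *\<^sub>R frechet_derivative (?D b) (at x) v + frechet_derivative (h b) (at x) v *\<^sub>R ?D b x)"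
    if "\<And>b. smooth_at x (h b)" for h :: "'a \<Rightarrow> 'a \<Rightarrow> real"
  proof -
    have "((\<lambda>z. \<Sum>b\<in>Basis. (h b z) *\<^sub>R ?D b z) has_derivative
      (\<lambda>v. \<Sum>b\<in>Basis. h b x *\<^sub>R frechet_derivative (?D b) (at x) v + frechet_derivative (h b) (at x) v *\<^sub>R ?D b x)) (at x)"
      by (intro has_derivative_sum has_derivative_scaleR smooth_at_has_derivative sD that)
    from fun_cong[OF frechet_derivative_at[OF this], of v, symmetric] show ?thesis .
  qed
  have "frechet_derivative (\<lambda>z. frechet_derivative F (at z) (G z)) (at x) v =
      frechet_derivative (\<lambda>z. \<Sum>b\<in>Basis. (G z \<bullet> b) *\<^sub>R ?D b z) (at x) v"
    by (rule fun_cong[OF frechet_derivative_cong]) (rule exp)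
  also have "\<dots> = (\<Sum>b\<in>Basis. (G x \<bullet> b) *\<^sub>R frechet_derivative (?D b) (at x) v + 
      (frechet_derivative G (at x) v \<bullet> b) *\<^sub>R ?D b x)"
    using sum[of "\<lambda>b z. G z \<bullet> b"] smooth_at_inner_const[OF G] comp by simp
  also have "\<dots> = (\<Sum>b\<in>Basis. (G x \<bullet> b) *\<^sub>R frechet_derivative (?D b) (at x) v) +
     frechet_derivative F (at x) (frechet_derivative G (at x) v)"
    using linear_eq_sum_Basis[OF lin, of "frechet_derivative G (at x) v"] by (simp add: sum.distrib)
  also have "(\<Sum>b\<in>Basis. (G x \<bullet> b) *\<^sub>R frechet_derivative (?D b) (at x) v) = 
      frechet_derivative (\<lambda>z. \<Sum>b\<in>Basis. (G x \<bullet> b) *\<^sub>R ?D b z) (at x) v"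
    using sum[of "\<lambda>b z. G x \<bullet> b", OF smooth_at_const] by simp
  also have "\<dots> = frechet_derivative (\<lambda>z. frechet_derivative F (at z) (G x)) (at x) v"
    by (rule fun_cong[OF frechet_derivative_cong[symmetric]]) (rule exp)
  finally show ?thesis .
qed

lemma Ck_on_local:
  "(\<And>x. x \<in> S \<Longrightarrow> \<exists>N. open N \<and> x \<in> N \<and> Ck_on k N f) \<Longrightarrow> Ck_on k S f"
proof (induction k arbitrary: f)
  case 0
  have "isCont f x" if "x \<in> S" for x
    using 0[OF that] continuous_on_eq_continuous_at by auto
  then show ?case by (auto intro: continuous_at_imp_continuous_on)
next
  case (Suc k)
  have "f differentiable (at x)" if "x \<in> S" for x
    using Suc.prems[OF that] by auto
  moreover have "\<forall>v. Ck_on k S (\<lambda>x. frechet_derivative f (at x) v)"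
  proof
    fix v
    show "Ck_on k S (\<lambda>x. frechet_derivative f (at x) v)"
  proof (rule Suc.IH)
    fix x assume "x \<in> S"
    then obtain N where "open N" "x \<in> N" "Ck_on (Suc k) N f" using Suc.prems by blast
    then show "\<exists>N. open N \<and> x \<in> N \<and> Ck_on k N (\<lambda>x. frechet_derivative f (at x) v)"
      unfolding Ck_on.simps by blast
  qed
  qed
  ultimately show ?case unfolding Ck_on.simps by blast
qed

lemma smooth_on_if_smooth_at: 
  assumes "\<And>x. x \<in> S \<Longrightarrow> smooth_at x f"
  shows "smooth_on S f"
  unfolding smooth_on_def
proof
  fix k
  show "Ck_on k S f"
    by (rule Ck_on_local) (use assms in \<open>auto simp: smooth_at_def smooth_on_def\<close>)
qed

lemma smooth_at_derivative_compose:
  fixes T :: "'b::euclidean_space \<Rightarrow> 'c::real_normed_vector"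
  assumes "smooth_at x F" "smooth_at (F x) T" "smooth_at x G"
  shows "smooth_at x (\<lambda>z. frechet_derivative T (at (F z)) (G z))"
proof -
  have "smooth_at x (\<lambda>z. \<Sum>b\<in>Basis. (G z \<bullet> b) *\<^sub>R frechet_derivative T (at (F z)) b)"
    by (intro smooth_at_sum smooth_at_scaleR smooth_at_inner_const assms
      smooth_at_compose[OF assms(1), of "\<lambda>y. frechet_derivative T (at y) _"] smooth_at_derivative smooth_at_const)
  moreover have "eventually (\<lambda>z. smooth_at (F z) T) (nhds x)"
    using eventually_compose_filterlim[OF smooth_at_eventually[OF assms(2)] smooth_at_tendsto[OF assms(1)]] .
  then have "eventually (\<lambda>z. (\<Sum>b\<in>Basis. (G z \<bullet> b) *\<^sub>R frechet_derivative T (at (F z)) b) =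
      frechet_derivative T (at (F z)) (G z)) (nhds x)"
    by eventually_elim (rule linear_eq_sum_Basis[symmetric, OF smooth_at_linear_derivative])
  ultimately show ?thesis by (rule smooth_at_cong)
qed

section \<open>Calculus in a smooth atlas\<close>

text \<open>The notions of the calculus refer to an atlas and not to a topology. Stating their properties for an
  atlas alone makes them available both for $M$ and for the slit
  tangent bundle, whose points are only some of the pairs \<open>(p, v)\<close>.\<close>

locale smooth_atlas =
  fixes atl :: "('a, 'e::euclidean_space) chart set"
  assumes chart_inj: "(U, \<phi>) \<in> atl \<Longrightarrow> inj_on \<phi> U"
    and chart_open: "(U, \<phi>) \<in> atl \<Longrightarrow> (V, \<psi>) \<in> atl \<Longrightarrow> open (\<phi> ` (U \<inter> V))"
    and chart_smooth: "(U, \<phi>) \<in> atl \<Longrightarrow> (V, \<psi>) \<in> atl \<Longrightarrow>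
      smooth_on (\<phi> ` (U \<inter> V)) (\<psi> \<circ> inv_into U \<phi>)"
begin

lemma inv_chart [simp]: "(U, \<phi>) \<in> atl \<Longrightarrow> p \<in> U \<Longrightarrow> inv_into U \<phi> (\<phi> p) = p"
  by (simp add: chart_inj)

lemma eventually_overlap:
  assumes "(U, \<phi>) \<in> atl" "p \<in> U" "(V, \<psi>) \<in> atl" "p \<in> V"
  shows "eventually (\<lambda>x. inv_into U \<phi> x \<in> U \<and> inv_into U \<phi> x \<in> V \<and> \<phi> (inv_into U \<phi> x) = x) (nhds (\<phi> p))"
proof -
  have "eventually (\<lambda>x. x \<in> \<phi> ` (U \<inter> V)) (nhds (\<phi> p))"
    using assms chart_open by (intro eventually_nhds_in_open) auto
  then show ?thesis
    by eventually_elim (use assms(1) in auto)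
qed

lemma eventually_chart:
  assumes "(U, \<phi>) \<in> atl" "p \<in> U"
  shows "eventually (\<lambda>x. inv_into U \<phi> x \<in> U \<and> \<phi> (inv_into U \<phi> x) = x) (nhds (\<phi> p))"
  using eventually_overlap[OF assms assms] by eventually_elim simp

lemma smooth_at_transition:
  assumes "(U, \<phi>) \<in> atl" "(V, \<psi>) \<in> atl" "p \<in> U" "p \<in> V"
  shows "smooth_at (\<phi> p) (\<psi> \<circ> inv_into U \<phi>)"
  unfolding smooth_at_def using assms chart_open chart_smooth by (meson IntI image_eqI)

text \<open>Any chart around the point may be used, because transition maps are continuous. In this form, statements
  about neighbourhoods become statements about the filter \<open>nhds\<close>.\<close>

lemma near_iff:
  assumes "(U, \<phi>) \<in> atl" "p \<in> U"
  shows "near atl p P \<longleftrightarrow> eventually (\<lambda>x. P (inv_into U \<phi> x)) (nhds (\<phi> p))"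
proof
  assume "eventually (\<lambda>x. P (inv_into U \<phi> x)) (nhds (\<phi> p))"
  then obtain S where S: "open S" "\<phi> p \<in> S" "\<And>x. x \<in> S \<Longrightarrow> P (inv_into U \<phi> x)"
    unfolding eventually_nhds by blast
  have "open (S \<inter> \<phi> ` U)" using S chart_open[OF assms(1) assms(1)] by auto
  moreover have "P q" if "q \<in> U" "\<phi> q \<in> S" for q using S(3)[OF that(2)] that assms by simp
  ultimately show "near atl p P"
    unfolding near_def using assms S by (intro bexI[OF _ assms(1)]) auto
next
  assume "near atl p P"
  then obtain V \<psi> N where V: "(V, \<psi>) \<in> atl" "p \<in> V" "open N" "\<psi> p \<in> N" "\<And>q. q \<in> V \<Longrightarrow> \<psi> q \<in> N \<Longrightarrow> P q"
    unfolding near_def by fast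
  have "((\<psi> \<circ> inv_into U \<phi>) \<longlongrightarrow> (\<psi> \<circ> inv_into U \<phi>) (\<phi> p)) (nhds (\<phi> p))"
    using smooth_at_tendsto smooth_at_transition assms V by blast
  then have "eventually (\<lambda>x. (\<psi> \<circ> inv_into U \<phi>) x \<in> N) (nhds (\<phi> p))"
    by (rule topological_tendstoD) (use V assms in auto)
  then show "eventually (\<lambda>x. P (inv_into U \<phi> x)) (nhds (\<phi> p))"
    using eventually_overlap[OF assms V(1,2)] by eventually_elim (use V in auto)
qed

lemma smooth_near_iff:
  assumes "(U, \<phi>) \<in> atl" "p \<in> U"
  shows "smooth_near atl p f \<longleftrightarrow> smooth_at (\<phi> p) (f \<circ> inv_into U \<phi>)"
proof
  assume "smooth_at (\<phi> p) (f \<circ> inv_into U \<phi>)"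
  then obtain S where S: "open S" "\<phi> p \<in> S" "smooth_on S (f \<circ> inv_into U \<phi>)"
    unfolding smooth_at_def by blast
  have "open (S \<inter> \<phi> ` U)" using S chart_open[OF assms(1) assms(1)] by auto
  moreover have "smooth_on (S \<inter> \<phi> ` U) (f \<circ> inv_into U \<phi>)"
    using S smooth_on_subset by blast
  ultimately show "smooth_near atl p f"
    unfolding smooth_near_def using assms S by (intro bexI[OF _ assms(1)]) auto
next
  assume "smooth_near atl p f"
  then obtain V \<psi> N where V: "(V, \<psi>) \<in> atl" "p \<in> V" "open N" "\<psi> p \<in> N" "smooth_on N (f \<circ> inv_into V \<psi>)"
    unfolding smooth_near_def by fast
  have "smooth_at ((\<psi> \<circ> inv_into U \<phi>) (\<phi> p)) (f \<circ> inv_into V \<psi>)"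
    unfolding smooth_at_def using assms V by auto
  from smooth_at_compose[OF smooth_at_transition[OF assms(1) V(1) assms(2) V(2)] this]
  show "smooth_at (\<phi> p) (f \<circ> inv_into U \<phi>)"
    by (rule smooth_at_cong) (use eventually_overlap[OF assms V(1,2)] V in \<open>auto elim: eventually_mono\<close>)
qed

lemma near_chart: "near atl p P \<Longrightarrow> \<exists>U \<phi>. (U, \<phi>) \<in> atl \<and> p \<in> U"
  unfolding near_def by blast

lemma smooth_near_chart: "smooth_near atl p P \<Longrightarrow> \<exists>U \<phi>. (U, \<phi>) \<in> atl \<and> p \<in> U"
  unfolding smooth_near_def by blast

lemma near_self: "near atl p P \<Longrightarrow> P p"
  unfolding near_def by fast

lemma near_mono: 
  assumes "near atl p P" "\<And>q. P q \<Longrightarrow> Q q" 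
  shows "near atl p Q"
proof -
  obtain U \<phi> where U: "(U, \<phi>) \<in> atl" "p \<in> U" using assms(1) near_chart by blast
  show ?thesis using assms unfolding near_iff[OF U] by (auto elim: eventually_mono)
qed

lemma near_conj: 
  assumes "near atl p P" "near atl p Q" 
  shows "near atl p (\<lambda>q. P q \<and> Q q)"
proof -
  obtain U \<phi> where U: "(U, \<phi>) \<in> atl" "p \<in> U" using assms(1) near_chart by blast
  show ?thesis using assms unfolding near_iff[OF U] by (rule eventually_conj)
qed

lemma near_elim:
  assumes "near atl p P" "near atl p Q" "\<And>q. P q \<Longrightarrow> Q q \<Longrightarrow> R q"
  shows "near atl p R"
  using near_mono[OF near_conj[OF assms(1,2)]] assms(3) by blast

lemma near_in_chart: "(U, \<phi>) \<in> atl \<Longrightarrow> p \<in> U \<Longrightarrow> near atl p (\<lambda>q. q \<in> U)"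
  using eventually_chart[of U \<phi> p] by (auto simp: near_iff elim: eventually_mono)

lemma near_eq_sym: "near atl p (\<lambda>q. f q = g q) \<Longrightarrow> near atl p (\<lambda>q. g q = f q)"
  using near_mono by fastforce

lemma near_in_chartI:
  assumes "(U, \<phi>) \<in> atl" "p \<in> U" "eventually P (nhds (\<phi> p))"
  shows "near atl p (\<lambda>q. P (\<phi> q))"
  unfolding near_iff[OF assms(1,2)]
  using eventually_chart[OF assms(1,2)] assms(3) by eventually_elim auto

lemma near_near:
  assumes "near atl p P"
  shows "near atl p (\<lambda>q. near atl q P)"
proof -
  obtain U \<phi> where U: "(U, \<phi>) \<in> atl" "p \<in> U" using assms near_chart by blast
  have "eventually (\<lambda>x. eventually (\<lambda>x. P (inv_into U \<phi> x)) (nhds x)) (nhds (\<phi> p))"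
    using assms near_iff[OF U] eventually_eventually by blast
  then have "near atl p (\<lambda>q. eventually (\<lambda>x. P (inv_into U \<phi> x)) (nhds (\<phi> q)))"
    by (rule near_in_chartI[OF U])
  then show ?thesis by (rule near_elim[OF _ near_in_chart[OF U]]) (simp add: near_iff[OF U(1)])
qed

lemma smooth_near_near:
  assumes "smooth_near atl p f"
  shows "near atl p (\<lambda>q. smooth_near atl q f)"
proof -
  obtain U \<phi> where U: "(U, \<phi>) \<in> atl" "p \<in> U" using assms smooth_near_chart by blast
  have "eventually (\<lambda>x. smooth_at x (f \<circ> inv_into U \<phi>)) (nhds (\<phi> p))"
    using assms smooth_near_iff[OF U] smooth_at_eventually by blast
  then have "near atl p (\<lambda>q. smooth_at (\<phi> q) (f \<circ> inv_into U \<phi>))"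
    by (rule near_in_chartI[OF U])
  then show ?thesis by (rule near_elim[OF _ near_in_chart[OF U]]) (simp add: smooth_near_iff[OF U(1)])
qed

lemma smooth_near_cong:
  assumes "smooth_near atl p f" "near atl p (\<lambda>q. f q = g q)"
  shows "smooth_near atl p g"
proof -
  obtain U \<phi> where U: "(U, \<phi>) \<in> atl" "p \<in> U" using assms smooth_near_chart by blast
  show ?thesis
    using assms smooth_at_cong[of "\<phi> p" "f \<circ> inv_into U \<phi>" "g \<circ> inv_into U \<phi>"]
    unfolding near_iff[OF U] smooth_near_iff[OF U] by (simp add: comp_def)
qed

lemma smooth_near_cong_iff:
  "near atl p (\<lambda>q. f q = g q) \<Longrightarrow> smooth_near atl p f \<longleftrightarrow> smooth_near atl p g"
  using smooth_near_cong near_eq_sym by blast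

lemma smooth_near_const: "(U, \<phi>) \<in> atl \<Longrightarrow> p \<in> U \<Longrightarrow> smooth_near atl p (\<lambda>q. c)"
  by (simp add: smooth_near_iff comp_def smooth_at_const)

lemma smooth_near_coord: 
  assumes "(U, \<phi>) \<in> atl" "p \<in> U" 
  shows "smooth_near atl p \<phi>"
  unfolding smooth_near_iff[OF assms]
  by (rule smooth_at_cong[OF smooth_at_ident])
    (use eventually_chart[OF assms] in \<open>auto elim!: eventually_mono\<close>)

lemma smooth_near_compose:
  assumes "smooth_near atl p f" "smooth_at (f p) g"
  shows "smooth_near atl p (\<lambda>q. g (f q))"
proof -
  obtain U \<phi> where U: "(U, \<phi>) \<in> atl" "p \<in> U" using assms smooth_near_chart by blast
  show ?thesis using assms smooth_at_compose[of "\<phi> p" "f \<circ> inv_into U \<phi>" g]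
    by (simp add: smooth_near_iff[OF U] comp_def U)
qed

lemma smooth_near_Pair:
  assumes "smooth_near atl p f" "smooth_near atl p g"
  shows "smooth_near atl p (\<lambda>q. (f q, g q))"
proof -
  obtain U \<phi> where U: "(U, \<phi>) \<in> atl" "p \<in> U" using assms smooth_near_chart by blast
  show ?thesis using assms by (simp add: smooth_near_iff[OF U] comp_def smooth_at_Pair)
qed

lemma smooth_near_chart_fun:
  assumes "(U, \<phi>) \<in> atl" "p \<in> U" "smooth_at (\<phi> p) F"
  shows "smooth_near atl p (\<lambda>q. F (\<phi> q))"
  using smooth_near_compose[OF smooth_near_coord[OF assms(1,2)] assms(3)] .

lemma smooth_near_add: "smooth_near atl p f \<Longrightarrow> smooth_near atl p g \<Longrightarrow> smooth_near atl p (\<lambda>q. f q + g q)"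
  using smooth_near_chart[of p f] by (auto simp: smooth_near_iff comp_def intro: smooth_at_add)

lemma smooth_near_minus: "smooth_near atl p f \<Longrightarrow> smooth_near atl p (\<lambda>q. - f q)"
  using smooth_near_chart[of p f] by (auto simp: smooth_near_iff comp_def intro: smooth_at_minus)

lemma smooth_near_scaleR: "smooth_near atl p f \<Longrightarrow> smooth_near atl p g \<Longrightarrow> smooth_near atl p (\<lambda>q. f q *\<^sub>R g q)"
  using smooth_near_chart[of p f] by (auto simp: smooth_near_iff comp_def intro: smooth_at_scaleR)

lemma smooth_near_mult: 
  fixes f g :: "_ \<Rightarrow> real"
  shows "smooth_near atl p f \<Longrightarrow> smooth_near atl p g \<Longrightarrow> smooth_near atl p (\<lambda>q. f q * g q)"
  using smooth_near_scaleR[of p f g] by simp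

lemma smooth_near_cmult: 
  fixes f :: "_ \<Rightarrow> real"
  shows "smooth_near atl p f \<Longrightarrow> smooth_near atl p (\<lambda>q. c * f q)"
  using smooth_near_chart[of p f] smooth_near_mult[OF smooth_near_const] by blast

lemma smooth_near_sum:
  assumes "(U, \<phi>) \<in> atl" "p \<in> U" "\<And>i. i \<in> I \<Longrightarrow> smooth_near atl p (f i)"
  shows "smooth_near atl p (\<lambda>q. \<Sum>i\<in>I. f i q)"
  using assms by (auto simp: smooth_near_iff comp_def intro!: smooth_at_sum)

lemma smooth_near_inner_const: "smooth_near atl p f \<Longrightarrow> smooth_near atl p (\<lambda>q. f q \<bullet> b)"
  using smooth_near_chart[of p f] by (auto simp: smooth_near_iff comp_def intro: smooth_at_inner_const)

lemma smooth_near_componentwise: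
  fixes f :: "_ \<Rightarrow> 'b::euclidean_space"
  assumes "\<And>b. b \<in> Basis \<Longrightarrow> smooth_near atl p (\<lambda>q. f q \<bullet> b)"
  shows "smooth_near atl p f"
proof -
  obtain U \<phi> where U: "(U, \<phi>) \<in> atl" "p \<in> U" 
    using assms smooth_near_chart by (meson ex_in_conv nonempty_Basis)
  show ?thesis using assms smooth_at_componentwise[of "\<phi> p" "f \<circ> inv_into U \<phi>"] 
    by (simp add: smooth_near_iff[OF U] comp_def)
qed

subsection \<open>Tangent vectors\<close>

lemma coord_vec_apply:
  "smooth_near atl p f \<Longrightarrow> 
    coord_vec atl (U, \<phi>) p y f = frechet_derivative (f \<circ> inv_into U \<phi>) (at (\<phi> p)) y"
  by (simp add: coord_vec_def)

lemma coord_vec_linear: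
  assumes "(U, \<phi>) \<in> atl" "p \<in> U"
  shows "coord_vec atl (U, \<phi>) p (a *\<^sub>R y + b *\<^sub>R z) = a *\<^sub>R coord_vec atl (U, \<phi>) p y + b *\<^sub>R coord_vec atl (U, \<phi>) p z"
proof
  fix f
  show "coord_vec atl (U, \<phi>) p (a *\<^sub>R y + b *\<^sub>R z) f = (a *\<^sub>R coord_vec atl (U, \<phi>) p y + b *\<^sub>R coord_vec atl (U, \<phi>) p z) f"
  proof (cases "smooth_near atl p f")
    case True
    then have "linear (frechet_derivative (f \<circ> inv_into U \<phi>) (at (\<phi> p)))"
      using smooth_at_linear_derivative assms by (simp add: smooth_near_iff)
    with True show ?thesis by (simp add: coord_vec_apply scaleR_fun_def linear_add linear_scale)
  qed (simp add: coord_vec_def scaleR_fun_def)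
qed

lemma linear_coord_vec:
  assumes "(U, \<phi>) \<in> atl" "p \<in> U"
  shows "linear (coord_vec atl (U, \<phi>) p)"
  using coord_vec_linear[OF assms, of 1 _ 1] coord_vec_linear[OF assms, of _ _ 0]
  by (intro linearI) auto

lemma vec_coords_linear:
  "vec_coords \<phi> (a *\<^sub>R v + b *\<^sub>R w) = a *\<^sub>R vec_coords \<phi> v + b *\<^sub>R vec_coords \<phi> w"
  by (simp add: vec_coords_def scaleR_fun_def sum.distrib scaleR_add_left scaleR_sum_right)

lemma linear_vec_coords: "linear (vec_coords \<phi>)"
  using vec_coords_linear[of \<phi> 1 _ 1] vec_coords_linear[of \<phi> _ _ 0]
  by (intro linearI) auto

lemma vec_coords_coord_vec:
  assumes "(U, \<phi>) \<in> atl" "p \<in> U" "(V, \<psi>) \<in> atl" "p \<in> V"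
  shows "vec_coords \<psi> (coord_vec atl (U, \<phi>) p y) = frechet_derivative (\<psi> \<circ> inv_into U \<phi>) (at (\<phi> p)) y"
proof -
  have "coord_vec atl (U, \<phi>) p y (\<lambda>q. \<psi> q \<bullet> b) = frechet_derivative (\<psi> \<circ> inv_into U \<phi>) (at (\<phi> p)) y \<bullet> b" for b
    using coord_vec_apply[OF smooth_near_inner_const[OF smooth_near_coord[OF assms(3,4)]]]
      frechet_derivative_bounded_linear[OF bounded_linear_inner_left smooth_at_transition[OF assms(1,3,2,4)]]
    by (simp add: comp_def)
  then show ?thesis by (simp add: vec_coords_def euclidean_representation)
qed

lemma vec_coords_self [simp]:
  assumes "(U, \<phi>) \<in> atl" "p \<in> U"
  shows "vec_coords \<phi> (coord_vec atl (U, \<phi>) p y) = y"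
proof -
  have "frechet_derivative (\<phi> \<circ> inv_into U \<phi>) (at (\<phi> p)) = frechet_derivative (\<lambda>x. x) (at (\<phi> p))"
    by (rule frechet_derivative_cong) (use eventually_chart[OF assms] in \<open>auto elim!: eventually_mono\<close>)
  then show ?thesis by (simp add: vec_coords_coord_vec[OF assms assms])
qed

text \<open>The chain rule for the transition map.\<close>

lemma coord_vec_change:
  assumes "(U, \<phi>) \<in> atl" "p \<in> U" "(V, \<psi>) \<in> atl" "p \<in> V"
  shows "coord_vec atl (U, \<phi>) p y = coord_vec atl (V, \<psi>) p (frechet_derivative (\<psi> \<circ> inv_into U \<phi>) (at (\<phi> p)) y)"
proof
  fix f
  show "coord_vec atl (U, \<phi>) p y f = coord_vec atl (V, \<psi>) p (frechet_derivative (\<psi> \<circ> inv_into U \<phi>) (at (\<phi> p)) y) f"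
  proof (cases "smooth_near atl p f")
    case True
    have "frechet_derivative (f \<circ> inv_into U \<phi>) (at (\<phi> p)) = 
       frechet_derivative (\<lambda>x. (f \<circ> inv_into V \<psi>) ((\<psi> \<circ> inv_into U \<phi>) x)) (at (\<phi> p))"
      by (rule frechet_derivative_cong) (use eventually_overlap[OF assms] assms in \<open>auto elim!: eventually_mono\<close>)
    moreover have "smooth_at ((\<psi> \<circ> inv_into U \<phi>) (\<phi> p)) (f \<circ> inv_into V \<psi>)"
      using smooth_near_iff[OF assms(3,4), of f] True assms by simp
    note frechet_derivative_chain[OF smooth_at_transition[OF assms(1,3,2,4)] this]
    ultimately show ?thesis using True assms by (simp add: coord_vec_apply comp_def)
  qed (simp add: coord_vec_def)
qed

lemma tangent_space_eq_range:
  assumes "(U, \<phi>) \<in> atl" "p \<in> U"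
  shows "tangent_space atl p = range (coord_vec atl (U, \<phi>) p)"
proof -
  have "coord_vec atl (V, \<psi>) p y \<in> range (coord_vec atl (U, \<phi>) p)" if "(V, \<psi>) \<in> atl" "p \<in> V" for V \<psi> y
    unfolding coord_vec_change[OF that assms] by simp
  moreover have "coord_vec atl (U, \<phi>) p y \<in> tangent_space atl p" for y
    unfolding tangent_space_def using assms by (intro CollectI exI[of _ "(U, \<phi>)"] exI[of _ y]) simp
  ultimately show ?thesis by (auto simp: tangent_space_def)
qed

lemma coord_vec_in: "(U, \<phi>) \<in> atl \<Longrightarrow> p \<in> U \<Longrightarrow> coord_vec atl (U, \<phi>) p y \<in> tangent_space atl p"
  by (simp add: tangent_space_eq_range)

lemma tangent_space_chart: "v \<in> tangent_space atl p \<Longrightarrow> \<exists>U \<phi>. (U, \<phi>) \<in> atl \<and> p \<in> U"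
  unfolding tangent_space_def by auto

lemma coord_vec_vec_coords:
  assumes "(U, \<phi>) \<in> atl" "p \<in> U" "v \<in> tangent_space atl p"
  shows "coord_vec atl (U, \<phi>) p (vec_coords \<phi> v) = v"
  using assms by (auto simp: tangent_space_eq_range)

lemma subspace_tangent_space:
  assumes "(U, \<phi>) \<in> atl" "p \<in> U"
  shows "subspace (tangent_space atl p)"
  unfolding tangent_space_eq_range[OF assms]
  using linear_subspace_image[OF linear_coord_vec[OF assms] subspace_UNIV] .

lemma tangent_apply:
  assumes "(U, \<phi>) \<in> atl" "p \<in> U" "v \<in> tangent_space atl p" "smooth_near atl p f"
  shows "v f = frechet_derivative (f \<circ> inv_into U \<phi>) (at (\<phi> p)) (vec_coords \<phi> v)"
  using coord_vec_apply[OF assms(4), of U \<phi> "vec_coords \<phi> v"] 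
  by (simp only: coord_vec_vec_coords[OF assms(1-3)])

lemma tangent_not_smooth:
  "v \<in> tangent_space atl p \<Longrightarrow> \<not> smooth_near atl p f \<Longrightarrow> v f = 0"
  by (auto simp: tangent_space_def coord_vec_def)

text \<open>A tangent vector sees only the germ of a function. This includes functions that are not smooth, on which
  tangent vectors vanish by convention.\<close>

lemma tangent_cong:
  assumes "v \<in> tangent_space atl p" "near atl p (\<lambda>q. f q = g q)"
  shows "v f = v g"
proof (cases "smooth_near atl p f")
  case True
  then have g: "smooth_near atl p g" using assms smooth_near_cong by blast
  obtain U \<phi> where U: "(U, \<phi>) \<in> atl" "p \<in> U" using assms tangent_space_chart by blast
  have "frechet_derivative (f \<circ> inv_into U \<phi>) (at (\<phi> p)) = frechet_derivative (g \<circ> inv_into U \<phi>) (at (\<phi> p))"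
    by (rule frechet_derivative_cong) (use assms in \<open>simp add: near_iff[OF U] comp_def\<close>)
  then show ?thesis using tangent_apply[OF U assms(1)] True g by simp
next
  case False
  then show ?thesis using assms tangent_not_smooth smooth_near_cong_iff by metis
qed

lemma tangent_add:
  assumes "v \<in> tangent_space atl p" "smooth_near atl p f" "smooth_near atl p g"
  shows "v (\<lambda>q. f q + g q) = v f + v g"
proof -
  obtain U \<phi> where U: "(U, \<phi>) \<in> atl" "p \<in> U" using assms tangent_space_chart by blast
  show ?thesis using assms frechet_derivative_add[of "\<phi> p" "f \<circ> inv_into U \<phi>" "g \<circ> inv_into U \<phi>"]
    by (simp add: tangent_apply[OF U] smooth_near_add) (simp add: comp_def smooth_near_iff[OF U])
qed

lemma tangent_mult:
  assumes "v \<in> tangent_space atl p" "smooth_near atl p f" "smooth_near atl p g"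
  shows "v (\<lambda>q. f q * g q) = f p * v g + v f * g p"
proof -
  obtain U \<phi> where U: "(U, \<phi>) \<in> atl" "p \<in> U" using assms tangent_space_chart by blast
  show ?thesis using assms frechet_derivative_scaleR[of "\<phi> p" "f \<circ> inv_into U \<phi>" "g \<circ> inv_into U \<phi>"] U
    by (simp add: tangent_apply[OF U] smooth_near_mult) (simp add: comp_def smooth_near_iff[OF U])
qed

lemma tangent_const:
  assumes "v \<in> tangent_space atl p" 
  shows "v (\<lambda>q. c) = 0"
proof -
  obtain U \<phi> where U: "(U, \<phi>) \<in> atl" "p \<in> U" using assms tangent_space_chart by blast
  show ?thesis using tangent_apply[OF U assms smooth_near_const[OF U]] by (simp add: comp_def)
qed

lemma tangent_cmult:
  assumes "v \<in> tangent_space atl p" "smooth_near atl p f"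
  shows "v (\<lambda>q. c * f q) = c * v f"
proof -
  obtain U \<phi> where U: "(U, \<phi>) \<in> atl" "p \<in> U" using assms tangent_space_chart by blast
  show ?thesis using tangent_mult[OF assms(1) smooth_near_const[OF U, of c] assms(2)] tangent_const[OF assms(1)] by simp
qed

lemma tangent_sum:
  assumes "v \<in> tangent_space atl p" "\<And>i. i \<in> I \<Longrightarrow> smooth_near atl p (f i)"
  shows "v (\<lambda>q. \<Sum>i\<in>I. f i q) = (\<Sum>i\<in>I. v (f i))"
proof -
  obtain U \<phi> where U: "(U, \<phi>) \<in> atl" "p \<in> U" using assms tangent_space_chart by blast
  show ?thesis using assms(2)
  proof (induction I rule: infinite_finite_induct)
    case (insert i I)
    then show ?case using tangent_add[OF assms(1), of "f i" "\<lambda>q. \<Sum>i\<in>I. f i q"] smooth_near_sum[OF U, of I f] by auto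
  qed (use tangent_const[OF assms(1)] in auto)
qed

subsection \<open>Vector fields\<close>

text \<open>Smooth components in one chart suffice: those in another chart are the image under the derivative of the
  transition map.\<close>

lemma vector_field_nearI:
  assumes "(U, \<phi>) \<in> atl" "p \<in> U" "near atl p (\<lambda>q. X q \<in> tangent_space atl q)"
    "smooth_near atl p (\<lambda>q. vec_coords \<phi> (X q))"
  shows "vector_field_near atl p X"
  unfolding vector_field_near_def
proof (intro conjI ballI)
  fix c assume "c \<in> atl"
  show "case c of (V, \<psi>) \<Rightarrow> p \<in> V \<longrightarrow> smooth_near atl p (\<lambda>q. vec_coords \<psi> (X q))"
  proof (clarify)
    fix V \<psi> assume V: "c = (V, \<psi>)" "p \<in> V"
    then have V: "(V, \<psi>) \<in> atl" "p \<in> V" using \<open>c \<in> atl\<close> by auto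
    have "smooth_at (\<phi> p) (\<lambda>x. frechet_derivative (\<psi> \<circ> inv_into U \<phi>) (at x) (vec_coords \<phi> (X (inv_into U \<phi> x))))"
      using assms V smooth_at_transition
      by (intro smooth_at_derivative) (auto simp: smooth_near_iff comp_def)
    then have "smooth_near atl p (\<lambda>q. frechet_derivative (\<psi> \<circ> inv_into U \<phi>) (at (\<phi> q)) (vec_coords \<phi> (X (inv_into U \<phi> (\<phi> q)))))"
      by (rule smooth_near_chart_fun[OF assms(1,2)])
    then show "smooth_near atl p (\<lambda>q. vec_coords \<psi> (X q))"
    proof (rule smooth_near_cong)
      show "near atl p (\<lambda>q. frechet_derivative (\<psi> \<circ> inv_into U \<phi>) (at (\<phi> q)) (vec_coords \<phi> (X (inv_into U \<phi> (\<phi> q)))) = vec_coords \<psi> (X q))"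
        by (rule near_elim[OF near_conj[OF near_in_chart[OF assms(1,2)] near_in_chart[OF V]] assms(3)])
          (use assms(1) V(1) vec_coords_coord_vec coord_vec_vec_coords in \<open>auto simp: vec_coords_coord_vec[symmetric]\<close>)
    qed
  qed
qed (use assms in auto)

lemma vector_field_nearD:
  assumes "vector_field_near atl p X"
  shows "near atl p (\<lambda>q. X q \<in> tangent_space atl q)"
    "(U, \<phi>) \<in> atl \<Longrightarrow> p \<in> U \<Longrightarrow> smooth_near atl p (\<lambda>q. vec_coords \<phi> (X q))"
  using assms unfolding vector_field_near_def by auto

lemma vector_field_near_in: "vector_field_near atl p X \<Longrightarrow> X p \<in> tangent_space atl p"
  using vector_field_nearD near_self by blast

lemma vector_field_near_chart: "vector_field_near atl p X \<Longrightarrow> \<exists>U \<phi>. (U, \<phi>) \<in> atl \<and> p \<in> U"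
  using vector_field_near_in tangent_space_chart by blast

lemma vector_field_near_near:
  assumes "vector_field_near atl p X" 
  shows "near atl p (\<lambda>q. vector_field_near atl q X)"
proof -
  obtain U \<phi> where U: "(U, \<phi>) \<in> atl" "p \<in> U" using assms vector_field_near_chart by blast
  show ?thesis
    by (rule near_elim[OF near_conj[OF near_in_chart[OF U] near_near[OF vector_field_nearD(1)[OF assms]]]
      smooth_near_near[OF vector_field_nearD(2)[OF assms U]]]) (use U vector_field_nearI in blast)
qed

lemma smooth_near_vector_field_apply:
  assumes "vector_field_near atl p X" "smooth_near atl p f"
  shows "smooth_near atl p (\<lambda>q. X q f)"
proof -
  obtain U \<phi> where U: "(U, \<phi>) \<in> atl" "p \<in> U" using assms vector_field_near_chart by blast
  have "smooth_at (\<phi> p) (\<lambda>x. frechet_derivative (f \<circ> inv_into U \<phi>) (at x) (vec_coords \<phi> (X (inv_into U \<phi> x))))"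
    using assms vector_field_nearD(2)[OF assms(1) U]
    by (intro smooth_at_derivative) (auto simp: smooth_near_iff[OF U] comp_def)
  then have "smooth_near atl p (\<lambda>q. frechet_derivative (f \<circ> inv_into U \<phi>) (at (\<phi> q)) (vec_coords \<phi> (X (inv_into U \<phi> (\<phi> q)))))"
    by (rule smooth_near_chart_fun[OF U])
  then show ?thesis
    by (rule smooth_near_cong[OF _ near_elim[OF near_conj[OF near_in_chart[OF U] vector_field_nearD(1)[OF assms(1)]] smooth_near_near[OF assms(2)]]])
      (use U in \<open>auto simp: tangent_apply\<close>)
qed

lemma vector_field_near_linear:
  assumes "smooth_near atl p f" "smooth_near atl p g" "vector_field_near atl p X" "vector_field_near atl p Y"
  shows "vector_field_near atl p (\<lambda>q. f q *\<^sub>R X q + g q *\<^sub>R Y q)"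
proof -
  obtain U \<phi> where U: "(U, \<phi>) \<in> atl" "p \<in> U" using assms vector_field_near_chart by blast
  show ?thesis
  proof (rule vector_field_nearI[OF U])
    show "near atl p (\<lambda>q. f q *\<^sub>R X q + g q *\<^sub>R Y q \<in> tangent_space atl q)"
      by (rule near_elim[OF near_conj[OF near_in_chart[OF U] vector_field_nearD(1)[OF assms(3)]] vector_field_nearD(1)[OF assms(4)]])
       (use U subspace_tangent_space in \<open>auto simp: subspace_add subspace_scale\<close>)
    show "smooth_near atl p (\<lambda>q. vec_coords \<phi> (f q *\<^sub>R X q + g q *\<^sub>R Y q))"
      unfolding vec_coords_linear using assms U vector_field_nearD(2)
      by (intro smooth_near_add smooth_near_scaleR) auto
  qed
qed

lemma vector_field_near_scale:
  assumes "smooth_near atl p f" "vector_field_near atl p X" 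
  shows "vector_field_near atl p (\<lambda>q. f q *\<^sub>R X q)"
proof -
  obtain U \<phi> where U: "(U, \<phi>) \<in> atl" "p \<in> U" using assms vector_field_near_chart by blast
  show ?thesis using vector_field_near_linear[OF assms(1) smooth_near_const[OF U, of 0] assms(2,2)] by simp
qed

lemma vector_field_near_add:
  assumes "vector_field_near atl p X" "vector_field_near atl p Y"
  shows "vector_field_near atl p (\<lambda>q. X q + Y q)"
proof -
  obtain U \<phi> where U: "(U, \<phi>) \<in> atl" "p \<in> U" using assms vector_field_near_chart by blast
  show ?thesis using vector_field_near_linear[OF smooth_near_const[OF U, of 1] smooth_near_const[OF U, of 1] assms] by simp
qed

lemma vector_field_near_coord_vec:
  assumes "(U, \<phi>) \<in> atl" "p \<in> U" "smooth_near atl p Y"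
  shows "vector_field_near atl p (\<lambda>q. coord_vec atl (U, \<phi>) q (Y q))"
proof (rule vector_field_nearI[OF assms(1,2)])
  show "near atl p (\<lambda>q. coord_vec atl (U, \<phi>) q (Y q) \<in> tangent_space atl q)"
    by (rule near_mono[OF near_in_chart[OF assms(1,2)]]) (rule coord_vec_in[OF assms(1)])
  show "smooth_near atl p (\<lambda>q. vec_coords \<phi> (coord_vec atl (U, \<phi>) q (Y q)))"
    by (rule smooth_near_cong[OF assms(3) near_mono[OF near_in_chart[OF assms(1,2)]]]) (use assms in simp)
qed

text \<open>In coordinates the bracket is $\eta'\xi - \xi'\eta$: the second derivatives of the function that
  it is applied to cancel by symmetry.\<close>

lemma lie_bracket_coord:
  assumes "vector_field_near atl p X" "vector_field_near atl p Y" "(U, \<phi>) \<in> atl" "p \<in> U" 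
  defines "\<xi> \<equiv> \<lambda>x. vec_coords \<phi> (X (inv_into U \<phi> x))" and "\<eta> \<equiv> \<lambda>x. vec_coords \<phi> (Y (inv_into U \<phi> x))"
  shows "lie_bracket atl X Y p = coord_vec atl (U, \<phi>) p 
     (frechet_derivative \<eta> (at (\<phi> p)) (\<xi> (\<phi> p)) - frechet_derivative \<xi> (at (\<phi> p)) (\<eta> (\<phi> p)))"
proof
  fix f
  show "lie_bracket atl X Y p f = coord_vec atl (U, \<phi>) p 
     (frechet_derivative \<eta> (at (\<phi> p)) (\<xi> (\<phi> p)) - frechet_derivative \<xi> (at (\<phi> p)) (\<eta> (\<phi> p))) f"
  proof (cases "smooth_near atl p f")
    case True
    define F where "F = f \<circ> inv_into U \<phi>"
    have F: "smooth_at (\<phi> p) F" using True assms smooth_near_iff F_def by blast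
    have \<xi>: "smooth_at (\<phi> p) \<xi>" and \<eta>: "smooth_at (\<phi> p) \<eta>"
      using vector_field_nearD(2)[OF assms(1,3,4)] vector_field_nearD(2)[OF assms(2,3,4)]
      unfolding smooth_near_iff[OF assms(3,4)] \<xi>_def \<eta>_def by (simp_all add: comp_def)
    have *: "X' p (\<lambda>q. Y' q f) = frechet_derivative (\<lambda>x. frechet_derivative F (at x) (vec_coords \<phi> (Y' (inv_into U \<phi> x)))) (at (\<phi> p)) (vec_coords \<phi> (X' p))"
      if "vector_field_near atl p X'" "vector_field_near atl p Y'" for X' Y'
    proof -
      have "near atl p (\<lambda>q. Y' q f = frechet_derivative F (at (\<phi> q)) (vec_coords \<phi> (Y' q)))"
        by (rule near_elim[OF near_conj[OF near_in_chart[OF assms(3,4)] vector_field_nearD(1)[OF that(2)]] smooth_near_near[OF True]])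
          (use assms(3) in \<open>auto simp: tangent_apply F_def\<close>)
      then have ev: "eventually (\<lambda>x. Y' (inv_into U \<phi> x) f = frechet_derivative F (at x) (vec_coords \<phi> (Y' (inv_into U \<phi> x)))) (nhds (\<phi> p))"
        using eventually_chart[OF assms(3,4)] unfolding near_iff[OF assms(3,4)]
        by eventually_elim auto
      have "X' p (\<lambda>q. Y' q f) = frechet_derivative ((\<lambda>q. Y' q f) \<circ> inv_into U \<phi>) (at (\<phi> p)) (vec_coords \<phi> (X' p))"
        using tangent_apply[OF assms(3,4) vector_field_near_in[OF that(1)] smooth_near_vector_field_apply[OF that(2) True]] .
      then show ?thesis using frechet_derivative_cong[OF ev] by (simp add: comp_def)
    qed
    have "lie_bracket atl X Y p f = X p (\<lambda>q. Y q f) - Y p (\<lambda>q. X q f)" 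
      using True by (simp add: lie_bracket_def)
    also have "\<dots> = frechet_derivative (\<lambda>x. frechet_derivative F (at x) (\<eta> x)) (at (\<phi> p)) (\<xi> (\<phi> p)) - 
       frechet_derivative (\<lambda>x. frechet_derivative F (at x) (\<xi> x)) (at (\<phi> p)) (\<eta> (\<phi> p))"
      using *[OF assms(1,2)] *[OF assms(2,1)] assms(3,4) by (simp add: \<xi>_def \<eta>_def)
    also have "\<dots> = frechet_derivative F (at (\<phi> p)) (frechet_derivative \<eta> (at (\<phi> p)) (\<xi> (\<phi> p)))
       - frechet_derivative F (at (\<phi> p)) (frechet_derivative \<xi> (at (\<phi> p)) (\<eta> (\<phi> p)))"
      using frechet_derivative_derivative[OF F \<xi>] frechet_derivative_derivative[OF F \<eta>] 
        second_derivative_symmetric[OF F, of "\<eta> (\<phi> p)" "\<xi> (\<phi> p)"] by simp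
    also have "\<dots> = coord_vec atl (U, \<phi>) p 
     (frechet_derivative \<eta> (at (\<phi> p)) (\<xi> (\<phi> p)) - frechet_derivative \<xi> (at (\<phi> p)) (\<eta> (\<phi> p))) f"
      using coord_vec_apply[OF True] linear_diff[OF smooth_at_linear_derivative[OF F]] by (simp add: F_def)
    finally show ?thesis .
  qed (simp add: lie_bracket_def coord_vec_def)
qed

lemma lie_bracket_vector_field:
  assumes "vector_field_near atl p X" "vector_field_near atl p Y" 
  shows "vector_field_near atl p (lie_bracket atl X Y)"
proof -
  obtain U \<phi> where U: "(U, \<phi>) \<in> atl" "p \<in> U" using assms vector_field_near_chart by blast
  define \<xi> \<eta> where "\<xi> = (\<lambda>x. vec_coords \<phi> (X (inv_into U \<phi> x)))" and "\<eta> = (\<lambda>x. vec_coords \<phi> (Y (inv_into U \<phi> x)))"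
  have \<xi>: "smooth_at (\<phi> p) \<xi>" and \<eta>: "smooth_at (\<phi> p) \<eta>"
    using vector_field_nearD(2)[OF assms(1) U] vector_field_nearD(2)[OF assms(2) U]
    unfolding smooth_near_iff[OF U] \<xi>_def \<eta>_def by (simp_all add: comp_def)
  let ?\<zeta> = "\<lambda>x. frechet_derivative \<eta> (at x) (\<xi> x) - frechet_derivative \<xi> (at x) (\<eta> x)"
  have eq: "near atl p (\<lambda>q. q \<in> U \<and> lie_bracket atl X Y q = coord_vec atl (U, \<phi>) q (?\<zeta> (\<phi> q)))"
    by (rule near_elim[OF near_conj[OF near_in_chart[OF U] vector_field_near_near[OF assms(1)]] vector_field_near_near[OF assms(2)]])
     (use U lie_bracket_coord in \<open>auto simp: \<xi>_def \<eta>_def\<close>)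
  show ?thesis
  proof (rule vector_field_nearI[OF U])
    show "near atl p (\<lambda>q. lie_bracket atl X Y q \<in> tangent_space atl q)"
      by (rule near_mono[OF eq]) (use U coord_vec_in in auto)
    have "smooth_near atl p (\<lambda>q. ?\<zeta> (\<phi> q))"
      by (intro smooth_near_chart_fun[OF U] smooth_at_diff smooth_at_derivative \<xi> \<eta>)
    then show "smooth_near atl p (\<lambda>q. vec_coords \<phi> (lie_bracket atl X Y q))"
      by (rule smooth_near_cong) (rule near_mono[OF eq], use U in auto)
  qed
qed

lemma lie_bracket_antisym: "lie_bracket atl X Y p = - lie_bracket atl Y X p"
  by (auto simp: lie_bracket_def fun_eq_iff)

lemma lie_bracket_add:
  assumes "vector_field_near atl p X" "vector_field_near atl p Y" "vector_field_near atl p Z" 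
  shows "lie_bracket atl (\<lambda>q. X q + Y q) Z p = lie_bracket atl X Z p + lie_bracket atl Y Z p"
proof
  fix f
  show "lie_bracket atl (\<lambda>q. X q + Y q) Z p f = (lie_bracket atl X Z p + lie_bracket atl Y Z p) f"
  proof (cases "smooth_near atl p f")
    case True
    show ?thesis
      using tangent_add[OF vector_field_near_in[OF assms(3)] smooth_near_vector_field_apply[OF assms(1) True] smooth_near_vector_field_apply[OF assms(2) True]]
      by (simp add: lie_bracket_def True)
  qed (simp add: lie_bracket_def)
qed

lemma lie_bracket_scale:
  assumes "vector_field_near atl p X" "vector_field_near atl p Y" "smooth_near atl p h"
  shows "lie_bracket atl (\<lambda>q. h q *\<^sub>R X q) Y p = h p *\<^sub>R lie_bracket atl X Y p - Y p h *\<^sub>R X p"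
proof
  fix f
  show "lie_bracket atl (\<lambda>q. h q *\<^sub>R X q) Y p f = (h p *\<^sub>R lie_bracket atl X Y p - Y p h *\<^sub>R X p) f"
  proof (cases "smooth_near atl p f")
    case True
    show ?thesis
      using tangent_mult[OF vector_field_near_in[OF assms(2)] assms(3) smooth_near_vector_field_apply[OF assms(1) True]]
      by (simp add: lie_bracket_def True scaleR_fun_def algebra_simps)
  next
    case False
    then show ?thesis using tangent_not_smooth[OF vector_field_near_in[OF assms(1)]]
      by (simp add: lie_bracket_def scaleR_fun_def)
  qed
qed

lemma lie_bracket_cong:
  assumes "vector_field_near atl p Y" "near atl p (\<lambda>q. X q = X' q)"
  shows "lie_bracket atl X Y p = lie_bracket atl X' Y p"
proof -
  have "Y p (\<lambda>q. X q f) = Y p (\<lambda>q. X' q f)" for f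
    by (rule tangent_cong[OF vector_field_near_in[OF assms(1)]]) (rule near_mono[OF assms(2)], simp)
  moreover have "X p = X' p" using near_self[OF assms(2)] .
  ultimately show ?thesis by (auto simp: lie_bracket_def)
qed

lemma smooth_near_derivative_compose:
  fixes T :: "'b::euclidean_space \<Rightarrow> 'c::real_normed_vector"
  assumes "smooth_near atl p f" "smooth_at (f p) T" "smooth_near atl p g"
  shows "smooth_near atl p (\<lambda>q. frechet_derivative T (at (f q)) (g q))"
proof -
  obtain U \<phi> where U: "(U, \<phi>) \<in> atl" "p \<in> U" using assms smooth_near_chart by blast
  show ?thesis using assms U smooth_at_derivative_compose[of "\<phi> p" "f \<circ> inv_into U \<phi>" T "g \<circ> inv_into U \<phi>"]
    by (simp add: smooth_near_iff[OF U] comp_def)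
qed

text \<open>The form in which Cramer's rule is used: for horizontal lifts and for \<open>Ric_o\<close>.\<close>

lemma smooth_near_linear_system:
  fixes M :: "'a \<Rightarrow> real^'n^'n" and b y :: "'a \<Rightarrow> real^'n"
  assumes "\<And>i j. smooth_near atl p (\<lambda>q. M q $ i $ j)" "\<And>i. smooth_near atl p (\<lambda>q. b q $ i)"
    and "det (M p) \<noteq> 0" and "near atl p (\<lambda>q. M q *v y q = b q)"
  shows "smooth_near atl p (\<lambda>q. y q $ k)"
proof -
  obtain U \<phi> where U: "(U, \<phi>) \<in> atl" "p \<in> U" using assms(4) near_chart by blast
  show ?thesis using assms U smooth_at_linear_system[of "\<phi> p" "M \<circ> inv_into U \<phi>" "b \<circ> inv_into U \<phi>" "y \<circ> inv_into U \<phi>" k]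
    by (simp add: smooth_near_iff[OF U] near_iff[OF U] comp_def)
qed

lemma smooth_near_component:
  fixes f :: "'a \<Rightarrow> real^'n"
  shows "smooth_near atl p f \<Longrightarrow> smooth_near atl p (\<lambda>q. f q $ i)"
  using smooth_near_inner_const[of p f "axis i 1"] by (simp add: inner_axis)

lemma smooth_near_vec:
  fixes f :: "'a \<Rightarrow> real^'n"
  shows "(\<And>i. smooth_near atl p (\<lambda>q. f q $ i)) \<Longrightarrow> smooth_near atl p f"
  by (rule smooth_near_componentwise) (auto simp: Basis_vec_def inner_axis)

lemma coord_vec_eq_0_iff: "(U, \<phi>) \<in> atl \<Longrightarrow> p \<in> U \<Longrightarrow> coord_vec atl (U, \<phi>) p y = 0 \<longleftrightarrow> y = 0"
  using vec_coords_self linear_0[OF linear_coord_vec] linear_0[OF linear_vec_coords] by metis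

end

section \<open>The slit tangent bundle and \<open>\<pi>\<close>-vector fields\<close>

locale manifold_atlas = smooth_atlas atl for atl :: "('m, 'e::euclidean_space) chart set" +
  assumes cover: "\<Union> (fst ` atl) = UNIV"
begin

abbreviation "sdom U \<equiv> {u \<in> slit_tb atl. fst u \<in> U}"
abbreviation "smap \<phi> \<equiv> (\<lambda>u. (\<phi> (fst u), vec_coords \<phi> (snd u)))"

lemma slit_chart: "(U, \<phi>) \<in> atl \<Longrightarrow> (sdom U, smap \<phi>) \<in> slit_atlas atl"
  unfolding slit_atlas_def by force

lemma slit_atlasE:
  assumes "(S, \<sigma>) \<in> slit_atlas atl"
  obtains U \<phi> where "(U, \<phi>) \<in> atl" "S = sdom U" "\<sigma> = smap \<phi>"
  using assms unfolding slit_atlas_def by force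

lemma chart_around: obtains U \<phi> where "(U, \<phi>) \<in> atl" "p \<in> U"
proof -
  have "p \<in> \<Union> (fst ` atl)" using cover by simp
  then show ?thesis using that by force
qed

lemma inj_smap: "(U, \<phi>) \<in> atl \<Longrightarrow> inj_on (smap \<phi>) (sdom U)"
proof (rule inj_onI, clarsimp simp: slit_tb_def)
  fix p v q w
  assume *: "(U, \<phi>) \<in> atl" "p \<in> U" "q \<in> U" "\<phi> p = \<phi> q" "v \<in> tangent_space atl p" "w \<in> tangent_space atl q"
    "vec_coords \<phi> v = vec_coords \<phi> w"
  then have "p = q" using chart_inj inj_onD by metis
  moreover have "v = w" using * \<open>p = q\<close> coord_vec_vec_coords by metis
  ultimately show "p = q \<and> v = w" by simp
qed

lemma coord_vec_slit:
  "(U, \<phi>) \<in> atl \<Longrightarrow> p \<in> U \<Longrightarrow> y \<noteq> 0 \<Longrightarrow> (p, coord_vec atl (U, \<phi>) p y) \<in> sdom U"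
  by (simp add: slit_tb_def coord_vec_in coord_vec_eq_0_iff)

lemma inv_smap:
  assumes "(U, \<phi>) \<in> atl" "p \<in> U" "y \<noteq> 0"
  shows "inv_into (sdom U) (smap \<phi>) (\<phi> p, y) = (p, coord_vec atl (U, \<phi>) p y)"
  by (rule inv_into_f_eq[OF inj_smap[OF assms(1)] coord_vec_slit[OF assms]]) (use assms in simp)

lemma image_smap:
  assumes "(U, \<phi>) \<in> atl" "(V, \<psi>) \<in> atl"
  shows "smap \<phi> ` (sdom U \<inter> sdom V) = \<phi> ` (U \<inter> V) \<times> (- {0::'e})"
proof (intro equalityI subsetI)
  fix z assume "z \<in> smap \<phi> ` (sdom U \<inter> sdom V)"
  then obtain p v where z: "z = (\<phi> p, vec_coords \<phi> v)" "p \<in> U" "p \<in> V" "v \<in> tangent_space atl p" "v \<noteq> 0"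
    by (auto simp: slit_tb_def)
  have "vec_coords \<phi> v \<noteq> 0"
    using coord_vec_vec_coords[OF assms(1) z(2,4)] z(5) coord_vec_eq_0_iff[OF assms(1) z(2)] by metis
  then show "z \<in> \<phi> ` (U \<inter> V) \<times> (- {0})" using z by auto
next
  fix z assume "z \<in> \<phi> ` (U \<inter> V) \<times> (- {0::'e})"
  then obtain p y where z: "z = (\<phi> p, y)" "p \<in> U" "p \<in> V" "y \<noteq> 0" by auto
  have "(p, coord_vec atl (U, \<phi>) p y) \<in> sdom U \<inter> sdom V" 
    using coord_vec_slit[OF assms(1) z(2,4)] z by auto
  moreover have "z = smap \<phi> (p, coord_vec atl (U, \<phi>) p y)" using z assms by simp
  ultimately show "z \<in> smap \<phi> ` (sdom U \<inter> sdom V)" by blast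
qed

text \<open>The transition maps of the slit tangent bundle are the tangent maps \<open>(x, y) \<mapsto> (\<tau>(x), \<tau>'(x) y)\<close> of the
  transition maps \<open>\<tau>\<close> of $M$.\<close>

sublocale slit: smooth_atlas "slit_atlas atl"
proof
  fix S \<sigma> assume "(S, \<sigma>) \<in> slit_atlas atl"
  then show "inj_on \<sigma> S" by (rule slit_atlasE) (simp only: inj_smap)
next
  fix S \<sigma> S' \<sigma>' assume "(S, \<sigma>) \<in> slit_atlas atl" "(S', \<sigma>') \<in> slit_atlas atl"
  then show "open (\<sigma> ` (S \<inter> S'))"
    by (elim slit_atlasE) (simp only: image_smap, intro open_Times chart_open open_Compl, auto)
next
  fix S \<sigma> S' \<sigma>' assume *: "(S, \<sigma>) \<in> slit_atlas atl" "(S', \<sigma>') \<in> slit_atlas atl"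
  obtain U \<phi> where U: "(U, \<phi>) \<in> atl" "S = sdom U" "\<sigma> = smap \<phi>" using *(1) by (rule slit_atlasE)
  obtain V \<psi> where V: "(V, \<psi>) \<in> atl" "S' = sdom V" "\<sigma>' = smap \<psi>" using *(2) by (rule slit_atlasE)
  let ?\<tau> = "\<psi> \<circ> inv_into U \<phi>"
  show "smooth_on (\<sigma> ` (S \<inter> S')) (\<sigma>' \<circ> inv_into S \<sigma>)"
  proof (rule smooth_on_if_smooth_at)
    fix z assume z: "z \<in> \<sigma> ` (S \<inter> S')"
    then have z': "z \<in> \<phi> ` (U \<inter> V) \<times> (- {0})" using image_smap[OF U(1) V(1)] U V by simp
    then have fz: "fst z \<in> \<phi> ` (U \<inter> V)" by auto
    then have \<tau>: "smooth_at (fst z) ?\<tau>" using smooth_at_transition[OF U(1) V(1)] by auto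
    have "smooth_at z (\<lambda>z. (?\<tau> (fst z), frechet_derivative ?\<tau> (at (fst z)) (snd z)))"
      using \<tau> by (intro smooth_at_Pair smooth_at_compose[where F=fst and G="?\<tau>"] smooth_at_derivative_compose
        smooth_at_fst smooth_at_snd smooth_at_ident)
    then show "smooth_at z (\<sigma>' \<circ> inv_into S \<sigma>)"
    proof (rule smooth_at_cong)
      have "open (\<phi> ` (U \<inter> V) \<times> (- {0::'e}))" by (intro open_Times chart_open[OF U(1) V(1)] open_Compl) auto
      then have "eventually (\<lambda>z. z \<in> \<phi> ` (U \<inter> V) \<times> (- {0})) (nhds z)" 
        using z' by (rule eventually_nhds_in_open)
      then show "eventually (\<lambda>z. (?\<tau> (fst z), frechet_derivative ?\<tau> (at (fst z)) (snd z)) = (\<sigma>' \<circ> inv_into S \<sigma>) z) (nhds z)"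
      proof eventually_elim
        case (elim z)
        then obtain p y where p: "z = (\<phi> p, y)" "p \<in> U" "p \<in> V" "y \<noteq> 0" by auto
        have "inv_into S \<sigma> z = (p, coord_vec atl (U, \<phi>) p y)"
          using inv_smap[OF U(1) p(2,4)] U p by simp
        then show ?case using p U V vec_coords_coord_vec[OF U(1) p(2) V(1) p(3)] by simp
      qed
    qed
  qed
qed

lemma slit_near_in: "u \<in> slit_tb atl \<Longrightarrow> (U, \<phi>) \<in> atl \<Longrightarrow> fst u \<in> U \<Longrightarrow> near (slit_atlas atl) u (\<lambda>w. w \<in> slit_tb atl \<and> fst w \<in> U)"
  using slit.near_in_chart[OF slit_chart[of U \<phi>], of u] by simp

lemma slit_near_imp: "near (slit_atlas atl) u P \<Longrightarrow> u \<in> slit_tb atl"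
  using slit.near_chart slit_atlasE by blast

lemma slit_near_always: 
  assumes "u \<in> slit_tb atl" "\<And>w. w \<in> slit_tb atl \<Longrightarrow> P w" 
  shows "near (slit_atlas atl) u P"
proof -
  obtain U \<phi> where U: "(U, \<phi>) \<in> atl" "fst u \<in> U" using chart_around by blast
  show ?thesis by (rule slit.near_mono[OF slit_near_in[OF assms(1) U]]) (use assms in simp)
qed

lemma slit_smooth_const: 
  assumes "u \<in> slit_tb atl"
  shows "smooth_near (slit_atlas atl) u (\<lambda>w. c)"
proof -
  obtain U \<phi> where U: "(U, \<phi>) \<in> atl" "fst u \<in> U" using chart_around by blast
  show ?thesis using slit.smooth_near_const[OF slit_chart[OF U(1)], of u] assms U by simp
qed

lemma slit_smooth_fst_snd:
  assumes "u \<in> slit_tb atl" "(U, \<phi>) \<in> atl" "fst u \<in> U"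
  shows "smooth_near (slit_atlas atl) u (\<lambda>w. \<phi> (fst w))" 
    "smooth_near (slit_atlas atl) u (\<lambda>w. vec_coords \<phi> (snd w))" 
  using slit.smooth_near_compose[OF slit.smooth_near_coord[OF slit_chart[OF assms(2)], of u], of fst]
    slit.smooth_near_compose[OF slit.smooth_near_coord[OF slit_chart[OF assms(2)], of u], of snd]
    assms smooth_at_fst[OF smooth_at_ident] smooth_at_snd[OF smooth_at_ident] by auto

lemma fibre_change:
  assumes "(U, \<phi>) \<in> atl" "p \<in> U" "(V, \<psi>) \<in> atl" "p \<in> V" "x \<in> tangent_space atl p"
  shows "vec_coords \<psi> x = frechet_derivative (\<psi> \<circ> inv_into U \<phi>) (at (\<phi> p)) (vec_coords \<phi> x)"
  using vec_coords_coord_vec[OF assms(1-4), of "vec_coords \<phi> x"] coord_vec_vec_coords[OF assms(1,2,5)] by simp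

text \<open>As for vector fields, one chart decides.\<close>

lemma pi_field_nearI:
  assumes u: "u \<in> slit_tb atl" and U: "(U, \<phi>) \<in> atl" "fst u \<in> U" and X: "near (slit_atlas atl) u (\<lambda>w. X w \<in> fibre atl w)"
    "smooth_near (slit_atlas atl) u (\<lambda>w. vec_coords \<phi> (X w))"
  shows "pi_field_near atl u X"
  unfolding pi_field_near_def
proof (intro conjI ballI)
  fix c assume "c \<in> atl"
  show "case c of (V, \<psi>) \<Rightarrow> fst u \<in> V \<longrightarrow> smooth_near (slit_atlas atl) u (\<lambda>w. vec_coords \<psi> (X w))"
  proof (clarify)
    fix V \<psi> assume V: "c = (V, \<psi>)" "fst u \<in> V"
    then have V: "(V, \<psi>) \<in> atl" "fst u \<in> V" using \<open>c \<in> atl\<close> by auto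
    have "smooth_near (slit_atlas atl) u (\<lambda>w. frechet_derivative (\<psi> \<circ> inv_into U \<phi>) (at (\<phi> (fst w))) (vec_coords \<phi> (X w)))"
      by (intro slit.smooth_near_derivative_compose slit_smooth_fst_snd[OF u U] X smooth_at_transition[OF U(1) V(1) U(2) V(2)])
    then show "smooth_near (slit_atlas atl) u (\<lambda>w. vec_coords \<psi> (X w))"
    proof (rule slit.smooth_near_cong)
      show "near (slit_atlas atl) u (\<lambda>w. frechet_derivative (\<psi> \<circ> inv_into U \<phi>) (at (\<phi> (fst w))) (vec_coords \<phi> (X w)) = vec_coords \<psi> (X w))"
        by (rule slit.near_elim[OF slit.near_conj[OF slit_near_in[OF u U] slit_near_in[OF u V]] X(1)])
          (rule fibre_change[symmetric, OF U(1) _ V(1)], auto)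
    qed
  qed
qed (use X in auto)

lemma pi_field_nearD:
  assumes "pi_field_near atl u X"
  shows "near (slit_atlas atl) u (\<lambda>w. X w \<in> fibre atl w)"
    "(U, \<phi>) \<in> atl \<Longrightarrow> fst u \<in> U \<Longrightarrow> smooth_near (slit_atlas atl) u (\<lambda>w. vec_coords \<phi> (X w))"
  using assms unfolding pi_field_near_def by auto

lemma pi_field_near_in: 
  assumes "pi_field_near atl u X" 
  shows "X u \<in> fibre atl u"
  using slit.near_self[OF pi_field_nearD(1)[OF assms]] .

lemma pi_field_near_slit: "pi_field_near atl u X \<Longrightarrow> u \<in> slit_tb atl"
  by (rule slit_near_imp[OF pi_field_nearD(1)])

lemma pi_field_near_near:
  assumes X: "pi_field_near atl u X" 
  shows "near (slit_atlas atl) u (\<lambda>w. pi_field_near atl w X)"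
proof -
  obtain U \<phi> where U: "(U, \<phi>) \<in> atl" "fst u \<in> U" using chart_around by blast
  note u = pi_field_near_slit[OF X]
  show ?thesis
    by (rule slit.near_elim[OF slit.near_conj[OF slit_near_in[OF u U] slit.near_near[OF pi_field_nearD(1)[OF X]]]
      slit.smooth_near_near[OF pi_field_nearD(2)[OF X U]]]) (rule pi_field_nearI[OF _ U(1)], auto)
qed

lemma pi_field_near_cong:
  assumes X: "pi_field_near atl u X" and eq: "near (slit_atlas atl) u (\<lambda>w. X w = Y w)"
  shows "pi_field_near atl u Y"
proof -
  obtain U \<phi> where U: "(U, \<phi>) \<in> atl" "fst u \<in> U" using chart_around by blast
  show ?thesis
  proof (rule pi_field_nearI[OF pi_field_near_slit[OF X] U])
    show "near (slit_atlas atl) u (\<lambda>w. Y w \<in> fibre atl w)"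
      by (rule slit.near_elim[OF pi_field_nearD(1)[OF X] eq]) simp
    show "smooth_near (slit_atlas atl) u (\<lambda>w. vec_coords \<phi> (Y w))"
      by (rule slit.smooth_near_cong[OF pi_field_nearD(2)[OF X U] slit.near_mono[OF eq]]) simp
  qed
qed

lemma subspace_fibre: "subspace (fibre atl u)"
proof -
  obtain U \<phi> where U: "(U, \<phi>) \<in> atl" "fst u \<in> U" using chart_around by blast
  show ?thesis by (rule subspace_tangent_space[OF U])
qed

lemma subspace_tspace: 
  assumes "u \<in> slit_tb atl" 
  shows "subspace (tspace atl u)"
proof -
  obtain U \<phi> where U: "(U, \<phi>) \<in> atl" "fst u \<in> U" using chart_around by blast
  show ?thesis using slit.subspace_tangent_space[OF slit_chart[OF U(1)], of u] assms U by simp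
qed

lemma pi_field_near_linear:
  assumes f: "smooth_near (slit_atlas atl) u f" and g: "smooth_near (slit_atlas atl) u g" 
    and X: "pi_field_near atl u X" and Y: "pi_field_near atl u Y"
  shows "pi_field_near atl u (\<lambda>w. f w *\<^sub>R X w + g w *\<^sub>R Y w)"
proof -
  obtain U \<phi> where U: "(U, \<phi>) \<in> atl" "fst u \<in> U" using chart_around by blast
  show ?thesis
  proof (rule pi_field_nearI[OF pi_field_near_slit[OF X] U])
    show "near (slit_atlas atl) u (\<lambda>w. f w *\<^sub>R X w + g w *\<^sub>R Y w \<in> fibre atl w)"
      by (rule slit.near_elim[OF pi_field_nearD(1)[OF X] pi_field_nearD(1)[OF Y]])
       (use subspace_fibre in \<open>auto simp: subspace_add subspace_scale\<close>)
    show "smooth_near (slit_atlas atl) u (\<lambda>w. vec_coords \<phi> (f w *\<^sub>R X w + g w *\<^sub>R Y w))"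
      unfolding vec_coords_linear
      by (intro slit.smooth_near_add slit.smooth_near_scaleR f g pi_field_nearD(2)[OF _ U] X Y)
  qed
qed

lemma pi_field_near_scale:
  assumes "smooth_near (slit_atlas atl) u f" "pi_field_near atl u X" 
  shows "pi_field_near atl u (\<lambda>w. f w *\<^sub>R X w)"
  using pi_field_near_linear[OF assms(1) slit_smooth_const[of u 0] assms(2,2)] pi_field_near_slit[OF assms(2)] by simp

lemma pi_field_near_add:
  assumes "pi_field_near atl u X" "pi_field_near atl u Y" 
  shows "pi_field_near atl u (\<lambda>w. X w + Y w)"
  using pi_field_near_linear[OF slit_smooth_const[of u 1] slit_smooth_const[of u 1] assms] 
    pi_field_near_slit[OF assms(1)] by simp

lemma pi_field_near_minus:
  assumes "pi_field_near atl u X" 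
  shows "pi_field_near atl u (\<lambda>w. - X w)"
  using pi_field_near_scale[OF slit_smooth_const[of u "-1"] assms] pi_field_near_slit[OF assms] by simp

lemma pi_field_near_diff:
  assumes "pi_field_near atl u X" "pi_field_near atl u Y" 
  shows "pi_field_near atl u (\<lambda>w. X w - Y w)"
  using pi_field_near_add[OF assms(1) pi_field_near_minus[OF assms(2)]] by simp

lemma pi_field_near_cscale:
  assumes "pi_field_near atl u X" 
  shows "pi_field_near atl u (\<lambda>w. c *\<^sub>R X w)"
  using pi_field_near_scale[OF slit_smooth_const[of u c] assms] pi_field_near_slit[OF assms] by simp

lemma pi_field_near_coord_vec:
  assumes u: "u \<in> slit_tb atl" and U: "(U, \<phi>) \<in> atl" "fst u \<in> U" and Y: "smooth_near (slit_atlas atl) u Y"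
  shows "pi_field_near atl u (\<lambda>w. coord_vec atl (U, \<phi>) (fst w) (Y w))"
proof (rule pi_field_nearI[OF u U])
  show "near (slit_atlas atl) u (\<lambda>w. coord_vec atl (U, \<phi>) (fst w) (Y w) \<in> fibre atl w)"
    by (rule slit.near_mono[OF slit_near_in[OF u U]]) (rule coord_vec_in[OF U(1)], simp)
  show "smooth_near (slit_atlas atl) u (\<lambda>w. vec_coords \<phi> (coord_vec atl (U, \<phi>) (fst w) (Y w)))"
    by (rule slit.smooth_near_cong[OF Y slit.near_mono[OF slit_near_in[OF u U]]]) (use U in simp)
qed

lemma pi_field_near_eta: "u \<in> slit_tb atl \<Longrightarrow> pi_field_near atl u snd"
proof -
  assume u: "u \<in> slit_tb atl"
  obtain U \<phi> where U: "(U, \<phi>) \<in> atl" "fst u \<in> U" using chart_around by blast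
  show ?thesis
    by (rule pi_field_nearI[OF u U slit_near_always[OF u] slit_smooth_fst_snd(2)[OF u U]]) (auto simp: slit_tb_def)
qed

text \<open>A field with constant components in a chart extends a given vector to a neighbourhood.\<close>

lemma pi_extension_works:
  assumes u: "u \<in> slit_tb atl" and x: "x \<in> fibre atl u"
  shows "pi_field_near atl u (pi_extension atl u x)" "pi_extension atl u x u = x"
proof -
  obtain U \<phi> where U: "(U, \<phi>) \<in> atl" "fst u \<in> U" using chart_around by blast
  let ?X = "\<lambda>w. coord_vec atl (U, \<phi>) (fst w) (vec_coords \<phi> x)"
  have "pi_field_near atl u ?X \<and> ?X u = x"
    using pi_field_near_coord_vec[OF u U slit_smooth_const[OF u]] coord_vec_vec_coords[OF U x] by simp
  then have "pi_field_near atl u (pi_extension atl u x) \<and> pi_extension atl u x u = x"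
    unfolding pi_extension_def by (rule someI[of "\<lambda>X. pi_field_near atl u X \<and> X u = x"])
  then show "pi_field_near atl u (pi_extension atl u x)" "pi_extension atl u x u = x" by auto
qed

lemma pi_field_near_zero: 
  assumes u: "u \<in> slit_tb atl"
  shows "pi_field_near atl u (\<lambda>w. 0)"
  using pi_field_near_scale[OF slit_smooth_const[OF u, of 0] pi_extension_works(1)[OF u, of 0]] 
    subspace_0[OF subspace_fibre] by simp

lemma pi_field_near_sum:
  assumes "u \<in> slit_tb atl" "\<And>i. i \<in> I \<Longrightarrow> pi_field_near atl u (X i)"
  shows "pi_field_near atl u (\<lambda>w. \<Sum>i\<in>I. X i w)"
  using assms(2)
  by (induction I rule: infinite_finite_induct) (auto intro: pi_field_near_zero[OF assms(1)] pi_field_near_add)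

text \<open>In coordinates \<open>\<rho>\<close> is \<open>(a, b) \<mapsto> a\<close>, since \<open>f \<circ> fst\<close> is independent of the fibre coordinates.\<close>

lemma rho_coord_vec:
  assumes u: "u \<in> slit_tb atl" and U: "(U, \<phi>) \<in> atl" "fst u \<in> U"
  shows "rho atl u (coord_vec (slit_atlas atl) (sdom U, smap \<phi>) u z) = coord_vec atl (U, \<phi>) (fst u) (fst z)"
proof
  fix f
  show "rho atl u (coord_vec (slit_atlas atl) (sdom U, smap \<phi>) u z) f = coord_vec atl (U, \<phi>) (fst u) (fst z) f"
  proof (cases "smooth_near atl (fst u) f")
    case True
    let ?F = "f \<circ> inv_into U \<phi>"
    have F: "smooth_at (\<phi> (fst u)) ?F" using True by (simp add: smooth_near_iff[OF U])
    have "smooth_near (slit_atlas atl) u (\<lambda>w. ?F (\<phi> (fst w)))"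
      using slit.smooth_near_compose[OF slit_smooth_fst_snd(1)[OF u U] F] .
    then have ff: "smooth_near (slit_atlas atl) u (f \<circ> fst)"
      by (rule slit.smooth_near_cong[OF _ slit.near_mono[OF slit_near_in[OF u U]]]) (use U in simp)
    have su: "u \<in> sdom U" using u U by simp
    have "eventually (\<lambda>z. ((f \<circ> fst) \<circ> inv_into (sdom U) (smap \<phi>)) z = ?F (fst z)) (nhds (smap \<phi> u))"
      using slit.eventually_chart[OF slit_chart[OF U(1)] su]
    proof eventually_elim
      case (elim z)
      let ?w = "inv_into (sdom U) (smap \<phi>) z"
      have "fst z = \<phi> (fst ?w)" using elim by (metis (no_types, lifting) fst_conv)
      then show ?case using elim U by (simp add: comp_def)
    qed
    from fun_cong[OF frechet_derivative_cong[OF this], of z]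
    have "frechet_derivative ((f \<circ> fst) \<circ> inv_into (sdom U) (smap \<phi>)) (at (smap \<phi> u)) z = 
       frechet_derivative (\<lambda>z. ?F (fst z)) (at (smap \<phi> u)) z" .
    also have "\<dots> = frechet_derivative ?F (at (\<phi> (fst u))) (frechet_derivative fst (at (smap \<phi> u)) z)"
      by (rule frechet_derivative_chain[of "smap \<phi> u" fst ?F, unfolded fst_conv]) (use F smooth_at_fst[OF smooth_at_ident] in auto)
    also have "frechet_derivative fst (at (smap \<phi> u)) z = fst z"
      using fun_cong[OF frechet_derivative_at[OF bounded_linear_imp_has_derivative[OF bounded_linear_fst]], of z] by simp
    finally show ?thesis using True ff by (simp add: rho_def coord_vec_apply slit.coord_vec_apply comp_def)
  qed (simp add: rho_def coord_vec_def)
qed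

lemma rho_coords:
  assumes u: "u \<in> slit_tb atl" and U: "(U, \<phi>) \<in> atl" "fst u \<in> U" and v: "v \<in> tspace atl u"
  shows "rho atl u v = coord_vec atl (U, \<phi>) (fst u) (fst (vec_coords (smap \<phi>) v))"
  using rho_coord_vec[OF u U, of "vec_coords (smap \<phi>) v"] slit.coord_vec_vec_coords[OF slit_chart[OF U(1)] _ v] u U by simp

lemma rho_in: 
  assumes "u \<in> slit_tb atl" "v \<in> tspace atl u" 
  shows "rho atl u v \<in> fibre atl u"
proof -
  obtain U \<phi> where U: "(U, \<phi>) \<in> atl" "fst u \<in> U" using chart_around by blast
  show ?thesis unfolding rho_coords[OF assms(1) U assms(2)] by (rule coord_vec_in[OF U])
qed

lemma rho_linear: "rho atl u (a *\<^sub>R v + b *\<^sub>R w) = a *\<^sub>R rho atl u v + b *\<^sub>R rho atl u w"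
  by (auto simp: rho_def scaleR_fun_def)

end

section \<open>Regular connections and their horizontal curvature\<close>

lemma vec_eq_sum_axis: "(x :: real^'n) = (\<Sum>i\<in>UNIV. (x $ i) *\<^sub>R axis i 1)"
  using basis_expansion[of x] by (simp add: scalar_mult_eq_scaleR)

locale regular_conn = manifold_atlas atl for atl :: "('m, real^'n) chart set" +
  fixes D :: "'m connection"
  assumes regular: "regular_connection atl D"
begin

abbreviation "satl \<equiv> slit_atlas atl"

abbreviation frame :: "'m set \<Rightarrow> ('m \<Rightarrow> real^'n) \<Rightarrow> 'n \<Rightarrow> 'm tb \<Rightarrow> 'm tvec" where
  "frame U \<phi> i \<equiv> \<lambda>w. coord_vec atl (U, \<phi>) (fst w) (axis i 1)"

lemma linear_conn: "linear_connection atl D"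
  using regular unfolding regular_connection_def by (rule conjunct1)

lemma D_in:
  assumes "u \<in> slit_tb atl" "x \<in> tspace atl u" "pi_field_near atl u Y"
  shows "D u x Y \<in> fibre atl u"
  using linear_conn[unfolded linear_connection_def, THEN conjunct1] assms by simp

lemma D_linear:
  assumes "u \<in> slit_tb atl" "x \<in> tspace atl u" "y \<in> tspace atl u" "pi_field_near atl u Y"
  shows "D u (a *\<^sub>R x + b *\<^sub>R y) Y = a *\<^sub>R D u x Y + b *\<^sub>R D u y Y"
  using linear_conn[unfolded linear_connection_def, THEN conjunct2, THEN conjunct1] assms by simp

lemma D_add:
  assumes "x \<in> tspace atl u" "pi_field_near atl u Y" "pi_field_near atl u Z"
  shows "D u x (\<lambda>w. Y w + Z w) = D u x Y + D u x Z"
  using linear_conn[unfolded linear_connection_def, THEN conjunct2, THEN conjunct2, THEN conjunct1] 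
    assms pi_field_near_slit[OF assms(2)] by simp

lemma D_leibniz:
  assumes "x \<in> tspace atl u" "smooth_near satl u f" "pi_field_near atl u Y"
  shows "D u x (\<lambda>w. f w *\<^sub>R Y w) = x f *\<^sub>R Y u + f u *\<^sub>R D u x Y"
  using linear_conn[unfolded linear_connection_def, THEN conjunct2, THEN conjunct2, THEN conjunct2, THEN conjunct1] 
    assms pi_field_near_slit[OF assms(3)] by simp

lemma D_smooth:
  assumes "vector_field_near satl u X" "pi_field_near atl u Y"
  shows "pi_field_near atl u (\<lambda>w. D w (X w) Y)"
  using linear_conn[unfolded linear_connection_def, THEN conjunct2, THEN conjunct2, THEN conjunct2, THEN conjunct2] 
    assms pi_field_near_slit[OF assms(2)] by simp

text \<open>Locality follows from the Leibniz rule, applied to the indicator function of the set on which the two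
  fields agree: its derivative vanishes, and its products with the two fields are the same.\<close>

lemma D_cong:
  assumes x: "x \<in> tspace atl u" and Y: "pi_field_near atl u Y" and eq: "near satl u (\<lambda>w. Y w = Z w)"
  shows "D u x Y = D u x Z"
proof -
  define f where "f = (\<lambda>w. if Y w = Z w then 1 else 0::real)"
  have u: "u \<in> slit_tb atl" using pi_field_near_slit[OF Y] .
  have f1: "near satl u (\<lambda>w. f w = 1)" 
    by (rule slit.near_mono[OF eq]) (simp add: f_def)
  have f: "smooth_near satl u f"
    by (rule slit.smooth_near_cong[OF slit_smooth_const[OF u] slit.near_eq_sym[OF f1]])
  have xf: "x f = 0" "f u = 1"
    using slit.tangent_cong[OF x f1] slit.tangent_const[OF x] slit.near_self[OF f1] by auto
  have "(\<lambda>w. f w *\<^sub>R Y w) = (\<lambda>w. f w *\<^sub>R Z w)" by (auto simp: f_def)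
  then show ?thesis
    using D_leibniz[OF x f Y] D_leibniz[OF x f pi_field_near_cong[OF Y eq]] xf by simp
qed

lemma D_cmult:
  assumes x: "x \<in> tspace atl u" and Y: "pi_field_near atl u Y"
  shows "D u x (\<lambda>w. c *\<^sub>R Y w) = c *\<^sub>R D u x Y"
  using D_leibniz[OF x slit_smooth_const[OF pi_field_near_slit[OF Y]] Y, of c] slit.tangent_const[OF x] by simp

lemma D_zero:
  assumes x: "x \<in> tspace atl u" and u: "u \<in> slit_tb atl"
  shows "D u x (\<lambda>w. 0) = 0"
  using D_cmult[OF x pi_field_near_zero[OF u], of 0] by simp

lemma D_sum:
  assumes x: "x \<in> tspace atl u" and u: "u \<in> slit_tb atl" and Y: "\<And>i. i \<in> I \<Longrightarrow> pi_field_near atl u (Y i)"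
  shows "D u x (\<lambda>w. \<Sum>i\<in>I. Y i w) = (\<Sum>i\<in>I. D u x (Y i))"
  using Y by (induction I rule: infinite_finite_induct) 
    (auto simp: D_zero[OF x u] D_add[OF x] pi_field_near_sum[OF u])

lemma D_dir_scale:
  assumes "u \<in> slit_tb atl" "x \<in> tspace atl u" "pi_field_near atl u Y"
  shows "D u (a *\<^sub>R x) Y = a *\<^sub>R D u x Y"
  using D_linear[OF assms(1,2,2,3), of a 0] by simp

lemma D_dir_add:
  assumes "u \<in> slit_tb atl" "x \<in> tspace atl u" "y \<in> tspace atl u" "pi_field_near atl u Y"
  shows "D u (x + y) Y = D u x Y + D u y Y"
  using D_linear[OF assms, of 1 1] by simp

lemma D_dir_diff:
  assumes "u \<in> slit_tb atl" "x \<in> tspace atl u" "y \<in> tspace atl u" "pi_field_near atl u Y"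
  shows "D u (x - y) Y = D u x Y - D u y Y"
  using D_linear[OF assms, of 1 "-1"] by simp

lemma D_dir_minus:
  assumes "u \<in> slit_tb atl" "x \<in> tspace atl u" "pi_field_near atl u Y"
  shows "D u (- x) Y = - D u x Y"
  using D_dir_scale[OF assms, of "-1"] by simp

lemma D_dir_sum:
  assumes u: "u \<in> slit_tb atl" and x: "\<And>i. i \<in> I \<Longrightarrow> x i \<in> tspace atl u" and Y: "pi_field_near atl u Y"
  shows "D u (\<Sum>i\<in>I. a i *\<^sub>R x i) Y = (\<Sum>i\<in>I. a i *\<^sub>R D u (x i) Y)"
  using x
proof (induction I rule: infinite_finite_induct)
  case (insert i I)
  have "(\<Sum>i\<in>I. a i *\<^sub>R x i) \<in> tspace atl u"
    using insert.prems subspace_tspace[OF u] by (intro subspace_sum subspace_scale) auto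
  moreover have "x i \<in> tspace atl u" "a i *\<^sub>R x i \<in> tspace atl u"
    using insert.prems subspace_scale[OF subspace_tspace[OF u]] by auto
  ultimately show ?case 
    unfolding sum.insert[OF insert(1,2)] using insert by (simp only: D_dir_add[OF u _ _ Y] D_dir_scale[OF u _ Y] insertI1 insertI2)
qed (use D_dir_scale[OF u subspace_0[OF subspace_tspace[OF u]] Y, of 0] in auto)

subsection \<open>The horizontal map\<close>

lemma split_tspace:
  assumes "u \<in> slit_tb atl" 
  shows "vertical_space atl u \<inter> horizontal_space atl D u = {0}"
    "v \<in> tspace atl u \<Longrightarrow> \<exists>x y. v = x + y \<and> x \<in> vertical_space atl u \<and> y \<in> horizontal_space atl D u"
proof -
  have *: "vertical_space atl u \<inter> horizontal_space atl D u = {0} \<and>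
        tspace atl u = {x + y | x y. x \<in> vertical_space atl u \<and> y \<in> horizontal_space atl D u}"
    using regular[unfolded regular_connection_def, THEN conjunct2] assms by simp
  show "vertical_space atl u \<inter> horizontal_space atl D u = {0}" using * by (rule conjunct1)
  assume v: "v \<in> tspace atl u"
  have "tspace atl u = {x + y | x y. x \<in> vertical_space atl u \<and> y \<in> horizontal_space atl D u}"
    using * by (rule conjunct2)
  with v show "\<exists>x y. v = x + y \<and> x \<in> vertical_space atl u \<and> y \<in> horizontal_space atl D u"
    by (simp only: mem_Collect_eq) 
qed

text \<open>The difference of two horizontal vectors with the same projection is both horizontal and vertical. For
  existence, take any vector that projects to \<open>x\<close> and remove its vertical part.\<close>

lemma hmap_ex1:
  assumes u: "u \<in> slit_tb atl" and x: "x \<in> fibre atl u"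
  shows "\<exists>!h. h \<in> horizontal_space atl D u \<and> rho atl u h = x"
proof -
  note eta = pi_field_near_eta[OF u]
  obtain U \<phi> where U: "(U, \<phi>) \<in> atl" "fst u \<in> U" using chart_around by blast
  let ?v = "coord_vec satl (sdom U, smap \<phi>) u (vec_coords \<phi> x, 0)"
  have "?v \<in> tspace atl u" using slit.coord_vec_in[OF slit_chart[OF U(1)]] u U by simp
  then obtain a h where ah: "?v = a + h" "a \<in> vertical_space atl u" "h \<in> horizontal_space atl D u"
    using split_tspace(2)[OF u] by blast
  have "rho atl u (a + h) = rho atl u a + rho atl u h" using rho_linear[of u 1 a 1 h] by simp
  moreover have "rho atl u a = 0" using ah(2) by (simp add: vertical_space_def)
  ultimately have "rho atl u h = rho atl u ?v" using ah(1) by simp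
  also have "\<dots> = x" using rho_coord_vec[OF u U] coord_vec_vec_coords[OF U x] by simp
  finally have h: "rho atl u h = x" .
  show ?thesis
  proof (rule ex1I[of _ h])
    show "h \<in> horizontal_space atl D u \<and> rho atl u h = x" using h ah by simp
    fix k assume k: "k \<in> horizontal_space atl D u \<and> rho atl u k = x"
    have kh: "k \<in> tspace atl u" "h \<in> tspace atl u" using k ah by (auto simp: horizontal_space_def)
    then have t: "k - h \<in> tspace atl u" using subspace_tspace[OF u] by (rule_tac subspace_diff)
    have "rho atl u (k - h) = 0" using rho_linear[of u 1 k "-1" h] k h by simp
    moreover have "D u (k - h) snd = 0" 
      using D_dir_diff[OF u kh eta] k ah by (simp add: horizontal_space_def)
    ultimately have "k - h \<in> vertical_space atl u \<inter> horizontal_space atl D u"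
      using t by (simp add: vertical_space_def horizontal_space_def)
    then show "k = h" using split_tspace(1)[OF u] by simp
  qed
qed

lemma hmap_props:
  assumes u: "u \<in> slit_tb atl" and x: "x \<in> fibre atl u"
  shows "hmap atl D u x \<in> tspace atl u" "D u (hmap atl D u x) snd = 0" "rho atl u (hmap atl D u x) = x"
  using theI'[OF hmap_ex1[OF assms]] unfolding hmap_def horizontal_space_def by auto

lemma hmap_eqI:
  assumes u: "u \<in> slit_tb atl" and h: "h \<in> tspace atl u" "D u h snd = 0" "rho atl u h = x"
  shows "hmap atl D u x = h"
proof -
  have "x \<in> fibre atl u" using rho_in[OF u h(1)] h(3) by simp
  then show ?thesis
    unfolding hmap_def by (rule the1_equality[OF hmap_ex1[OF u]]) (use h in \<open>simp add: horizontal_space_def\<close>)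
qed

lemma hmap_linear:
  assumes u: "u \<in> slit_tb atl" and x: "x \<in> fibre atl u" and y: "y \<in> fibre atl u"
  shows "hmap atl D u (a *\<^sub>R x + b *\<^sub>R y) = a *\<^sub>R hmap atl D u x + b *\<^sub>R hmap atl D u y"
proof (rule hmap_eqI[OF u])
  note hx = hmap_props[OF u x] and hy = hmap_props[OF u y]
  show "a *\<^sub>R hmap atl D u x + b *\<^sub>R hmap atl D u y \<in> tspace atl u"
    using hx(1) hy(1) subspace_tspace[OF u] by (intro subspace_add subspace_scale)
  show "D u (a *\<^sub>R hmap atl D u x + b *\<^sub>R hmap atl D u y) snd = 0"
    using D_linear[OF u hx(1) hy(1) pi_field_near_eta[OF u]] hx hy by simp
  show "rho atl u (a *\<^sub>R hmap atl D u x + b *\<^sub>R hmap atl D u y) = a *\<^sub>R x + b *\<^sub>R y"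
    using hx hy by (simp add: rho_linear)
qed

text \<open>The vertical components of a horizontal lift solve a linear system whose matrix is that of
  \<open>D \<eta>\<close> on the vertical space. Regularity says that this matrix is invertible.\<close>

lemma hmap_smooth:
  assumes X: "pi_field_near atl u X"
  shows "vector_field_near satl u (\<lambda>w. hmap atl D w (X w))"
proof -
  obtain U \<phi> where U: "(U, \<phi>) \<in> atl" "fst u \<in> U" using chart_around by blast
  have u: "u \<in> slit_tb atl" using pi_field_near_slit[OF X] .
  define cv where "cv = coord_vec satl (sdom U, smap \<phi>)"
  define \<xi> where "\<xi> = (\<lambda>w. vec_coords \<phi> (X w))"
  define \<eta> where "\<eta> = (\<lambda>w. snd (vec_coords (smap \<phi>) (hmap atl D w (X w))))"
  define G where "G = (\<lambda>i w. vec_coords \<phi> (D w (cv w (0, axis i 1)) snd))"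
  define E where "E = (\<lambda>w. vec_coords \<phi> (D w (cv w (\<xi> w, 0)) snd))"
  define M where "M = (\<lambda>w. \<chi> j i. G i w $ j)"
  have cv_in: "cv w z \<in> tspace atl w" if "w \<in> sdom U" for w z
    unfolding cv_def by (rule slit.coord_vec_in[OF slit_chart[OF U(1)] that])
  have lin: "linear (cv w)" if "w \<in> sdom U" for w
    unfolding cv_def by (rule slit.linear_coord_vec[OF slit_chart[OF U(1)] that])
  have D_vert: "vec_coords \<phi> (D w (cv w (0, y)) snd) = M w *v y" if w: "w \<in> sdom U" for w y
  proof -
    have "(0, y) = (\<Sum>i\<in>UNIV. (y $ i) *\<^sub>R (0 :: real^'n, axis i (1::real)))"
      using vec_eq_sum_axis[of y] by (simp add: prod_eq_iff fst_sum snd_sum)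
    then have "cv w (0, y) = (\<Sum>i\<in>UNIV. (y $ i) *\<^sub>R cv w (0, axis i 1))"
      by (simp only: linear_sum[OF lin[OF w]] linear_scale[OF lin[OF w]])
    then have "D w (cv w (0, y)) snd = (\<Sum>i\<in>UNIV. (y $ i) *\<^sub>R D w (cv w (0, axis i 1)) snd)"
      using D_dir_sum[of w UNIV "\<lambda>i. cv w (0, axis i 1)" snd "\<lambda>i. y $ i"] cv_in[OF w] pi_field_near_eta w by simp
    then have "vec_coords \<phi> (D w (cv w (0, y)) snd) = (\<Sum>i\<in>UNIV. (y $ i) *\<^sub>R G i w)"
      using linear_vec_coords[of \<phi>] by (simp add: linear_sum linear_scale G_def)
    then show ?thesis by (simp add: vec_eq_iff M_def matrix_vector_mult_def mult.commute)
  qed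
  have system: "M w *v \<eta> w = - E w \<and> hmap atl D w (X w) = cv w (\<xi> w, \<eta> w)"
    if w: "w \<in> sdom U" and Xw: "X w \<in> fibre atl w" for w
  proof -
    let ?h = "hmap atl D w (X w)"
    have ws: "w \<in> slit_tb atl" "fst w \<in> U" using w by auto
    note h = hmap_props[OF ws(1) Xw]
    have h_eq: "cv w (vec_coords (smap \<phi>) ?h) = ?h"
      unfolding cv_def by (rule slit.coord_vec_vec_coords[OF slit_chart[OF U(1)] w h(1)])
    have "fst (vec_coords (smap \<phi>) ?h) = \<xi> w"
      using arg_cong[OF rho_coords[OF ws(1) U(1) ws(2) h(1)], of "vec_coords \<phi>"]
      unfolding h(3) vec_coords_self[OF U(1) ws(2)] \<xi>_def by (rule sym)
    then have "vec_coords (smap \<phi>) ?h = (\<xi> w, \<eta> w)" by (simp add: \<eta>_def prod_eq_iff)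
    then have h_eq: "?h = cv w (\<xi> w, \<eta> w)" using h_eq by simp
    also have "\<dots> = cv w (\<xi> w, 0) + cv w (0, \<eta> w)"
      using linear_add[OF lin[OF w], of "(\<xi> w, 0)" "(0, \<eta> w)"] by simp
    finally have "D w (cv w (\<xi> w, 0)) snd + D w (cv w (0, \<eta> w)) snd = 0"
      using h(2) D_dir_add[OF ws(1) cv_in[OF w] cv_in[OF w] pi_field_near_eta[OF ws(1)]] by simp
    then have "vec_coords \<phi> (D w (cv w (\<xi> w, 0)) snd) + vec_coords \<phi> (D w (cv w (0, \<eta> w)) snd) = 0"
      unfolding linear_add[OF linear_vec_coords, symmetric] by (simp only: linear_0[OF linear_vec_coords])
    then have "E w + M w *v \<eta> w = 0" using D_vert[OF w] by (simp add: E_def)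
    then show ?thesis using h_eq by (simp add: eq_neg_iff_add_eq_0 add.commute)
  qed
  have nearU: "near satl u (\<lambda>w. w \<in> sdom U \<and> X w \<in> fibre atl w)"
    by (rule slit.near_elim[OF slit_near_in[OF u U] pi_field_nearD(1)[OF X]]) simp
  have us: "u \<in> sdom U" using u U by simp
  have \<xi>: "smooth_near satl u \<xi>" unfolding \<xi>_def using pi_field_nearD(2)[OF X U] .
  have smooth_D: "smooth_near satl u (\<lambda>w. vec_coords \<phi> (D w (cv w (z w)) snd))" if "smooth_near satl u z" for z
    unfolding cv_def
    by (rule pi_field_nearD(2)[OF D_smooth[OF slit.vector_field_near_coord_vec[OF slit_chart[OF U(1)] us that] pi_field_near_eta[OF u]] U])
  have G: "smooth_near satl u (G i)" for i
    unfolding G_def by (rule smooth_D[OF slit_smooth_const[OF u]])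
  have E: "smooth_near satl u E"
    unfolding E_def by (rule smooth_D) (intro slit.smooth_near_Pair \<xi> slit_smooth_const[OF u])
  \<comment> \<open>A vector in the kernel would give a vertical vector that is also horizontal.\<close>
  have det: "det (M u) \<noteq> 0"
  proof -
    have "y = 0" if y: "M u *v y = 0" for y
    proof -
      have "vec_coords \<phi> (D u (cv u (0, y)) snd) = 0" using D_vert[OF us] y by simp
      then have "D u (cv u (0, y)) snd = 0"
        using coord_vec_vec_coords[OF U D_in[OF u cv_in[OF us] pi_field_near_eta[OF u]], of "(0, y)"] 
          by (simp add: linear_0[OF linear_coord_vec[OF U]])
      moreover have "rho atl u (cv u (0, y)) = 0"
        unfolding cv_def by (simp add: rho_coord_vec[OF u U] linear_0[OF linear_coord_vec[OF U]])
      ultimately have "cv u (0, y) \<in> vertical_space atl u \<inter> horizontal_space atl D u"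
        using cv_in[OF us] by (simp add: vertical_space_def horizontal_space_def)
      then have "cv u (0, y) = 0" using split_tspace(1)[OF u] by simp
      then show "y = 0"
        unfolding cv_def slit.coord_vec_eq_0_iff[OF slit_chart[OF U(1)] us] by (simp add: zero_prod_def)
    qed
    then have "\<exists>B. B ** M u = mat 1" unfolding matrix_left_invertible_ker by simp
    then show ?thesis unfolding invertible_left_inverse[symmetric] invertible_det_nz .
  qed
  have "smooth_near satl u (\<lambda>w. \<eta> w $ k)" for k
  proof (rule slit.smooth_near_linear_system[where M=M and b="\<lambda>w. - E w"])
    show "smooth_near satl u (\<lambda>w. M w $ i $ j)" for i j
      unfolding M_def using slit.smooth_near_component[OF G] by simp
    show "smooth_near satl u (\<lambda>w. (- E w) $ i)" for i
      using slit.smooth_near_component[OF slit.smooth_near_minus[OF E]] .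
    show "near satl u (\<lambda>w. M w *v \<eta> w = - E w)"
      by (rule slit.near_mono[OF nearU]) (use system in simp)
  qed (rule det)
  then have \<eta>: "smooth_near satl u \<eta>" by (rule slit.smooth_near_vec)
  have eq: "near satl u (\<lambda>w. w \<in> sdom U \<and> hmap atl D w (X w) = cv w (\<xi> w, \<eta> w))"
    by (rule slit.near_mono[OF nearU]) (use system in simp)
  show ?thesis
  proof (rule slit.vector_field_nearI[OF slit_chart[OF U(1)] us])
    show "near satl u (\<lambda>w. hmap atl D w (X w) \<in> tspace atl w)"
      by (rule slit.near_mono[OF nearU]) (use hmap_props in simp)
    show "smooth_near satl u (\<lambda>w. vec_coords (smap \<phi>) (hmap atl D w (X w)))"
      by (rule slit.smooth_near_cong[OF slit.smooth_near_Pair[OF \<xi> \<eta>] slit.near_mono[OF eq]])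
        (use slit.vec_coords_self[OF slit_chart[OF U(1)]] in \<open>simp add: cv_def\<close>)
  qed
qed

subsection \<open>Tensoriality\<close>

lemma frame_smooth:
  assumes "u \<in> slit_tb atl" "(U, \<phi>) \<in> atl" "fst u \<in> U"
  shows "pi_field_near atl u (frame U \<phi> i)"
  by (rule pi_field_near_coord_vec[OF assms slit_smooth_const[OF assms(1)]])

lemma frame_in: "(U, \<phi>) \<in> atl \<Longrightarrow> fst u \<in> U \<Longrightarrow> frame U \<phi> i u \<in> fibre atl u"
  by (rule coord_vec_in)

lemma fibre_expand:
  assumes "(U, \<phi>) \<in> atl" "fst u \<in> U" "x \<in> fibre atl u"
  shows "x = (\<Sum>i\<in>UNIV. (vec_coords \<phi> x $ i) *\<^sub>R frame U \<phi> i u)"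
proof -
  have "x = coord_vec atl (U, \<phi>) (fst u) (vec_coords \<phi> x)" using coord_vec_vec_coords[OF assms] by simp
  also have "\<dots> = coord_vec atl (U, \<phi>) (fst u) (\<Sum>i\<in>UNIV. (vec_coords \<phi> x $ i) *\<^sub>R axis i 1)" 
    by (simp only: vec_eq_sum_axis[symmetric])
  also have "\<dots> = (\<Sum>i\<in>UNIV. (vec_coords \<phi> x $ i) *\<^sub>R frame U \<phi> i u)"
    using linear_coord_vec[OF assms(1,2)] by (simp add: linear_sum linear_scale)
  finally show ?thesis .
qed

text \<open>An operator on fields that is linear over smooth functions can be evaluated on the components in a local
  frame, so its value depends only on the value of the field at the point.\<close>

lemma tensorial_expand:
  fixes T :: "('m tb \<Rightarrow> 'm tvec) \<Rightarrow> 'v::real_vector"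
  assumes add: "\<And>X Y. pi_field_near atl u X \<Longrightarrow> pi_field_near atl u Y \<Longrightarrow> T (\<lambda>w. X w + Y w) = T X + T Y"
    and scale: "\<And>f X. smooth_near satl u f \<Longrightarrow> pi_field_near atl u X \<Longrightarrow> T (\<lambda>w. f w *\<^sub>R X w) = f u *\<^sub>R T X"
    and cong: "\<And>X Y. pi_field_near atl u X \<Longrightarrow> near satl u (\<lambda>w. X w = Y w) \<Longrightarrow> T X = T Y"
    and X: "pi_field_near atl u X" and U: "(U, \<phi>) \<in> atl" "fst u \<in> U"
  shows "T X = (\<Sum>i\<in>UNIV. (vec_coords \<phi> (X u) $ i) *\<^sub>R T (frame U \<phi> i))"
proof -
  have u: "u \<in> slit_tb atl" using pi_field_near_slit[OF X] .
  have zero: "T (\<lambda>w. 0) = 0" 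
    using scale[OF slit_smooth_const[OF u, of 0] pi_field_near_zero[OF u]] by simp
  let ?Y = "\<lambda>i w. (vec_coords \<phi> (X w) $ i) *\<^sub>R frame U \<phi> i w"
  have sm: "smooth_near satl u (\<lambda>w. vec_coords \<phi> (X w) $ i)" for i
    using slit.smooth_near_component[OF pi_field_nearD(2)[OF X U]] .
  have Y: "pi_field_near atl u (?Y i)" for i
    by (intro pi_field_near_scale sm frame_smooth[OF u U])
  have "T (\<lambda>w. \<Sum>i\<in>I. ?Y i w) = (\<Sum>i\<in>I. T (?Y i))" if "finite I" for I
    using that 
  proof induction
    case empty
    show ?case unfolding sum.empty by (rule zero)
  next
    case (insert i I)
    show ?case unfolding sum.insert[OF insert(1,2)] insert(3)[symmetric] by (intro add Y pi_field_near_sum[OF u])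
  qed
  then have "T (\<lambda>w. \<Sum>i\<in>UNIV. ?Y i w) = (\<Sum>i\<in>UNIV. T (?Y i))" by simp
  also have "\<dots> = (\<Sum>i\<in>UNIV. (vec_coords \<phi> (X u) $ i) *\<^sub>R T (frame U \<phi> i))"
    using scale[OF sm frame_smooth[OF u U]] by simp
  also have "T (\<lambda>w. \<Sum>i\<in>UNIV. ?Y i w) = T X"
  proof (rule cong[symmetric, OF X])
    show "near satl u (\<lambda>w. X w = (\<Sum>i\<in>UNIV. ?Y i w))"
      by (rule slit.near_elim[OF slit_near_in[OF u U] pi_field_nearD(1)[OF X]]) (use fibre_expand[OF U(1)] in blast)
  qed
  finally show ?thesis .
qed

lemma tensorial_pointwise:
  fixes T :: "('m tb \<Rightarrow> 'm tvec) \<Rightarrow> 'v::real_vector"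
  assumes add: "\<And>X Y. pi_field_near atl u X \<Longrightarrow> pi_field_near atl u Y \<Longrightarrow> T (\<lambda>w. X w + Y w) = T X + T Y"
    and scale: "\<And>f X. smooth_near satl u f \<Longrightarrow> pi_field_near atl u X \<Longrightarrow> T (\<lambda>w. f w *\<^sub>R X w) = f u *\<^sub>R T X"
    and cong: "\<And>X Y. pi_field_near atl u X \<Longrightarrow> near satl u (\<lambda>w. X w = Y w) \<Longrightarrow> T X = T Y"
    and X: "pi_field_near atl u X" and Y: "pi_field_near atl u Y" and eq: "X u = Y u"
  shows "T X = T Y"
proof -
  obtain U \<phi> where U: "(U, \<phi>) \<in> atl" "fst u \<in> U" using chart_around by blast
  have "T Z = (\<Sum>i\<in>UNIV. (vec_coords \<phi> (Z u) $ i) *\<^sub>R T (frame U \<phi> i))" if "pi_field_near atl u Z" for Z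
    by (rule tensorial_expand[where T=T and u=u, OF add scale cong that U])
  then show ?thesis using X Y eq by simp
qed

lemma vf_in: "vector_field_near satl u V \<Longrightarrow> V u \<in> tspace atl u"
  by (rule slit.vector_field_near_in)

lemma bracket_in: 
  "vector_field_near satl u V \<Longrightarrow> vector_field_near satl u W \<Longrightarrow> lie_bracket satl V W u \<in> tspace atl u"
  by (rule vf_in[OF slit.lie_bracket_vector_field])

lemma curvature_smooth:
  assumes "vector_field_near satl u V" "vector_field_near satl u W" "pi_field_near atl u Z"
  shows "pi_field_near atl u (curvature atl D V W Z)"
  unfolding curvature_def[abs_def]
  by (intro pi_field_near_add pi_field_near_minus D_smooth slit.lie_bracket_vector_field assms)

lemma curvature_antisym:
  assumes "vector_field_near satl u V" "vector_field_near satl u W" "pi_field_near atl u Z"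
  shows "curvature atl D V W Z u = - curvature atl D W V Z u"
proof -
  have "D u (lie_bracket satl V W u) Z = - D u (lie_bracket satl W V u) Z"
    unfolding slit.lie_bracket_antisym[of V W u]
    by (rule D_dir_minus[OF pi_field_near_slit[OF assms(3)] bracket_in[OF assms(2,1)] assms(3)])
  then show ?thesis by (simp add: curvature_def)
qed

lemma near_vf_pi:
  assumes "vector_field_near satl u V" "pi_field_near atl u Z"
  shows "near satl u (\<lambda>w. w \<in> slit_tb atl \<and> V w \<in> tspace atl w \<and> pi_field_near atl w Z)"
  by (rule slit.near_elim[OF slit.vector_field_nearD(1)[OF assms(1)] pi_field_near_near[OF assms(2)]])
    (use pi_field_near_slit in simp)

lemma curvature_add1:
  assumes V: "vector_field_near satl u V" and V': "vector_field_near satl u V'" and W: "vector_field_near satl u W" 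
    and Z: "pi_field_near atl u Z"
  shows "curvature atl D (\<lambda>w. V w + V' w) W Z u = curvature atl D V W Z u + curvature atl D V' W Z u"
proof -
  have u: "u \<in> slit_tb atl" using pi_field_near_slit[OF Z] .
  have 1: "D u (V u + V' u) (\<lambda>w. D w (W w) Z) = D u (V u) (\<lambda>w. D w (W w) Z) + D u (V' u) (\<lambda>w. D w (W w) Z)"
    by (rule D_dir_add[OF u vf_in[OF V] vf_in[OF V'] D_smooth[OF W Z]])
  have "D u (W u) (\<lambda>w. D w (V w + V' w) Z) = D u (W u) (\<lambda>w. D w (V w) Z + D w (V' w) Z)"
  proof (rule D_cong[OF vf_in[OF W] D_smooth[OF slit.vector_field_near_add[OF V V'] Z]])
    show "near satl u (\<lambda>w. D w (V w + V' w) Z = D w (V w) Z + D w (V' w) Z)"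
      by (rule slit.near_elim[OF near_vf_pi[OF V Z] near_vf_pi[OF V' Z]]) (rule D_dir_add, auto)
  qed
  also have "\<dots> = D u (W u) (\<lambda>w. D w (V w) Z) + D u (W u) (\<lambda>w. D w (V' w) Z)"
    by (rule D_add[OF vf_in[OF W] D_smooth[OF V Z] D_smooth[OF V' Z]])
  finally have 2: "D u (W u) (\<lambda>w. D w (V w + V' w) Z) = D u (W u) (\<lambda>w. D w (V w) Z) + D u (W u) (\<lambda>w. D w (V' w) Z)" .
  have 3: "D u (lie_bracket satl (\<lambda>w. V w + V' w) W u) Z = D u (lie_bracket satl V W u) Z + D u (lie_bracket satl V' W u) Z"
    unfolding slit.lie_bracket_add[OF V V' W] by (rule D_dir_add[OF u bracket_in[OF V W] bracket_in[OF V' W] Z])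
  show ?thesis unfolding curvature_def 1 2 3 by simp
qed

text \<open>The term with the derivative of \<open>f\<close> is cancelled by the one that the bracket produces.\<close>

lemma curvature_scale1:
  assumes V: "vector_field_near satl u V" and W: "vector_field_near satl u W" 
    and Z: "pi_field_near atl u Z" and f: "smooth_near satl u f"
  shows "curvature atl D (\<lambda>w. f w *\<^sub>R V w) W Z u = f u *\<^sub>R curvature atl D V W Z u"
proof -
  have u: "u \<in> slit_tb atl" using pi_field_near_slit[OF Z] .
  have 1: "D u (f u *\<^sub>R V u) (\<lambda>w. D w (W w) Z) = f u *\<^sub>R D u (V u) (\<lambda>w. D w (W w) Z)"
    by (rule D_dir_scale[OF u vf_in[OF V] D_smooth[OF W Z]])
  have "D u (W u) (\<lambda>w. D w (f w *\<^sub>R V w) Z) = D u (W u) (\<lambda>w. f w *\<^sub>R D w (V w) Z)"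
  proof (rule D_cong[OF vf_in[OF W] D_smooth[OF slit.vector_field_near_scale[OF f V] Z]])
    show "near satl u (\<lambda>w. D w (f w *\<^sub>R V w) Z = f w *\<^sub>R D w (V w) Z)"
      by (rule slit.near_mono[OF near_vf_pi[OF V Z]]) (rule D_dir_scale, auto)
  qed
  also have "\<dots> = W u f *\<^sub>R D u (V u) Z + f u *\<^sub>R D u (W u) (\<lambda>w. D w (V w) Z)"
    by (rule D_leibniz[OF vf_in[OF W] f D_smooth[OF V Z]])
  finally have 2: "D u (W u) (\<lambda>w. D w (f w *\<^sub>R V w) Z) = W u f *\<^sub>R D u (V u) Z + f u *\<^sub>R D u (W u) (\<lambda>w. D w (V w) Z)" .
  have "D u (lie_bracket satl (\<lambda>w. f w *\<^sub>R V w) W u) Z = D u (f u *\<^sub>R lie_bracket satl V W u + (- W u f) *\<^sub>R V u) Z"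
    unfolding slit.lie_bracket_scale[OF V W f] by simp
  also have "\<dots> = f u *\<^sub>R D u (lie_bracket satl V W u) Z + (- W u f) *\<^sub>R D u (V u) Z"
    by (rule D_linear[OF u bracket_in[OF V W] vf_in[OF V] Z])
  finally have 3: "D u (lie_bracket satl (\<lambda>w. f w *\<^sub>R V w) W u) Z = f u *\<^sub>R D u (lie_bracket satl V W u) Z + (- W u f) *\<^sub>R D u (V u) Z" .
  show ?thesis unfolding curvature_def 1 2 3 by (simp add: scaleR_add_right scaleR_diff_right)
qed

lemma curvature_cong1:
  assumes V: "vector_field_near satl u V" and W: "vector_field_near satl u W" 
    and Z: "pi_field_near atl u Z" and eq: "near satl u (\<lambda>w. V w = V' w)"
  shows "curvature atl D V W Z u = curvature atl D V' W Z u"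
proof -
  have "D u (W u) (\<lambda>w. D w (V w) Z) = D u (W u) (\<lambda>w. D w (V' w) Z)"
    by (rule D_cong[OF vf_in[OF W] D_smooth[OF V Z]]) (rule slit.near_mono[OF eq], simp)
  then show ?thesis
    using slit.lie_bracket_cong[OF W eq] slit.near_self[OF eq] by (simp add: curvature_def)
qed

lemma curvature_add3:
  assumes V: "vector_field_near satl u V" and W: "vector_field_near satl u W" 
    and Z: "pi_field_near atl u Z" and Z': "pi_field_near atl u Z'"
  shows "curvature atl D V W (\<lambda>w. Z w + Z' w) u = curvature atl D V W Z u + curvature atl D V W Z' u"
proof -
  have *: "D u (V u) (\<lambda>w. D w (W w) (\<lambda>w. Z w + Z' w)) = D u (V u) (\<lambda>w. D w (W w) Z) + D u (V u) (\<lambda>w. D w (W w) Z')"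
    if V: "vector_field_near satl u V" and W: "vector_field_near satl u W" for V W
  proof -
    have "D u (V u) (\<lambda>w. D w (W w) (\<lambda>w. Z w + Z' w)) = D u (V u) (\<lambda>w. D w (W w) Z + D w (W w) Z')"
    proof (rule D_cong[OF vf_in[OF V] D_smooth[OF W pi_field_near_add[OF Z Z']]])
      show "near satl u (\<lambda>w. D w (W w) (\<lambda>w. Z w + Z' w) = D w (W w) Z + D w (W w) Z')"
        by (rule slit.near_elim[OF near_vf_pi[OF W Z] near_vf_pi[OF W Z']]) (rule D_add, auto)
    qed
    then show ?thesis using D_add[OF vf_in[OF V] D_smooth[OF W Z] D_smooth[OF W Z']] by simp
  qed
  show ?thesis unfolding curvature_def *[OF V W] *[OF W V] D_add[OF bracket_in[OF V W] Z Z'] by simp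
qed

text \<open>The second derivatives of \<open>f\<close> combine to the bracket applied to \<open>f\<close>, the first derivatives cancel.\<close>

lemma curvature_scale3:
  assumes V: "vector_field_near satl u V" and W: "vector_field_near satl u W" 
    and Z: "pi_field_near atl u Z" and f: "smooth_near satl u f"
  shows "curvature atl D V W (\<lambda>w. f w *\<^sub>R Z w) u = f u *\<^sub>R curvature atl D V W Z u"
proof -
  have *: "D u (V u) (\<lambda>w. D w (W w) (\<lambda>w. f w *\<^sub>R Z w)) = 
     V u (\<lambda>w. W w f) *\<^sub>R Z u + W u f *\<^sub>R D u (V u) Z + (V u f *\<^sub>R D u (W u) Z + f u *\<^sub>R D u (V u) (\<lambda>w. D w (W w) Z))"
    if V: "vector_field_near satl u V" and W: "vector_field_near satl u W" for V W
  proof -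
    have Wf: "smooth_near satl u (\<lambda>w. W w f)" by (rule slit.smooth_near_vector_field_apply[OF W f])
    have "D u (V u) (\<lambda>w. D w (W w) (\<lambda>w. f w *\<^sub>R Z w)) = D u (V u) (\<lambda>w. W w f *\<^sub>R Z w + f w *\<^sub>R D w (W w) Z)"
    proof (rule D_cong[OF vf_in[OF V] D_smooth[OF W pi_field_near_scale[OF f Z]]])
      show "near satl u (\<lambda>w. D w (W w) (\<lambda>w. f w *\<^sub>R Z w) = W w f *\<^sub>R Z w + f w *\<^sub>R D w (W w) Z)"
        by (rule slit.near_elim[OF near_vf_pi[OF W Z] slit.smooth_near_near[OF f]]) (rule D_leibniz, auto)
    qed
    also have "\<dots> = D u (V u) (\<lambda>w. W w f *\<^sub>R Z w) + D u (V u) (\<lambda>w. f w *\<^sub>R D w (W w) Z)"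
      by (rule D_add[OF vf_in[OF V] pi_field_near_scale[OF Wf Z] pi_field_near_scale[OF f D_smooth[OF W Z]]])
    finally show ?thesis
      unfolding D_leibniz[OF vf_in[OF V] Wf Z] D_leibniz[OF vf_in[OF V] f D_smooth[OF W Z]] .
  qed
  have L: "lie_bracket satl V W u f = V u (\<lambda>w. W w f) - W u (\<lambda>w. V w f)" using f by (simp add: lie_bracket_def)
  show ?thesis
    unfolding curvature_def *[OF V W] *[OF W V] D_leibniz[OF bracket_in[OF V W] f Z] L
    by (simp add: scaleR_add_right scaleR_diff_right scaleR_diff_left)
qed

lemma curvature_cong3:
  assumes V: "vector_field_near satl u V" and W: "vector_field_near satl u W" 
    and Z: "pi_field_near atl u Z" and eq: "near satl u (\<lambda>w. Z w = Z' w)"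
  shows "curvature atl D V W Z u = curvature atl D V W Z' u"
proof -
  have *: "D u (V u) (\<lambda>w. D w (W w) Z) = D u (V u) (\<lambda>w. D w (W w) Z')"
    if V: "vector_field_near satl u V" and W: "vector_field_near satl u W" for V W
    by (rule D_cong[OF vf_in[OF V] D_smooth[OF W Z]], 
      rule slit.near_elim[OF near_vf_pi[OF W Z] slit.near_near[OF eq]], rule D_cong, auto)
  show ?thesis unfolding curvature_def *[OF V W] *[OF W V] D_cong[OF bracket_in[OF V W] Z eq] ..
qed

definition horizontal_curvature :: "('m tb \<Rightarrow> 'm tvec) \<Rightarrow> ('m tb \<Rightarrow> 'm tvec) \<Rightarrow> ('m tb \<Rightarrow> 'm tvec) \<Rightarrow> 'm tb \<Rightarrow> 'm tvec" where
  "horizontal_curvature X Y = curvature atl D (\<lambda>w. hmap atl D w (X w)) (\<lambda>w. hmap atl D w (Y w))"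

lemma horizontal_curvature_smooth:
  assumes "pi_field_near atl u X" "pi_field_near atl u Y" "pi_field_near atl u Z"
  shows "pi_field_near atl u (horizontal_curvature X Y Z)"
  unfolding horizontal_curvature_def by (intro curvature_smooth hmap_smooth assms)

lemma horizontal_curvature_antisym:
  assumes "pi_field_near atl u X" "pi_field_near atl u Y" "pi_field_near atl u Z"
  shows "horizontal_curvature X Y Z u = - horizontal_curvature Y X Z u"
  unfolding horizontal_curvature_def by (intro curvature_antisym hmap_smooth assms)

lemma horizontal_curvature_linear1:
  assumes X: "pi_field_near atl u X" and X': "pi_field_near atl u X'" and Y: "pi_field_near atl u Y" and Z: "pi_field_near atl u Z"
    and f: "smooth_near satl u f" and g: "smooth_near satl u g"
  shows "horizontal_curvature (\<lambda>w. f w *\<^sub>R X w + g w *\<^sub>R X' w) Y Z u = f u *\<^sub>R horizontal_curvature X Y Z u + g u *\<^sub>R horizontal_curvature X' Y Z u"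
proof -
  note hX = hmap_smooth[OF X] and hX' = hmap_smooth[OF X'] and hY = hmap_smooth[OF Y]
  have "horizontal_curvature (\<lambda>w. f w *\<^sub>R X w + g w *\<^sub>R X' w) Y Z u = 
    curvature atl D (\<lambda>w. f w *\<^sub>R hmap atl D w (X w) + g w *\<^sub>R hmap atl D w (X' w)) (\<lambda>w. hmap atl D w (Y w)) Z u"
    unfolding horizontal_curvature_def
  proof (rule curvature_cong1[OF hmap_smooth[OF pi_field_near_linear[OF f g X X']] hY Z])
    show "near satl u (\<lambda>w. hmap atl D w (f w *\<^sub>R X w + g w *\<^sub>R X' w) = f w *\<^sub>R hmap atl D w (X w) + g w *\<^sub>R hmap atl D w (X' w))"
      by (rule slit.near_elim[OF pi_field_near_near[OF X] pi_field_near_near[OF X']]) 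
        (rule hmap_linear[OF pi_field_near_slit pi_field_near_in pi_field_near_in])
  qed
  then show ?thesis
    unfolding horizontal_curvature_def curvature_add1[OF slit.vector_field_near_scale[OF f hX] slit.vector_field_near_scale[OF g hX'] hY Z]
      curvature_scale1[OF hX hY Z f] curvature_scale1[OF hX' hY Z g] .
qed

lemma horizontal_curvature_linear2:
  assumes X: "pi_field_near atl u X" and Y: "pi_field_near atl u Y" and Y': "pi_field_near atl u Y'" and Z: "pi_field_near atl u Z"
    and f: "smooth_near satl u f" and g: "smooth_near satl u g"
  shows "horizontal_curvature X (\<lambda>w. f w *\<^sub>R Y w + g w *\<^sub>R Y' w) Z u = f u *\<^sub>R horizontal_curvature X Y Z u + g u *\<^sub>R horizontal_curvature X Y' Z u"
  using horizontal_curvature_linear1[OF Y Y' X Z f g] 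
    horizontal_curvature_antisym[OF X Y Z] horizontal_curvature_antisym[OF X Y' Z] 
    horizontal_curvature_antisym[OF X pi_field_near_linear[OF f g Y Y'] Z] by simp

lemma horizontal_curvature_linear3:
  assumes X: "pi_field_near atl u X" and Y: "pi_field_near atl u Y" and Z: "pi_field_near atl u Z" and Z': "pi_field_near atl u Z'"
    and f: "smooth_near satl u f" and g: "smooth_near satl u g"
  shows "horizontal_curvature X Y (\<lambda>w. f w *\<^sub>R Z w + g w *\<^sub>R Z' w) u = f u *\<^sub>R horizontal_curvature X Y Z u + g u *\<^sub>R horizontal_curvature X Y Z' u"
  unfolding horizontal_curvature_def
  using curvature_add3[OF hmap_smooth[OF X] hmap_smooth[OF Y] pi_field_near_scale[OF f Z] pi_field_near_scale[OF g Z']]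
    curvature_scale3[OF hmap_smooth[OF X] hmap_smooth[OF Y] Z f] curvature_scale3[OF hmap_smooth[OF X] hmap_smooth[OF Y] Z' g]
  by simp

lemma tensorial_pointwise':
  fixes T :: "('m tb \<Rightarrow> 'm tvec) \<Rightarrow> 'v::real_vector"
  assumes lin: "\<And>X Y f g. pi_field_near atl u X \<Longrightarrow> pi_field_near atl u Y \<Longrightarrow> smooth_near satl u f \<Longrightarrow> smooth_near satl u g \<Longrightarrow>
      T (\<lambda>w. f w *\<^sub>R X w + g w *\<^sub>R Y w) = f u *\<^sub>R T X + g u *\<^sub>R T Y"
    and cong: "\<And>X Y. pi_field_near atl u X \<Longrightarrow> near satl u (\<lambda>w. X w = Y w) \<Longrightarrow> T X = T Y"
    and X: "pi_field_near atl u X" and Y: "pi_field_near atl u Y" and eq: "X u = Y u"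
  shows "T X = T Y"
proof (rule tensorial_pointwise[where T=T and u=u, OF _ _ cong X Y eq])
  note u = pi_field_near_slit[OF X]
  show "T (\<lambda>w. X w + Y w) = T X + T Y" if "pi_field_near atl u X" "pi_field_near atl u Y" for X Y
    using lin[OF that slit_smooth_const[OF u, of 1] slit_smooth_const[OF u, of 1]] by simp
  show "T (\<lambda>w. f w *\<^sub>R X w) = f u *\<^sub>R T X" if "smooth_near satl u f" "pi_field_near atl u X" for f X
    using lin[OF that(2,2,1) slit_smooth_const[OF u, of 0]] by simp
qed

text \<open>\<open>hcurv\<close> is defined with unspecified extensions that vary from point to point. By tensoriality it can be
  computed with any fields, which gives its smoothness and its linearity.\<close>

lemma hcurv_eq:
  assumes X: "pi_field_near atl u X" and Y: "pi_field_near atl u Y" and Z: "pi_field_near atl u Z"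
  shows "hcurv atl D u (X u) (Y u) (Z u) = horizontal_curvature X Y Z u"
proof -
  have u: "u \<in> slit_tb atl" using pi_field_near_slit[OF X] .
  let ?E = "pi_extension atl u"
  have E: "pi_field_near atl u (?E (X u))" "?E (X u) u = X u" if "pi_field_near atl u X" for X
    using pi_extension_works[OF u pi_field_near_in[OF that]] by auto
  have cong1: "horizontal_curvature X Y Z u = horizontal_curvature X' Y Z u"
    if "pi_field_near atl u X" "pi_field_near atl u Y" "pi_field_near atl u Z" "near satl u (\<lambda>w. X w = X' w)" for X X' Y Z
    unfolding horizontal_curvature_def
    by (rule curvature_cong1[OF hmap_smooth hmap_smooth]) (use that in \<open>auto intro: slit.near_mono\<close>)
  have 1: "horizontal_curvature X Y Z u = horizontal_curvature X' Y Z u"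
    if "pi_field_near atl u X" "pi_field_near atl u X'" "pi_field_near atl u Y" "pi_field_near atl u Z" "X u = X' u" for X X' Y Z
    by (rule tensorial_pointwise'[where u=u and X=X and Y=X' and T="\<lambda>X. horizontal_curvature X Y Z u"])
      (use that in \<open>auto intro: horizontal_curvature_linear1 cong1\<close>)
  have 2: "horizontal_curvature X Y Z u = horizontal_curvature X Y' Z u"
    if "pi_field_near atl u X" "pi_field_near atl u Y" "pi_field_near atl u Y'" "pi_field_near atl u Z" "Y u = Y' u" for X Y Y' Z
    using 1[OF that(2,3,1,4,5)] horizontal_curvature_antisym[OF that(1,2,4)] horizontal_curvature_antisym[OF that(1,3,4)] by simp
  have cong3: "horizontal_curvature X Y Z u = horizontal_curvature X Y Z' u"
    if "pi_field_near atl u X" "pi_field_near atl u Y" "pi_field_near atl u Z" "near satl u (\<lambda>w. Z w = Z' w)" for X Y Z Z'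
    unfolding horizontal_curvature_def
    by (rule curvature_cong3[OF hmap_smooth hmap_smooth]) (use that in auto)
  have 3: "horizontal_curvature X Y Z u = horizontal_curvature X Y Z' u"
    if "pi_field_near atl u X" "pi_field_near atl u Y" "pi_field_near atl u Z" "pi_field_near atl u Z'" "Z u = Z' u" for X Y Z Z'
    by (rule tensorial_pointwise'[where u=u and X=Z and Y=Z' and T="\<lambda>Z. horizontal_curvature X Y Z u"])
      (use that in \<open>auto intro: horizontal_curvature_linear3 cong3\<close>)
  have "hcurv atl D u (X u) (Y u) (Z u) = horizontal_curvature (?E (X u)) (?E (Y u)) (?E (Z u)) u"
    by (simp add: hcurv_def horizontal_curvature_def)
  also have "\<dots> = horizontal_curvature X (?E (Y u)) (?E (Z u)) u" by (rule 1) (use E X Y Z in auto)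
  also have "\<dots> = horizontal_curvature X Y (?E (Z u)) u" by (rule 2) (use E X Y Z in auto)
  also have "\<dots> = horizontal_curvature X Y Z u" by (rule 3) (use E X Y Z in auto)
  finally show ?thesis .
qed

lemma hcurv_in:
  assumes u: "u \<in> slit_tb atl" and "x \<in> fibre atl u" "y \<in> fibre atl u" "z \<in> fibre atl u"
  shows "hcurv atl D u x y z \<in> fibre atl u"
  unfolding hcurv_def horizontal_curvature_def[symmetric]
  by (intro pi_field_near_in horizontal_curvature_smooth pi_extension_works assms)

lemma hcurv_linear1:
  assumes u: "u \<in> slit_tb atl" and x: "x \<in> fibre atl u" and x': "x' \<in> fibre atl u" and y: "y \<in> fibre atl u" and z: "z \<in> fibre atl u"
  shows "hcurv atl D u (a *\<^sub>R x + b *\<^sub>R x') y z = a *\<^sub>R hcurv atl D u x y z + b *\<^sub>R hcurv atl D u x' y z"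
proof -
  note X = pi_extension_works[OF u x] and X' = pi_extension_works[OF u x'] and Y = pi_extension_works[OF u y] and Z = pi_extension_works[OF u z]
  note c = slit_smooth_const[OF u]
  show ?thesis
    using horizontal_curvature_linear1[OF X(1) X'(1) Y(1) Z(1) c c, of a b] 
      hcurv_eq[OF pi_field_near_linear[OF c c X(1) X'(1)] Y(1) Z(1), of a b]
      hcurv_eq[OF X(1) Y(1) Z(1)] hcurv_eq[OF X'(1) Y(1) Z(1)] X(2) X'(2) Y(2) Z(2) by simp
qed

lemma hcurv_linear2:
  assumes u: "u \<in> slit_tb atl" and x: "x \<in> fibre atl u" and y: "y \<in> fibre atl u" and y': "y' \<in> fibre atl u" and z: "z \<in> fibre atl u"
  shows "hcurv atl D u x (a *\<^sub>R y + b *\<^sub>R y') z = a *\<^sub>R hcurv atl D u x y z + b *\<^sub>R hcurv atl D u x y' z"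
proof -
  note X = pi_extension_works[OF u x] and Y' = pi_extension_works[OF u y'] and Y = pi_extension_works[OF u y] and Z = pi_extension_works[OF u z]
  note c = slit_smooth_const[OF u]
  show ?thesis
    using horizontal_curvature_linear2[OF X(1) Y(1) Y'(1) Z(1) c c, of a b] 
      hcurv_eq[OF X(1) pi_field_near_linear[OF c c Y(1) Y'(1)] Z(1), of a b]
      hcurv_eq[OF X(1) Y(1) Z(1)] hcurv_eq[OF X(1) Y'(1) Z(1)] X(2) Y'(2) Y(2) Z(2) by simp
qed

lemma hcurv_linear3:
  assumes u: "u \<in> slit_tb atl" and x: "x \<in> fibre atl u" and y: "y \<in> fibre atl u" and z: "z \<in> fibre atl u" and z': "z' \<in> fibre atl u"
  shows "hcurv atl D u x y (a *\<^sub>R z + b *\<^sub>R z') = a *\<^sub>R hcurv atl D u x y z + b *\<^sub>R hcurv atl D u x y z'"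
proof -
  note X = pi_extension_works[OF u x] and Z' = pi_extension_works[OF u z'] and Y = pi_extension_works[OF u y] and Z = pi_extension_works[OF u z]
  note c = slit_smooth_const[OF u]
  show ?thesis
    using horizontal_curvature_linear3[OF X(1) Y(1) Z(1) Z'(1) c c, of a b] 
      hcurv_eq[OF X(1) Y(1) pi_field_near_linear[OF c c Z(1) Z'(1)], of a b]
      hcurv_eq[OF X(1) Y(1) Z(1)] hcurv_eq[OF X(1) Y(1) Z'(1)] X(2) Z'(2) Y(2) Z(2) by simp
qed

lemma hcurv_smooth:
  assumes X: "pi_field_near atl u X" and Y: "pi_field_near atl u Y" and Z: "pi_field_near atl u Z"
  shows "pi_field_near atl u (\<lambda>w. hcurv atl D w (X w) (Y w) (Z w))"
proof (rule pi_field_near_cong[OF horizontal_curvature_smooth[OF X Y Z]])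
  show "near satl u (\<lambda>w. horizontal_curvature X Y Z w = hcurv atl D w (X w) (Y w) (Z w))"
    by (rule slit.near_elim[OF slit.near_conj[OF pi_field_near_near[OF X] pi_field_near_near[OF Y]] pi_field_near_near[OF Z]])
      (use hcurv_eq in simp)
qed

end

section \<open>The Finsler metric\<close>

lemma deriv_along_line:
  fixes H :: "'a::euclidean_space \<Rightarrow> real"
  assumes "smooth_at c H"
  shows "deriv (\<lambda>s. H (c + s *\<^sub>R d)) 0 = frechet_derivative H (at c) d"
proof -
  have 1: "((\<lambda>s. c + s *\<^sub>R d) has_derivative (\<lambda>h. h *\<^sub>R d)) (at 0)"
    by (auto intro!: derivative_eq_intros)
  have 2: "(H has_derivative frechet_derivative H (at c)) (at (c + 0 *\<^sub>R d))"
    using smooth_at_has_derivative[OF assms] by simp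
  have "((\<lambda>s. H (c + s *\<^sub>R d)) has_derivative (\<lambda>h. frechet_derivative H (at c) (h *\<^sub>R d))) (at 0)"
    by (rule has_derivative_compose[OF 1 2])
  moreover have "(\<lambda>h. frechet_derivative H (at c) (h *\<^sub>R d)) = (\<lambda>h. frechet_derivative H (at c) d * h)"
    by (simp add: linear_scale[OF smooth_at_linear_derivative[OF assms]] mult.commute)
  ultimately show ?thesis
    by (intro DERIV_imp_deriv) (simp add: has_field_derivative_def)
qed

locale metric_conn = regular_conn atl D for atl :: "('m, real^'n) chart set" and D +
  fixes L :: "'m tb \<Rightarrow> real"
  assumes L_smooth: "u \<in> slit_tb atl \<Longrightarrow> smooth_near satl u L"
    and g_pos: "u \<in> slit_tb atl \<Longrightarrow> x \<in> fibre atl u \<Longrightarrow> x \<noteq> 0 \<Longrightarrow> finsler_g L u x x > 0"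
    and metric: "u \<in> slit_tb atl \<Longrightarrow> v \<in> tspace atl u \<Longrightarrow> pi_field_near atl u Y \<Longrightarrow> pi_field_near atl u Z \<Longrightarrow>
      cov_deriv2 D (finsler_g L) u v Y Z = 0"
begin

abbreviation "g \<equiv> finsler_g L"

definition energy :: "'m set \<Rightarrow> ('m \<Rightarrow> real^'n) \<Rightarrow> (real^'n) \<times> (real^'n) \<Rightarrow> real" where
  "energy U \<phi> z = (L (inv_into (sdom U) (smap \<phi>) z))\<^sup>2"

lemma energy_smooth:
  assumes u: "u \<in> slit_tb atl" and U: "(U, \<phi>) \<in> atl" "fst u \<in> U"
  shows "smooth_at (smap \<phi> u) (energy U \<phi>)"
proof -
  have us: "u \<in> sdom U" using u U by simp
  have "smooth_at (smap \<phi> u) (L \<circ> inv_into (sdom U) (smap \<phi>))"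
    using L_smooth[OF u] unfolding slit.smooth_near_iff[OF slit_chart[OF U(1)] us] .
  from smooth_at_mult[OF this this] show ?thesis
    unfolding energy_def[abs_def] by (simp add: comp_def power2_eq_square)
qed

text \<open>The iterated one-variable derivatives in the definition of \<open>g\<close> are a second derivative of the energy
  along the fibre. The segments through \<open>snd u\<close> stay away from the zero vector only for small parameters,
  so the derivatives are compared as derivatives of germs.\<close>

lemma g_coords:
  assumes u: "u \<in> slit_tb atl" and U: "(U, \<phi>) \<in> atl" "fst u \<in> U" and x: "x \<in> fibre atl u" and y: "y \<in> fibre atl u"
  shows "g u x y = frechet_derivative (\<lambda>z. frechet_derivative (energy U \<phi>) (at z) (0, vec_coords \<phi> y)) 
    (at (smap \<phi> u)) (0, vec_coords \<phi> x) / 2"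
proof -
  define a :: "(real^'n) \<times> (real^'n)" where "a = (0, vec_coords \<phi> x)"
  define b :: "(real^'n) \<times> (real^'n)" where "b = (0, vec_coords \<phi> y)"
  define z0 where "z0 = smap \<phi> u"
  let ?F = "energy U \<phi>"
  have v: "snd u \<in> fibre atl u" "snd u \<noteq> 0" using u by (auto simp: slit_tb_def)
  have L_eq: "(L (fst u, snd u + s *\<^sub>R x + t *\<^sub>R y))\<^sup>2 = ?F (z0 + s *\<^sub>R a + t *\<^sub>R b)" 
    if nz: "snd (z0 + s *\<^sub>R a + t *\<^sub>R b) \<noteq> 0" for s t
  proof -
    let ?\<zeta> = "vec_coords \<phi> (snd u) + s *\<^sub>R vec_coords \<phi> x + t *\<^sub>R vec_coords \<phi> y"
    have z: "z0 + s *\<^sub>R a + t *\<^sub>R b = (\<phi> (fst u), ?\<zeta>)" by (simp add: z0_def a_def b_def)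
    have "coord_vec atl (U, \<phi>) (fst u) ?\<zeta> = snd u + s *\<^sub>R x + t *\<^sub>R y"
      by (simp only: linear_add[OF linear_coord_vec[OF U]] linear_scale[OF linear_coord_vec[OF U]] 
        coord_vec_vec_coords[OF U v(1)] coord_vec_vec_coords[OF U x] coord_vec_vec_coords[OF U y])
    then have "inv_into (sdom U) (smap \<phi>) (z0 + s *\<^sub>R a + t *\<^sub>R b) = (fst u, snd u + s *\<^sub>R x + t *\<^sub>R y)"
      using inv_smap[OF U, of ?\<zeta>] nz z by simp
    then show ?thesis by (simp add: energy_def)
  qed
  have line: "((\<lambda>s. c + s *\<^sub>R d) \<longlongrightarrow> c) (nhds 0)" for c d :: "(real^'n) \<times> (real^'n)"
  proof -
    have "isCont (\<lambda>s::real. c + s *\<^sub>R d) 0" by simp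
    then show ?thesis using tendsto_at_iff_tendsto_nhds[of "\<lambda>s::real. c + s *\<^sub>R d" 0] by (simp add: isCont_def)
  qed
  have nz_ev: "eventually (\<lambda>s. snd (c + s *\<^sub>R d) \<noteq> 0) (nhds 0)" if "snd c \<noteq> 0" for c d :: "(real^'n) \<times> (real^'n)"
    using tendsto_imp_eventually_ne[OF tendsto_snd[OF line] that] .
  have z0: "snd z0 \<noteq> 0"
    using v coord_vec_eq_0_iff[OF U, of "vec_coords \<phi> (snd u)"] coord_vec_vec_coords[OF U v(1)] by (simp add: z0_def)
  have F: "smooth_at z0 ?F" unfolding z0_def by (rule energy_smooth[OF u U])
  have inner: "eventually (\<lambda>s. deriv (\<lambda>t. (L (fst u, snd u + s *\<^sub>R x + t *\<^sub>R y))\<^sup>2) 0 = frechet_derivative ?F (at (z0 + s *\<^sub>R a)) b) (nhds 0)"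
    using nz_ev[OF z0, of a] eventually_compose_filterlim[OF smooth_at_eventually[OF F] line[of z0 a]]
  proof eventually_elim
    case (elim s)
    have "eventually (\<lambda>t. (L (fst u, snd u + s *\<^sub>R x + t *\<^sub>R y))\<^sup>2 = ?F (z0 + s *\<^sub>R a + t *\<^sub>R b)) (nhds 0)"
      using nz_ev[OF elim(1), of b] by eventually_elim (rule L_eq)
    from deriv_cong_ev[OF this refl] show ?case using deriv_along_line[OF elim(2), of b] by simp
  qed
  have "g u x y = deriv (\<lambda>s. frechet_derivative ?F (at (z0 + s *\<^sub>R a)) b) 0 / 2"
    unfolding finsler_g_def using deriv_cong_ev[OF inner refl] by simp
  also have "\<dots> = frechet_derivative (\<lambda>z. frechet_derivative ?F (at z) b) (at z0) a / 2"
    using deriv_along_line[of z0 "\<lambda>z. frechet_derivative ?F (at z) b" a] smooth_at_derivative[OF F smooth_at_const, of b] by simp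
  finally show ?thesis by (simp add: a_def b_def z0_def)
qed

lemma g_sym:
  assumes u: "u \<in> slit_tb atl" and x: "x \<in> fibre atl u" and y: "y \<in> fibre atl u"
  shows "g u x y = g u y x"
proof -
  obtain U \<phi> where U: "(U, \<phi>) \<in> atl" "fst u \<in> U" using chart_around by blast
  show ?thesis unfolding g_coords[OF u U x y] g_coords[OF u U y x] 
    using second_derivative_symmetric[OF energy_smooth[OF u U]] by simp
qed

lemma g_linear1:
  assumes u: "u \<in> slit_tb atl" and x: "x \<in> fibre atl u" and x': "x' \<in> fibre atl u" and y: "y \<in> fibre atl u"
  shows "g u (a *\<^sub>R x + b *\<^sub>R x') y = a * g u x y + b * g u x' y"
proof -
  obtain U \<phi> where U: "(U, \<phi>) \<in> atl" "fst u \<in> U" using chart_around by blast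
  have xx': "a *\<^sub>R x + b *\<^sub>R x' \<in> fibre atl u" using subspace_fibre x x' by (simp add: subspace_add subspace_scale)
  have lin: "linear (frechet_derivative (\<lambda>z. frechet_derivative (energy U \<phi>) (at z) (0, vec_coords \<phi> y)) (at (smap \<phi> u)))"
    by (rule smooth_at_linear_derivative[OF smooth_at_derivative[OF energy_smooth[OF u U] smooth_at_const]])
  have "(0, vec_coords \<phi> (a *\<^sub>R x + b *\<^sub>R x')) = a *\<^sub>R (0::real^'n, vec_coords \<phi> x) + b *\<^sub>R (0, vec_coords \<phi> x')"
    by (simp add: vec_coords_linear)
  then show ?thesis unfolding g_coords[OF u U xx' y] g_coords[OF u U x y] g_coords[OF u U x' y]
    by (simp only: linear_add[OF lin] linear_scale[OF lin]) (simp add: field_simps)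
qed

lemma g_linear2:
  assumes u: "u \<in> slit_tb atl" and x: "x \<in> fibre atl u" and y: "y \<in> fibre atl u" and y': "y' \<in> fibre atl u"
  shows "g u x (a *\<^sub>R y + b *\<^sub>R y') = a * g u x y + b * g u x y'"
proof -
  have yy': "a *\<^sub>R y + b *\<^sub>R y' \<in> fibre atl u" using subspace_fibre y y' by (simp add: subspace_add subspace_scale)
  show ?thesis
    using g_linear1[OF u y y' x] g_sym[OF u x yy'] g_sym[OF u x y] g_sym[OF u x y'] by simp
qed

lemma bilinear_expand:
  fixes B :: "'m tb \<Rightarrow> 'm tvec \<Rightarrow> 'm tvec \<Rightarrow> real"
  assumes lin1: "\<And>x x' y a b. x \<in> fibre atl u \<Longrightarrow> x' \<in> fibre atl u \<Longrightarrow> y \<in> fibre atl u \<Longrightarrow> 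
      B u (a *\<^sub>R x + b *\<^sub>R x') y = a * B u x y + b * B u x' y"
    and U: "(U, \<phi>) \<in> atl" "fst u \<in> U" and x: "x \<in> fibre atl u" and y: "y \<in> fibre atl u"
  shows "B u x y = (\<Sum>i\<in>UNIV. vec_coords \<phi> x $ i * B u (frame U \<phi> i u) y)"
proof -
  have zero: "B u 0 y = 0" using lin1[OF x x y, of 0 0] by simp
  have sum_in: "(\<Sum>i\<in>I. c i *\<^sub>R frame U \<phi> i u) \<in> fibre atl u" for c I
    by (intro subspace_sum[OF subspace_fibre] subspace_scale[OF subspace_fibre] frame_in[OF U])
  have *: "B u (\<Sum>i\<in>I. c i *\<^sub>R frame U \<phi> i u) y = (\<Sum>i\<in>I. c i * B u (frame U \<phi> i u) y)" if "finite I" for c I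
    using that
  proof induction
    case empty
    show ?case using zero by (simp only: sum.empty)
  next
    case (insert i I)
    show ?case unfolding sum.insert[OF insert(1,2)] insert(3)[symmetric]
      by (rule lin1[OF frame_in[OF U] sum_in y, of "c i" i 1 c I, unfolded scaleR_one mult_1])
  qed
  have "B u x y = B u (\<Sum>i\<in>UNIV. (vec_coords \<phi> x $ i) *\<^sub>R frame U \<phi> i u) y"
    by (rule arg_cong[OF fibre_expand[OF U x]])
  also have "\<dots> = (\<Sum>i\<in>UNIV. vec_coords \<phi> x $ i * B u (frame U \<phi> i u) y)" by (rule *) simp
  finally show ?thesis .
qed

lemma g_smooth:
  assumes X: "pi_field_near atl u X" and Y: "pi_field_near atl u Y"
  shows "smooth_near satl u (\<lambda>w. g w (X w) (Y w))"
proof -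
  obtain U \<phi> where U: "(U, \<phi>) \<in> atl" "fst u \<in> U" using chart_around by blast
  have u: "u \<in> slit_tb atl" using pi_field_near_slit[OF X] .
  have us: "u \<in> sdom U" using u U by simp
  note F = energy_smooth[OF u U]
  let ?G = "\<lambda>w. \<Sum>i\<in>UNIV. \<Sum>j\<in>UNIV. (vec_coords \<phi> (X w) $ i * vec_coords \<phi> (Y w) $ j) * 
      (1/2 * frechet_derivative (\<lambda>z. frechet_derivative (energy U \<phi>) (at z) (0, axis j 1)) (at (smap \<phi> w)) (0, axis i 1))"
  have "smooth_near satl u ?G"
  proof (intro slit.smooth_near_sum[OF slit_chart[OF U(1)] us] slit.smooth_near_mult slit_smooth_const[OF u])
    fix i j
    show "smooth_near satl u (\<lambda>w. vec_coords \<phi> (X w) $ i)" "smooth_near satl u (\<lambda>w. vec_coords \<phi> (Y w) $ j)"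
      using slit.smooth_near_component[OF pi_field_nearD(2)[OF X U]] slit.smooth_near_component[OF pi_field_nearD(2)[OF Y U]] .
    show "smooth_near satl u (\<lambda>w. frechet_derivative (\<lambda>z. frechet_derivative (energy U \<phi>) (at z) (0, axis j 1)) (at (smap \<phi> w)) (0, axis i 1))"
      by (rule slit.smooth_near_derivative_compose[OF slit.smooth_near_coord[OF slit_chart[OF U(1)] us] 
        smooth_at_derivative[OF F smooth_at_const] slit_smooth_const[OF u]])
  qed
  then show ?thesis
  proof (rule slit.smooth_near_cong)
    show "near satl u (\<lambda>w. ?G w = g w (X w) (Y w))"
    proof (rule slit.near_elim[OF slit.near_conj[OF pi_field_near_near[OF X] pi_field_near_near[OF Y]] slit_near_in[OF u U]])
      fix w assume *: "pi_field_near atl w X \<and> pi_field_near atl w Y" "w \<in> slit_tb atl \<and> fst w \<in> U"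
      then have w: "w \<in> slit_tb atl" "fst w \<in> U" "X w \<in> fibre atl w" "Y w \<in> fibre atl w" using pi_field_near_in by auto
      note fr = frame_in[OF U(1) w(2)]
      have 1: "g w (X w) (Y w) = (\<Sum>i\<in>UNIV. vec_coords \<phi> (X w) $ i * g w (frame U \<phi> i w) (Y w))"
        by (rule bilinear_expand[where B=g and u=w, OF g_linear1[OF w(1)] U(1) w(2,3,4)]) 
      have 2: "g w (frame U \<phi> i w) (Y w) = (\<Sum>j\<in>UNIV. vec_coords \<phi> (Y w) $ j * g w (frame U \<phi> i w) (frame U \<phi> j w))" for i
        using bilinear_expand[where B=g and u=w, OF g_linear1[OF w(1)] U(1) w(2,4) fr] g_sym[OF w(1)] fr w(4) by simp
      have 3: "g w (frame U \<phi> i w) (frame U \<phi> j w) = 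
        1/2 * frechet_derivative (\<lambda>z. frechet_derivative (energy U \<phi>) (at z) (0, axis j 1)) (at (smap \<phi> w)) (0, axis i 1)" for i j
        using g_coords[OF w(1) U(1) w(2) fr fr] U(1) w(2) by simp
      show "?G w = g w (X w) (Y w)" unfolding 1 2 3 by (simp add: sum_distrib_left mult.assoc)
    qed
  qed
qed

lemma g_nondegenerate:
  assumes u: "u \<in> slit_tb atl" and x: "x \<in> fibre atl u" and y: "y \<in> fibre atl u" 
    and eq: "\<And>z. z \<in> fibre atl u \<Longrightarrow> g u x z = g u y z"
  shows "x = y"
proof (rule ccontr)
  assume "x \<noteq> y"
  have d: "x - y \<in> fibre atl u" using subspace_diff[OF subspace_fibre x y] .
  then have "g u (x - y) (x - y) > 0" using g_pos[OF u d] \<open>x \<noteq> y\<close> by simp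
  moreover have "g u (x - y) (x - y) = g u x (x - y) - g u y (x - y)"
    using g_linear1[OF u x y d, of 1 "-1"] by simp
  ultimately show False using eq[OF d] by simp
qed

lemma metric_compat:
  assumes v: "v \<in> tspace atl u" and Y: "pi_field_near atl u Y" and Z: "pi_field_near atl u Z"
  shows "v (\<lambda>w. g w (Y w) (Z w)) = g u (D u v Y) (Z u) + g u (Y u) (D u v Z)"
  using metric[OF pi_field_near_slit[OF Y] v Y Z] by (simp add: cov_deriv2_def)

text \<open>Differentiate \<open>g(Y, Z)\<close> twice, along \<open>V\<close> and \<open>W\<close>. Since \<open>g\<close> is parallel, the mixed terms are symmetric in
  \<open>V\<close> and \<open>W\<close> and drop out of the commutator.\<close>

lemma curvature_skew:
  assumes V: "vector_field_near satl u V" and W: "vector_field_near satl u W" 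
    and Y: "pi_field_near atl u Y" and Z: "pi_field_near atl u Z"
  shows "g u (curvature atl D V W Y u) (Z u) + g u (Y u) (curvature atl D V W Z u) = 0"
proof -
  have u: "u \<in> slit_tb atl" using pi_field_near_slit[OF Y] .
  let ?f = "\<lambda>w. g w (Y w) (Z w)"
  have f: "smooth_near satl u ?f" by (rule g_smooth[OF Y Z])
  have *: "V u (\<lambda>w. W w ?f) = g u (D u (V u) (\<lambda>w. D w (W w) Y)) (Z u) + g u (D u (W u) Y) (D u (V u) Z)
      + (g u (D u (V u) Y) (D u (W u) Z) + g u (Y u) (D u (V u) (\<lambda>w. D w (W w) Z)))"
    if V: "vector_field_near satl u V" and W: "vector_field_near satl u W" for V W
  proof -
    note DY = D_smooth[OF W Y] and DZ = D_smooth[OF W Z]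
    have "V u (\<lambda>w. W w ?f) = V u (\<lambda>w. g w (D w (W w) Y) (Z w) + g w (Y w) (D w (W w) Z))"
    proof (rule slit.tangent_cong[OF vf_in[OF V]])
      show "near satl u (\<lambda>w. W w ?f = g w (D w (W w) Y) (Z w) + g w (Y w) (D w (W w) Z))"
        by (rule slit.near_elim[OF near_vf_pi[OF W Y] near_vf_pi[OF W Z]]) (rule metric_compat, auto)
    qed
    also have "\<dots> = V u (\<lambda>w. g w (D w (W w) Y) (Z w)) + V u (\<lambda>w. g w (Y w) (D w (W w) Z))"
      by (rule slit.tangent_add[OF vf_in[OF V] g_smooth[OF DY Z] g_smooth[OF Y DZ]])
    finally show ?thesis unfolding metric_compat[OF vf_in[OF V] DY Z] metric_compat[OF vf_in[OF V] Y DZ] .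
  qed
  note b = bracket_in[OF V W]
  have L: "g u (D u (lie_bracket satl V W u) Y) (Z u) + g u (Y u) (D u (lie_bracket satl V W u) Z) = V u (\<lambda>w. W w ?f) - W u (\<lambda>w. V w ?f)"
    unfolding metric_compat[OF b Y Z, symmetric] using f by (simp add: lie_bracket_def)
  note Yu = pi_field_near_in[OF Y] and Zu = pi_field_near_in[OF Z]
  have in_: "D u (V u) (\<lambda>w. D w (W w) X) \<in> fibre atl u" "D u (W u) (\<lambda>w. D w (V w) X) \<in> fibre atl u" "D u (lie_bracket satl V W u) X \<in> fibre atl u"
    if "pi_field_near atl u X" for X
    using D_in[OF u vf_in[OF V] D_smooth[OF W that]] D_in[OF u vf_in[OF W] D_smooth[OF V that]] D_in[OF u b that] by auto
  have expand: "curvature atl D V W X u = 1 *\<^sub>R (1 *\<^sub>R D u (W u) (\<lambda>w. D w (V w) X) + (-1) *\<^sub>R D u (V u) (\<lambda>w. D w (W w) X)) 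
     + 1 *\<^sub>R D u (lie_bracket satl V W u) X" for X by (simp add: curvature_def)
  have in2: "1 *\<^sub>R D u (W u) (\<lambda>w. D w (V w) X) + (-1) *\<^sub>R D u (V u) (\<lambda>w. D w (W w) X) \<in> fibre atl u" if "pi_field_near atl u X" for X
    using in_[OF that] by (intro subspace_add[OF subspace_fibre] subspace_scale[OF subspace_fibre])
  show ?thesis
    unfolding expand g_linear1[OF u in2[OF Y] in_(3)[OF Y] Zu] g_linear1[OF u in_(2)[OF Y] in_(1)[OF Y] Zu]
      g_linear2[OF u Yu in2[OF Z] in_(3)[OF Z]] g_linear2[OF u Yu in_(2)[OF Z] in_(1)[OF Z]]
    using L *[OF V W] *[OF W V] by simp
qed

lemma hcurv_skew:
  assumes u: "u \<in> slit_tb atl" and x: "x \<in> fibre atl u" and y: "y \<in> fibre atl u" and z: "z \<in> fibre atl u" and v: "v \<in> fibre atl u"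
  shows "g u (hcurv atl D u x y z) v = - g u z (hcurv atl D u x y v)"
proof -
  note X = pi_extension_works[OF u x] and Y = pi_extension_works[OF u y] and Z = pi_extension_works[OF u z] and V = pi_extension_works[OF u v]
  show ?thesis
    using curvature_skew[OF hmap_smooth[OF X(1)] hmap_smooth[OF Y(1)] Z(1) V(1)] Z(2) V(2)
    unfolding hcurv_def by simp
qed

section \<open>Traces and the Ricci tensor\<close>

text \<open>\<open>trace_on\<close> uses an unspecified basis \<open>B\<close>. Expanding \<open>F b\<close> in the frame, and then the frame vectors in \<open>B\<close>,
  replaces it by the frame of a chart.\<close>

lemma trace_on_fibre:
  assumes U: "(U, \<phi>) \<in> atl" "fst u \<in> U"
    and F: "\<And>x. x \<in> fibre atl u \<Longrightarrow> F x \<in> fibre atl u"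
    and lin: "\<And>x y a b. x \<in> fibre atl u \<Longrightarrow> y \<in> fibre atl u \<Longrightarrow> F (a *\<^sub>R x + b *\<^sub>R y) = a *\<^sub>R F x + b *\<^sub>R F y"
  shows "trace_on (fibre atl u) F = (\<Sum>i\<in>UNIV. vec_coords \<phi> (F (frame U \<phi> i u)) $ i)"
proof -
  let ?V = "fibre atl u" and ?e = "\<lambda>i. frame U \<phi> i u"
  have ex: "\<exists>B. independent B \<and> span B = ?V"
  proof -
    obtain B where B: "B \<subseteq> ?V" "independent B" "?V \<subseteq> span B"
      using maximal_independent_subset by blast
    have "span B \<subseteq> ?V" by (rule span_minimal[OF B(1) subspace_fibre])
    then show ?thesis using B by blast
  qed
  define B where "B = (SOME B. independent B \<and> span B = ?V)"
  have B: "independent B" "span B = ?V"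
    using someI_ex[OF ex] unfolding B_def[symmetric] by auto
  have BV: "b \<in> ?V" if "b \<in> B" for b using span_base[OF that] B(2) by simp
  have e: "?e i \<in> ?V" for i by (rule frame_in[OF U])
  have "B \<subseteq> span (range ?e)"
  proof
    fix b assume "b \<in> B"
    have "(\<Sum>i\<in>UNIV. (vec_coords \<phi> b $ i) *\<^sub>R ?e i) \<in> span (range ?e)"
      by (intro span_sum span_scale span_base) simp
    then show "b \<in> span (range ?e)" using fibre_expand[OF U BV[OF \<open>b \<in> B\<close>]] by simp
  qed
  then have fin: "finite B" using independent_span_bound[OF _ B(1), of "range ?e"] by simp
  let ?rep = "representation B"
  have Fsum: "F (\<Sum>b\<in>I. c b *\<^sub>R b) = (\<Sum>b\<in>I. c b *\<^sub>R F b)" if "finite I" "I \<subseteq> B" for c I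
    using that
  proof induction
    case empty
    show ?case using lin[OF e e, of 0 undefined 0 undefined] by (simp only: sum.empty scale_zero_left add_0_left)
  next
    case (insert b I)
    have "(\<Sum>b\<in>I. c b *\<^sub>R b) \<in> ?V"
      using insert.prems BV by (intro subspace_sum[OF subspace_fibre] subspace_scale[OF subspace_fibre]) auto
    then have "F (c b *\<^sub>R b + 1 *\<^sub>R (\<Sum>b\<in>I. c b *\<^sub>R b)) = c b *\<^sub>R F b + 1 *\<^sub>R F (\<Sum>b\<in>I. c b *\<^sub>R b)"
      using insert.prems BV by (intro lin) auto
    moreover have "F (\<Sum>b\<in>I. c b *\<^sub>R b) = (\<Sum>b\<in>I. c b *\<^sub>R F b)" using insert by blast
    ultimately show ?case unfolding sum.insert[OF insert(1,2)] scaleR_one by (simp only:)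
  qed
  have "trace_on ?V F = (\<Sum>b\<in>B. ?rep (F b) b)"
    unfolding trace_on_def Let_def B_def[symmetric] ..
  also have "\<dots> = (\<Sum>b\<in>B. \<Sum>i\<in>UNIV. vec_coords \<phi> (F b) $ i * ?rep (?e i) b)"
  proof (rule sum.cong[OF refl])
    fix b assume b: "b \<in> B"
    have "?rep (F b) = ?rep (\<Sum>i\<in>UNIV. (vec_coords \<phi> (F b) $ i) *\<^sub>R ?e i)"
      using fibre_expand[OF U F[OF BV[OF b]]] by simp
    also have "\<dots> = (\<lambda>b'. \<Sum>i\<in>UNIV. ?rep ((vec_coords \<phi> (F b) $ i) *\<^sub>R ?e i) b')"
      by (rule representation_sum[OF B(1)]) (use e B(2) subspace_scale[OF subspace_fibre] in simp)
    finally show "?rep (F b) b = (\<Sum>i\<in>UNIV. vec_coords \<phi> (F b) $ i * ?rep (?e i) b)"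
      using representation_scale[OF B(1)] e B(2) by simp
  qed
  also have "\<dots> = (\<Sum>i\<in>UNIV. \<Sum>b\<in>B. ?rep (?e i) b * vec_coords \<phi> (F b) $ i)"
    by (subst sum.swap) (simp add: mult.commute)
  also have "\<dots> = (\<Sum>i\<in>UNIV. vec_coords \<phi> (F (?e i)) $ i)"
  proof (rule sum.cong[OF refl])
    fix i
    have "F (?e i) = F (\<Sum>b\<in>B. ?rep (?e i) b *\<^sub>R b)"
      using sum_representation_eq[OF B(1) _ fin subset_refl, of "?e i"] e B(2) by simp
    also have "\<dots> = (\<Sum>b\<in>B. ?rep (?e i) b *\<^sub>R F b)" by (rule Fsum[OF fin subset_refl])
    finally have "vec_coords \<phi> (F (?e i)) = (\<Sum>b\<in>B. ?rep (?e i) b *\<^sub>R vec_coords \<phi> (F b))"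
      by (simp only: linear_sum[OF linear_vec_coords] linear_scale[OF linear_vec_coords])
    then show "(\<Sum>b\<in>B. ?rep (?e i) b * vec_coords \<phi> (F b) $ i) = vec_coords \<phi> (F (?e i)) $ i" by simp
  qed
  finally show ?thesis .
qed

abbreviation "R \<equiv> hcurv atl D"
abbreviation "ric \<equiv> Ric atl D"

lemma ric_coords:
  assumes u: "u \<in> slit_tb atl" and U: "(U, \<phi>) \<in> atl" "fst u \<in> U" and x: "x \<in> fibre atl u" and y: "y \<in> fibre atl u"
  shows "ric u x y = (\<Sum>i\<in>UNIV. vec_coords \<phi> (R u x (frame U \<phi> i u) y) $ i)"
  unfolding Ric_def
  by (rule trace_on_fibre[where F="\<lambda>z. R u x z y", OF U hcurv_in[OF u x _ y] hcurv_linear2[OF u x _ _ y]])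

lemma ric_linear1:
  assumes u: "u \<in> slit_tb atl" and x: "x \<in> fibre atl u" and x': "x' \<in> fibre atl u" and y: "y \<in> fibre atl u"
  shows "ric u (a *\<^sub>R x + b *\<^sub>R x') y = a * ric u x y + b * ric u x' y"
proof -
  obtain U \<phi> where U: "(U, \<phi>) \<in> atl" "fst u \<in> U" using chart_around by blast
  have xx': "a *\<^sub>R x + b *\<^sub>R x' \<in> fibre atl u" using subspace_fibre x x' by (simp add: subspace_add subspace_scale)
  show ?thesis
    unfolding ric_coords[OF u U xx' y] ric_coords[OF u U x y] ric_coords[OF u U x' y] hcurv_linear1[OF u x x' frame_in[OF U] y]
    by (simp add: vec_coords_linear sum.distrib sum_distrib_left)
qed

lemma ric_linear2:
  assumes u: "u \<in> slit_tb atl" and x: "x \<in> fibre atl u" and y: "y \<in> fibre atl u" and y': "y' \<in> fibre atl u"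
  shows "ric u x (a *\<^sub>R y + b *\<^sub>R y') = a * ric u x y + b * ric u x y'"
proof -
  obtain U \<phi> where U: "(U, \<phi>) \<in> atl" "fst u \<in> U" using chart_around by blast
  have yy': "a *\<^sub>R y + b *\<^sub>R y' \<in> fibre atl u" using subspace_fibre y y' by (simp add: subspace_add subspace_scale)
  show ?thesis
    unfolding ric_coords[OF u U x yy'] ric_coords[OF u U x y] ric_coords[OF u U x y'] hcurv_linear3[OF u x frame_in[OF U] y y']
    by (simp add: vec_coords_linear sum.distrib sum_distrib_left)
qed

lemma ric_smooth:
  assumes X: "pi_field_near atl u X" and Y: "pi_field_near atl u Y"
  shows "smooth_near satl u (\<lambda>w. ric w (X w) (Y w))"
proof -
  obtain U \<phi> where U: "(U, \<phi>) \<in> atl" "fst u \<in> U" using chart_around by blast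
  have u: "u \<in> slit_tb atl" using pi_field_near_slit[OF X] .
  have us: "u \<in> sdom U" using u U by simp
  have "smooth_near satl u (\<lambda>w. \<Sum>i\<in>UNIV. vec_coords \<phi> (R w (X w) (frame U \<phi> i w) (Y w)) $ i)"
    by (intro slit.smooth_near_sum[OF slit_chart[OF U(1)] us] slit.smooth_near_component pi_field_nearD(2)[OF _ U] hcurv_smooth X Y frame_smooth[OF u U])
  then show ?thesis
  proof (rule slit.smooth_near_cong)
    show "near satl u (\<lambda>w. (\<Sum>i\<in>UNIV. vec_coords \<phi> (R w (X w) (frame U \<phi> i w) (Y w)) $ i) = ric w (X w) (Y w))"
      by (rule slit.near_elim[OF slit.near_conj[OF pi_field_near_near[OF X] pi_field_near_near[OF Y]] slit_near_in[OF u U]])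
        (rule ric_coords[symmetric, OF _ U(1)], auto intro: pi_field_near_in)
  qed
qed

definition gram :: "'m set \<Rightarrow> ('m \<Rightarrow> real^'n) \<Rightarrow> 'm tb \<Rightarrow> real^'n^'n" where
  "gram U \<phi> w = (\<chi> j i. g w (frame U \<phi> i w) (frame U \<phi> j w))"

lemma gram_coords:
  assumes w: "w \<in> slit_tb atl" and U: "(U, \<phi>) \<in> atl" "fst w \<in> U" and z: "z \<in> fibre atl w"
  shows "gram U \<phi> w *v vec_coords \<phi> z = (\<chi> j. g w z (frame U \<phi> j w))"
  using bilinear_expand[where B=g and u=w, OF g_linear1[OF w] U z frame_in[OF U]]
  by (simp add: vec_eq_iff gram_def matrix_vector_mult_def mult.commute)

lemma det_gram:
  assumes w: "w \<in> slit_tb atl" and U: "(U, \<phi>) \<in> atl" "fst w \<in> U"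
  shows "det (gram U \<phi> w) \<noteq> 0"
proof -
  have "c = 0" if c: "gram U \<phi> w *v c = 0" for c
  proof -
    let ?z = "coord_vec atl (U, \<phi>) (fst w) c"
    have z: "?z \<in> fibre atl w" by (rule coord_vec_in[OF U])
    have "(\<chi> j. g w ?z (frame U \<phi> j w)) = 0" using gram_coords[OF w U z] c U by simp
    then have "g w ?z (frame U \<phi> j w) = 0" for j by (simp add: vec_eq_iff)
    then have "g w ?z ?z = 0"
      using bilinear_expand[where B=g and u=w, OF g_linear1[OF w] U z z] g_sym[OF w z frame_in[OF U]] by simp
    then have "?z = 0" using g_pos[OF w z] by fastforce
    then show "c = 0" using coord_vec_eq_0_iff[OF U] by simp
  qed
  then have "\<exists>B. B ** gram U \<phi> w = mat 1" unfolding matrix_left_invertible_ker by simp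
  then show ?thesis unfolding invertible_left_inverse[symmetric] invertible_det_nz .
qed

abbreviation "rico \<equiv> Ric_o atl L D"

text \<open>Solve for the components of \<open>Ric_o x\<close>: the Gram matrix of a frame is invertible because \<open>g\<close> is positive
  definite.\<close>

lemma rico_props:
  assumes u: "u \<in> slit_tb atl" and x: "x \<in> fibre atl u"
  shows "rico u x \<in> fibre atl u" "y \<in> fibre atl u \<Longrightarrow> g u (rico u x) y = ric u x y"
proof -
  obtain U \<phi> where U: "(U, \<phi>) \<in> atl" "fst u \<in> U" using chart_around by blast
  have "\<exists>!z. z \<in> fibre atl u \<and> (\<forall>y\<in>fibre atl u. g u z y = ric u x y)"
  proof (rule ex_ex1I)
    let ?b = "\<chi> j. ric u x (frame U \<phi> j u)"
    define c where "c = (\<chi> k. det (\<chi> i j. if j = k then ?b $ i else gram U \<phi> u $ i $ j) / det (gram U \<phi> u))"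
    have c: "gram U \<phi> u *v c = ?b" unfolding cramer[OF det_gram[OF u U]] c_def ..
    let ?z = "coord_vec atl (U, \<phi>) (fst u) c"
    have z: "?z \<in> fibre atl u" by (rule coord_vec_in[OF U])
    have "(\<chi> j. g u ?z (frame U \<phi> j u)) = ?b" using gram_coords[OF u U z] c U by simp
    then have eq: "g u ?z (frame U \<phi> j u) = ric u x (frame U \<phi> j u)" for j by (simp add: vec_eq_iff)
    have "g u ?z y = ric u x y" if y: "y \<in> fibre atl u" for y
    proof -
      have "g u ?z y = (\<Sum>i\<in>UNIV. vec_coords \<phi> y $ i * g u ?z (frame U \<phi> i u))"
        by (rule bilinear_expand[where B="\<lambda>u x y. g u y x" and u=u, OF g_linear2[OF u] U y z])
      also have "\<dots> = ric u x y" unfolding eq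
        by (rule bilinear_expand[where B="\<lambda>u x y. ric u y x" and u=u, OF ric_linear2[OF u] U y x, symmetric])
      finally show ?thesis .
    qed
    then show "\<exists>z. z \<in> fibre atl u \<and> (\<forall>y\<in>fibre atl u. g u z y = ric u x y)" using z by blast
  next
    fix z z' assume "z \<in> fibre atl u \<and> (\<forall>y\<in>fibre atl u. g u z y = ric u x y)" "z' \<in> fibre atl u \<and> (\<forall>y\<in>fibre atl u. g u z' y = ric u x y)"
    then show "z = z'" using g_nondegenerate[OF u, of z z'] by simp
  qed
  from theI'[OF this] 
  show "rico u x \<in> fibre atl u" "y \<in> fibre atl u \<Longrightarrow> g u (rico u x) y = ric u x y"
    unfolding Ric_o_def by auto
qed

lemma rico_smooth:
  assumes X: "pi_field_near atl u X"
  shows "pi_field_near atl u (\<lambda>w. rico w (X w))"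
proof -
  obtain U \<phi> where U: "(U, \<phi>) \<in> atl" "fst u \<in> U" using chart_around by blast
  have u: "u \<in> slit_tb atl" using pi_field_near_slit[OF X] .
  have ev: "near satl u (\<lambda>w. w \<in> slit_tb atl \<and> fst w \<in> U \<and> X w \<in> fibre atl w)"
    by (rule slit.near_elim[OF pi_field_nearD(1)[OF X] slit_near_in[OF u U]]) simp
  have "smooth_near satl u (\<lambda>w. vec_coords \<phi> (rico w (X w)) $ k)" for k
  proof (rule slit.smooth_near_linear_system[where M="gram U \<phi>" and b="\<lambda>w. \<chi> j. ric w (X w) (frame U \<phi> j w)"])
    show "smooth_near satl u (\<lambda>w. gram U \<phi> w $ i $ j)" for i j
      unfolding gram_def using g_smooth[OF frame_smooth[OF u U] frame_smooth[OF u U]] by simp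
    show "smooth_near satl u (\<lambda>w. (\<chi> j. ric w (X w) (frame U \<phi> j w)) $ i)" for i
      using ric_smooth[OF X frame_smooth[OF u U]] by simp
    show "near satl u (\<lambda>w. gram U \<phi> w *v vec_coords \<phi> (rico w (X w)) = (\<chi> j. ric w (X w) (frame U \<phi> j w)))"
    proof (rule slit.near_mono[OF ev])
      fix w assume w: "w \<in> slit_tb atl \<and> fst w \<in> U \<and> X w \<in> fibre atl w"
      then show "gram U \<phi> w *v vec_coords \<phi> (rico w (X w)) = (\<chi> j. ric w (X w) (frame U \<phi> j w))"
        using gram_coords[of w U \<phi> "rico w (X w)"] rico_props[of w "X w"] frame_in[OF U(1)] U(1) by simp
    qed
  qed (rule det_gram[OF u U])
  then have "smooth_near satl u (\<lambda>w. vec_coords \<phi> (rico w (X w)))" by (rule slit.smooth_near_vec)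
  moreover have "near satl u (\<lambda>w. rico w (X w) \<in> fibre atl w)"
    by (rule slit.near_mono[OF ev]) (rule rico_props(1), auto)
  ultimately show ?thesis by (intro pi_field_nearI[OF u U])
qed

end

section \<open>Recurrence\<close>

context metric_conn begin

definition cov_deriv4 :: "('m tb \<Rightarrow> 'm tvec \<Rightarrow> 'm tvec \<Rightarrow> 'm tvec \<Rightarrow> 'm tvec \<Rightarrow> real) \<Rightarrow> 'm tb \<Rightarrow> 'm tb tvec
    \<Rightarrow> ('m tb \<Rightarrow> 'm tvec) \<Rightarrow> ('m tb \<Rightarrow> 'm tvec) \<Rightarrow> ('m tb \<Rightarrow> 'm tvec) \<Rightarrow> ('m tb \<Rightarrow> 'm tvec) \<Rightarrow> real" where
  "cov_deriv4 T u h X Y Z V = h (\<lambda>w. T w (X w) (Y w) (Z w) (V w))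
     - T u (D u h X) (Y u) (Z u) (V u) - T u (X u) (D u h Y) (Z u) (V u)
     - T u (X u) (Y u) (D u h Z) (V u) - T u (X u) (Y u) (Z u) (D u h V)"

definition lower :: "('m tb \<Rightarrow> 'm tvec \<Rightarrow> 'm tvec \<Rightarrow> 'm tvec \<Rightarrow> 'm tvec) \<Rightarrow> 'm tb \<Rightarrow> 'm tvec \<Rightarrow> 'm tvec \<Rightarrow> 'm tvec \<Rightarrow> 'm tvec \<Rightarrow> real" where
  "lower B u x y z v = g u (B u x y z) v"

text \<open>The two properties that the covariant derivative of a tensor relies on.\<close>

definition tensor13 :: "('m tb \<Rightarrow> 'm tvec \<Rightarrow> 'm tvec \<Rightarrow> 'm tvec \<Rightarrow> 'm tvec) \<Rightarrow> bool" where
  "tensor13 B \<longleftrightarrow> 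
    (\<forall>u\<in>slit_tb atl. \<forall>x\<in>fibre atl u. \<forall>y\<in>fibre atl u. \<forall>z\<in>fibre atl u. B u x y z \<in> fibre atl u) \<and>
    (\<forall>u X Y Z. pi_field_near atl u X \<longrightarrow> pi_field_near atl u Y \<longrightarrow> pi_field_near atl u Z \<longrightarrow>
      pi_field_near atl u (\<lambda>w. B w (X w) (Y w) (Z w)))"

lemma tensor13_in:
  "tensor13 B \<Longrightarrow> u \<in> slit_tb atl \<Longrightarrow> x \<in> fibre atl u \<Longrightarrow> y \<in> fibre atl u \<Longrightarrow> z \<in> fibre atl u \<Longrightarrow> B u x y z \<in> fibre atl u"
  by (simp add: tensor13_def del: split_paired_All)

lemma tensor13_smooth:
  "tensor13 B \<Longrightarrow> pi_field_near atl u X \<Longrightarrow> pi_field_near atl u Y \<Longrightarrow> pi_field_near atl u Z \<Longrightarrow>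
    pi_field_near atl u (\<lambda>w. B w (X w) (Y w) (Z w))"
  by (simp add: tensor13_def del: split_paired_All)

text \<open>Since \<open>g\<close> is parallel, lowering an index commutes with the covariant derivative. It turns identities of
  vectors into identities of functions, in which the symmetries of the last two slots are visible.\<close>

lemma lower_cov_deriv:
  assumes B: "tensor13 B" and h: "h \<in> tspace atl u" 
    and X: "pi_field_near atl u X" and Y: "pi_field_near atl u Y" and Z: "pi_field_near atl u Z" and V: "pi_field_near atl u V"
  shows "g u (cov_deriv13 D B u h X Y Z) (V u) = cov_deriv4 (lower B) u h X Y Z V"
proof -
  have u: "u \<in> slit_tb atl" using pi_field_near_slit[OF X] .
  note Xu = pi_field_near_in[OF X] and Yu = pi_field_near_in[OF Y] and Zu = pi_field_near_in[OF Z] and Vu = pi_field_near_in[OF V]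
  note DX = D_in[OF u h X] and DY = D_in[OF u h Y] and DZ = D_in[OF u h Z]
  note BXYZ = tensor13_smooth[OF B X Y Z]
  have diff: "g u (a - b) (V u) = g u a (V u) - g u b (V u)" if "a \<in> fibre atl u" "b \<in> fibre atl u" for a b
    using g_linear1[OF u that Vu, of 1 "-1"] by simp
  note in_ = D_in[OF u h BXYZ] tensor13_in[OF B u DX Yu Zu] tensor13_in[OF B u Xu DY Zu] tensor13_in[OF B u Xu Yu DZ]
  have "g u (cov_deriv13 D B u h X Y Z) (V u) = g u (D u h (\<lambda>w. B w (X w) (Y w) (Z w))) (V u)
     - g u (B u (D u h X) (Y u) (Z u)) (V u) - g u (B u (X u) (D u h Y) (Z u)) (V u) - g u (B u (X u) (Y u) (D u h Z)) (V u)"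
    unfolding cov_deriv13_def using in_ by (simp add: diff subspace_diff[OF subspace_fibre])
  then show ?thesis
    using metric_compat[OF h BXYZ V] by (simp add: cov_deriv4_def lower_def)
qed

lemma cov_deriv4_cong:
  assumes eq: "\<And>w x y z v. w \<in> slit_tb atl \<Longrightarrow> x \<in> fibre atl w \<Longrightarrow> y \<in> fibre atl w \<Longrightarrow> z \<in> fibre atl w \<Longrightarrow> v \<in> fibre atl w \<Longrightarrow>
      S w x y z v = T w x y z v"
    and h: "h \<in> tspace atl u" 
    and X: "pi_field_near atl u X" and Y: "pi_field_near atl u Y" and Z: "pi_field_near atl u Z" and V: "pi_field_near atl u V"
  shows "cov_deriv4 S u h X Y Z V = cov_deriv4 T u h X Y Z V"
proof -
  have u: "u \<in> slit_tb atl" using pi_field_near_slit[OF X] .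
  have "h (\<lambda>w. S w (X w) (Y w) (Z w) (V w)) = h (\<lambda>w. T w (X w) (Y w) (Z w) (V w))"
  proof (rule slit.tangent_cong[OF h])
    show "near satl u (\<lambda>w. S w (X w) (Y w) (Z w) (V w) = T w (X w) (Y w) (Z w) (V w))"
      by (rule slit.near_elim[OF slit.near_conj[OF pi_field_near_near[OF X] pi_field_near_near[OF Y]] 
          slit.near_conj[OF pi_field_near_near[OF Z] pi_field_near_near[OF V]]])
        (rule eq, auto intro: pi_field_near_in pi_field_near_slit)
  qed
  then show ?thesis
    unfolding cov_deriv4_def
    using eq u D_in[OF u h] X Y Z V pi_field_near_in by simp
qed

definition smooth4 :: "('m tb \<Rightarrow> 'm tvec \<Rightarrow> 'm tvec \<Rightarrow> 'm tvec \<Rightarrow> 'm tvec \<Rightarrow> real) \<Rightarrow> bool" where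
  "smooth4 T \<longleftrightarrow> (\<forall>u X Y Z V. pi_field_near atl u X \<longrightarrow> pi_field_near atl u Y \<longrightarrow> pi_field_near atl u Z \<longrightarrow> pi_field_near atl u V \<longrightarrow>
      smooth_near satl u (\<lambda>w. T w (X w) (Y w) (Z w) (V w)))"

lemma smooth4D:
  assumes "smooth4 T" "pi_field_near atl u X" "pi_field_near atl u Y" "pi_field_near atl u Z" "pi_field_near atl u V"
  shows "smooth_near satl u (\<lambda>w. T w (X w) (Y w) (Z w) (V w))"
  using assms by (simp add: smooth4_def del: split_paired_All)

lemma cov_deriv4_linear:
  assumes S: "smooth4 S" and T: "smooth4 T" and h: "h \<in> tspace atl u" 
    and X: "pi_field_near atl u X" and Y: "pi_field_near atl u Y" and Z: "pi_field_near atl u Z" and V: "pi_field_near atl u V"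
  shows "cov_deriv4 (\<lambda>w x y z v. a * S w x y z v + b * T w x y z v) u h X Y Z V = a * cov_deriv4 S u h X Y Z V + b * cov_deriv4 T u h X Y Z V"
proof -
  have s: "smooth_near satl u (\<lambda>w. S w (X w) (Y w) (Z w) (V w))" and t: "smooth_near satl u (\<lambda>w. T w (X w) (Y w) (Z w) (V w))"
    using smooth4D[OF S X Y Z V] smooth4D[OF T X Y Z V] .
  show ?thesis
    unfolding cov_deriv4_def
    using slit.tangent_add[OF h slit.smooth_near_cmult[OF s, of a] slit.smooth_near_cmult[OF t, of b]]
      slit.tangent_cmult[OF h s, of a] slit.tangent_cmult[OF h t, of b]
    by (simp add: algebra_simps)
qed

lemma smooth4_linear: 
  assumes "smooth4 S" "smooth4 T" 
  shows "smooth4 (\<lambda>w x y z v. a * S w x y z v + b * T w x y z v)"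
  unfolding smooth4_def
proof (intro allI impI)
  fix u X Y Z V assume F: "pi_field_near atl u X" "pi_field_near atl u Y" "pi_field_near atl u Z" "pi_field_near atl u V"
  show "smooth_near satl u (\<lambda>w. a * S w (X w) (Y w) (Z w) (V w) + b * T w (X w) (Y w) (Z w) (V w))"
    using slit.smooth_near_add[OF slit.smooth_near_cmult[OF smooth4D[OF assms(1) F]] slit.smooth_near_cmult[OF smooth4D[OF assms(2) F]]] .
qed

lemma smooth4_lower: 
  assumes "tensor13 B" 
  shows "smooth4 (lower B)"
  unfolding smooth4_def lower_def
proof (intro allI impI)
  fix u X Y Z V assume F: "pi_field_near atl u X" "pi_field_near atl u Y" "pi_field_near atl u Z" "pi_field_near atl u V"
  show "smooth_near satl u (\<lambda>w. g w (B w (X w) (Y w) (Z w)) (V w))"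
    using g_smooth[OF tensor13_smooth[OF assms F(1-3)] F(4)] .
qed

abbreviation smooth2 :: "('m tb \<Rightarrow> 'm tvec \<Rightarrow> 'm tvec \<Rightarrow> real) \<Rightarrow> bool" where
  "smooth2 p \<equiv> \<forall>u X Y. pi_field_near atl u X \<longrightarrow> pi_field_near atl u Y \<longrightarrow> smooth_near satl u (\<lambda>w. p w (X w) (Y w))"

lemma cov_deriv4_product:
  assumes p: "smooth2 p" and q: "smooth2 q" and h: "h \<in> tspace atl u" 
    and X: "pi_field_near atl u X" and Y: "pi_field_near atl u Y" and Z: "pi_field_near atl u Z" and V: "pi_field_near atl u V"
  shows "cov_deriv4 (\<lambda>w x y z v. p w x z * q w y v) u h X Y Z V = 
    cov_deriv2 D p u h X Z * q u (Y u) (V u) + p u (X u) (Z u) * cov_deriv2 D q u h Y V"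
proof -
  have s: "smooth_near satl u (\<lambda>w. p w (X w) (Z w))" and t: "smooth_near satl u (\<lambda>w. q w (Y w) (V w))"
    using p q X Y Z V by (simp_all del: split_paired_All)
  show ?thesis
    unfolding cov_deriv4_def cov_deriv2_def slit.tangent_mult[OF h s t] by (simp add: algebra_simps)
qed

lemma smooth4_product: 
  assumes p: "smooth2 p" and q: "smooth2 q" 
  shows "smooth4 (\<lambda>w x y z v. p w x z * q w y v)"
  unfolding smooth4_def
proof (intro allI impI)
  fix u X Y Z V assume F: "pi_field_near atl u X" "pi_field_near atl u Y" "pi_field_near atl u Z" "pi_field_near atl u V"
  have "smooth_near satl u (\<lambda>w. p w (X w) (Z w))" "smooth_near satl u (\<lambda>w. q w (Y w) (V w))"
    using p q F by (simp_all del: split_paired_All)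
  then show "smooth_near satl u (\<lambda>w. p w (X w) (Z w) * q w (Y w) (V w))" by (rule slit.smooth_near_mult)
qed

lemma cov_deriv4_swap: "cov_deriv4 (\<lambda>w x y z v. T w y x z v) u h X Y Z V = cov_deriv4 T u h Y X Z V"
  by (simp add: cov_deriv4_def)

lemma smooth4_swap: "smooth4 T \<Longrightarrow> smooth4 (\<lambda>w x y z v. T w y x z v)"
  by (simp add: smooth4_def del: split_paired_All)

lemma cov_deriv4_swap': "cov_deriv4 (\<lambda>w x y z v. T w x y v z) u h X Y Z V = cov_deriv4 T u h X Y V Z"
  by (simp add: cov_deriv4_def)

lemma smooth4_swap': "smooth4 T \<Longrightarrow> smooth4 (\<lambda>w x y z v. T w x y v z)"
  by (simp add: smooth4_def del: split_paired_All)

text \<open>For \<open>s = 1\<close> this is, up to the factor $-\frac1{2(n-1)}$, the Ricci part of the lowered tensor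
  $\mathbb H$. For \<open>s = -1\<close> it is, up to the factor $-\frac1{2(n-1)}$, the difference
  $\mathbb P-\mathbb H$.\<close>

definition ricci_product :: "real \<Rightarrow> 'm tb \<Rightarrow> 'm tvec \<Rightarrow> 'm tvec \<Rightarrow> 'm tvec \<Rightarrow> 'm tvec \<Rightarrow> real" where
  "ricci_product s u x y z v = (ric u x z * g u y v - ric u y z * g u x v) + s * (g u x z * ric u y v - g u y z * ric u x v)"

lemma smooth2_ric: "smooth2 ric" and smooth2_g: "smooth2 g"
  using ric_smooth g_smooth by auto

text \<open>By the Leibniz rule: \<open>g\<close> is parallel, so a product of \<open>Ric\<close> with \<open>g\<close> has the recurrence form of \<open>Ric\<close>.\<close>

lemma ricci_product_recurrent:
  assumes h: "h \<in> tspace atl u" 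
    and X: "pi_field_near atl u X" and Y: "pi_field_near atl u Y" and Z: "pi_field_near atl u Z" and V: "pi_field_near atl u V"
    and ric: "\<And>X Y. pi_field_near atl u X \<Longrightarrow> pi_field_near atl u Y \<Longrightarrow> cov_deriv2 D ric u h X Y = a * ric u (X u) (Y u)"
  shows "cov_deriv4 (ricci_product s) u h X Y Z V = a * ricci_product s u (X u) (Y u) (Z u) (V u)"
    and "smooth4 (ricci_product s)"
proof -
  have u: "u \<in> slit_tb atl" using pi_field_near_slit[OF X] .
  let ?S = "\<lambda>w x y z v. ric w x z * g w y v" and ?T = "\<lambda>w x y z v. g w x z * ric w y v"
  let ?alt = "\<lambda>(T :: 'm tb \<Rightarrow> 'm tvec \<Rightarrow> 'm tvec \<Rightarrow> 'm tvec \<Rightarrow> 'm tvec \<Rightarrow> real) w x y z v. 1 * T w x y z v + (-1) * T w y x z v"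
  have ST: "smooth4 ?S" "smooth4 ?T" using smooth4_product[OF smooth2_ric smooth2_g] smooth4_product[OF smooth2_g smooth2_ric] .
  have alt: "smooth4 (?alt ?S)" "smooth4 (?alt ?T)"
    by (rule smooth4_linear[OF ST(1) smooth4_swap[OF ST(1)]], rule smooth4_linear[OF ST(2) smooth4_swap[OF ST(2)]])
  have eq: "ricci_product s = (\<lambda>w x y z v. 1 * ?alt ?S w x y z v + s * ?alt ?T w x y z v)"
    by (intro ext) (simp add: ricci_product_def)
  show "smooth4 (ricci_product s)" unfolding eq by (rule smooth4_linear[OF alt])
  have *: "cov_deriv4 ?S u h X Y Z V = a * ?S u (X u) (Y u) (Z u) (V u)" "cov_deriv4 ?T u h X Y Z V = a * ?T u (X u) (Y u) (Z u) (V u)"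
    if "pi_field_near atl u X" "pi_field_near atl u Y" for X Y
    using cov_deriv4_product[OF smooth2_ric smooth2_g h that Z V] cov_deriv4_product[OF smooth2_g smooth2_ric h that Z V] 
      ric that Z V metric[OF u h] by simp_all
  show "cov_deriv4 (ricci_product s) u h X Y Z V = a * ricci_product s u (X u) (Y u) (Z u) (V u)"
    unfolding eq cov_deriv4_linear[OF alt h X Y Z V] 
      cov_deriv4_linear[OF ST(1) smooth4_swap[OF ST(1)] h X Y Z V] cov_deriv4_linear[OF ST(2) smooth4_swap[OF ST(2)] h X Y Z V]
      cov_deriv4_swap[of ?S] cov_deriv4_swap[of ?T] *[OF X Y] *[OF Y X] by (simp add: algebra_simps)
qed

subsection \<open>The two curvature tensors\<close>

definition proj_coeff :: real where "proj_coeff = 1 / (real CARD('n) - 1)"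

abbreviation "P \<equiv> proj_curv atl D"
abbreviation "H \<equiv> m_proj_curv atl L D"

lemma P_eq: "P u x y z = R u x y z - proj_coeff *\<^sub>R (ric u x z *\<^sub>R y - ric u y z *\<^sub>R x)"
  by (simp add: proj_curv_def proj_coeff_def)

lemma H_eq: "H u x y z = R u x y z - (proj_coeff / 2) *\<^sub>R (ric u x z *\<^sub>R y - ric u y z *\<^sub>R x + g u x z *\<^sub>R rico u y - g u y z *\<^sub>R rico u x)"
  by (simp add: m_proj_curv_def proj_coeff_def)

lemma tensor13_R: "tensor13 R"
  unfolding tensor13_def using hcurv_in hcurv_smooth by blast

lemma tensor13_P: "tensor13 P"
  unfolding tensor13_def P_eq
proof (intro conjI ballI allI impI)
  fix u x y z assume "u \<in> slit_tb atl" "x \<in> fibre atl u" "y \<in> fibre atl u" "z \<in> fibre atl u"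
  then show "R u x y z - proj_coeff *\<^sub>R (ric u x z *\<^sub>R y - ric u y z *\<^sub>R x) \<in> fibre atl u"
    by (intro subspace_diff[OF subspace_fibre] subspace_scale[OF subspace_fibre] hcurv_in)
next
  fix u X Y Z assume *: "pi_field_near atl u X" "pi_field_near atl u Y" "pi_field_near atl u Z"
  then show "pi_field_near atl u (\<lambda>w. R w (X w) (Y w) (Z w) - proj_coeff *\<^sub>R (ric w (X w) (Z w) *\<^sub>R Y w - ric w (Y w) (Z w) *\<^sub>R X w))"
    by (intro pi_field_near_diff pi_field_near_cscale pi_field_near_scale hcurv_smooth ric_smooth)
qed

lemma tensor13_H: "tensor13 H"
  unfolding tensor13_def H_eq
proof (intro conjI ballI allI impI)
  fix u x y z assume "u \<in> slit_tb atl" "x \<in> fibre atl u" "y \<in> fibre atl u" "z \<in> fibre atl u"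
  then show "R u x y z - (proj_coeff / 2) *\<^sub>R (ric u x z *\<^sub>R y - ric u y z *\<^sub>R x + g u x z *\<^sub>R rico u y - g u y z *\<^sub>R rico u x) \<in> fibre atl u"
    by (intro subspace_diff[OF subspace_fibre] subspace_add[OF subspace_fibre] subspace_scale[OF subspace_fibre] hcurv_in rico_props(1))
next
  fix u X Y Z assume *: "pi_field_near atl u X" "pi_field_near atl u Y" "pi_field_near atl u Z"
  then show "pi_field_near atl u (\<lambda>w. R w (X w) (Y w) (Z w) - (proj_coeff / 2) *\<^sub>R (ric w (X w) (Z w) *\<^sub>R Y w - ric w (Y w) (Z w) *\<^sub>R X w
     + g w (X w) (Z w) *\<^sub>R rico w (Y w) - g w (Y w) (Z w) *\<^sub>R rico w (X w)))"
    by (intro pi_field_near_diff pi_field_near_add pi_field_near_cscale pi_field_near_scale hcurv_smooth ric_smooth g_smooth rico_smooth)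
qed

lemma g_minus_scale:
  assumes u: "u \<in> slit_tb atl" and x: "x \<in> fibre atl u" and y: "y \<in> fibre atl u" and v: "v \<in> fibre atl u"
  shows "g u (x - a *\<^sub>R y) v = g u x v - a * g u y v"
  using g_linear1[OF u x y v, of 1 "-a"] by simp

lemma lower_P:
  assumes u: "u \<in> slit_tb atl" and x: "x \<in> fibre atl u" and y: "y \<in> fibre atl u" and z: "z \<in> fibre atl u" and v: "v \<in> fibre atl u"
  shows "lower P u x y z v = lower R u x y z v - proj_coeff * (ric u x z * g u y v - ric u y z * g u x v)"
proof -
  have "g u (ric u x z *\<^sub>R y - ric u y z *\<^sub>R x) v = ric u x z * g u y v - ric u y z * g u x v"
    using g_linear1[OF u y x v, of "ric u x z" "- ric u y z"] by simp
  moreover have "ric u x z *\<^sub>R y - ric u y z *\<^sub>R x \<in> fibre atl u"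
    by (intro subspace_diff[OF subspace_fibre] subspace_scale[OF subspace_fibre] x y)
  ultimately show ?thesis
    using g_minus_scale[OF u hcurv_in[OF u x y z] _ v] by (simp add: lower_def P_eq)
qed

definition ricci_term :: "'m tb \<Rightarrow> 'm tvec \<Rightarrow> 'm tvec \<Rightarrow> 'm tvec \<Rightarrow> 'm tvec" where
  "ricci_term u x y z = ric u x z *\<^sub>R y - ric u y z *\<^sub>R x + g u x z *\<^sub>R rico u y - g u y z *\<^sub>R rico u x"

lemma ricci_term_in:
  assumes u: "u \<in> slit_tb atl" and x: "x \<in> fibre atl u" and y: "y \<in> fibre atl u" and z: "z \<in> fibre atl u" 
  shows "ricci_term u x y z \<in> fibre atl u"
  unfolding ricci_term_def
  by (intro subspace_diff[OF subspace_fibre] subspace_add[OF subspace_fibre] subspace_scale[OF subspace_fibre] rico_props(1) assms)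

lemma lower_ricci_term:
  assumes u: "u \<in> slit_tb atl" and x: "x \<in> fibre atl u" and y: "y \<in> fibre atl u" and z: "z \<in> fibre atl u" and v: "v \<in> fibre atl u"
  shows "lower ricci_term u x y z v = ricci_product 1 u x y z v"
proof -
  note rx = rico_props[OF u x] and ry = rico_props[OF u y]
  have i1: "ric u x z *\<^sub>R y + (- ric u y z) *\<^sub>R x \<in> fibre atl u" "g u x z *\<^sub>R rico u y + (- g u y z) *\<^sub>R rico u x \<in> fibre atl u"
    by (intro subspace_add[OF subspace_fibre] subspace_scale[OF subspace_fibre] x y rx(1) ry(1))+
  have "ricci_term u x y z = 1 *\<^sub>R (ric u x z *\<^sub>R y + (- ric u y z) *\<^sub>R x) + 1 *\<^sub>R (g u x z *\<^sub>R rico u y + (- g u y z) *\<^sub>R rico u x)"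
    by (simp add: ricci_term_def)
  then show ?thesis unfolding lower_def
    by (simp only: g_linear1[OF u i1 v] g_linear1[OF u y x v] g_linear1[OF u ry(1) rx(1) v] rx(2)[OF v] ry(2)[OF v])
      (simp add: ricci_product_def)
qed

lemma lower_H:
  assumes u: "u \<in> slit_tb atl" and x: "x \<in> fibre atl u" and y: "y \<in> fibre atl u" and z: "z \<in> fibre atl u" and v: "v \<in> fibre atl u"
  shows "lower H u x y z v = lower R u x y z v - proj_coeff / 2 * ricci_product 1 u x y z v"
  using g_minus_scale[OF u hcurv_in[OF u x y z] ricci_term_in[OF u x y z] v, of "proj_coeff / 2"] lower_ricci_term[OF u x y z v]
  by (simp add: lower_def H_eq ricci_term_def)

text \<open>\<open>R(X, Y)\<close> is skew for \<open>g\<close>, and so is the symmetrized Ricci term in \<open>H\<close>.\<close>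

lemma H_skew_part_of_P:
  assumes u: "u \<in> slit_tb atl" and x: "x \<in> fibre atl u" and y: "y \<in> fibre atl u" and z: "z \<in> fibre atl u" and v: "v \<in> fibre atl u"
  shows "lower H u x y z v = 1/2 * lower P u x y z v + (- 1/2) * lower P u x y v z"
proof -
  have skew: "lower R u x y v z = - lower R u x y z v"
    unfolding lower_def using hcurv_skew[OF u x y z v] g_sym[OF u z hcurv_in[OF u x y v]] by simp
  show ?thesis
    unfolding lower_H[OF u x y z v] lower_P[OF u x y z v] lower_P[OF u x y v z] skew
    by (simp add: ricci_product_def algebra_simps add_divide_distrib diff_divide_distrib)
qed

lemma lower_P_H:
  assumes u: "u \<in> slit_tb atl" and x: "x \<in> fibre atl u" and y: "y \<in> fibre atl u" and z: "z \<in> fibre atl u" and v: "v \<in> fibre atl u"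
  shows "lower P u x y z v = 1 * lower H u x y z v + (- proj_coeff / 2) * ricci_product (-1) u x y z v"
  unfolding lower_H[OF u x y z v] lower_P[OF u x y z v]
  by (simp add: ricci_product_def field_simps)

lemma lower_R_H:
  assumes u: "u \<in> slit_tb atl" and x: "x \<in> fibre atl u" and y: "y \<in> fibre atl u" and z: "z \<in> fibre atl u" and v: "v \<in> fibre atl u"
  shows "lower R u x y z v = 1 * lower H u x y z v + (proj_coeff / 2) * ricci_product 1 u x y z v"
  unfolding lower_H[OF u x y z v] by simp

text \<open>The recurrence equation is tensorial in the direction, so it can be studied at one point and for one
  horizontal vector \<open>h\<close>, where the value of the recurrence form is a number \<open>b\<close>.\<close>

definition recurrent_at :: "('m tb \<Rightarrow> 'm tvec \<Rightarrow> 'm tvec \<Rightarrow> 'm tvec \<Rightarrow> 'm tvec) \<Rightarrow> 'm tb \<Rightarrow> 'm tb tvec \<Rightarrow> real \<Rightarrow> bool" where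
  "recurrent_at T u h b \<longleftrightarrow> (\<forall>X Y Z. pi_field_near atl u X \<and> pi_field_near atl u Y \<and> pi_field_near atl u Z \<longrightarrow>
     cov_deriv13 D T u h X Y Z = b *\<^sub>R T u (X u) (Y u) (Z u))"

lemma cov_deriv13_in:
  assumes T: "tensor13 T" and h: "h \<in> tspace atl u" 
    and X: "pi_field_near atl u X" and Y: "pi_field_near atl u Y" and Z: "pi_field_near atl u Z"
  shows "cov_deriv13 D T u h X Y Z \<in> fibre atl u"
proof -
  have u: "u \<in> slit_tb atl" using pi_field_near_slit[OF X] .
  note Xu = pi_field_near_in[OF X] and Yu = pi_field_near_in[OF Y] and Zu = pi_field_near_in[OF Z]
  show ?thesis unfolding cov_deriv13_def
    using D_in[OF u h tensor13_smooth[OF T X Y Z]] tensor13_in[OF T u D_in[OF u h X] Yu Zu] 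
      tensor13_in[OF T u Xu D_in[OF u h Y] Zu] tensor13_in[OF T u Xu Yu D_in[OF u h Z]]
    by (intro subspace_diff[OF subspace_fibre])
qed

lemma vector_eq_by_lowering:
  assumes u: "u \<in> slit_tb atl" and "x \<in> fibre atl u" "y \<in> fibre atl u"
    and eq: "\<And>V. pi_field_near atl u V \<Longrightarrow> g u x (V u) = g u y (V u)"
  shows "x = y"
proof (rule g_nondegenerate[OF assms(1-3)])
  fix z assume "z \<in> fibre atl u"
  then show "g u x z = g u y z" using eq[OF pi_extension_works(1)[OF u]] pi_extension_works(2)[OF u] by simp
qed

lemma g_scale1: 
  assumes "u \<in> slit_tb atl" "x \<in> fibre atl u" "v \<in> fibre atl u"
  shows "g u (b *\<^sub>R x) v = b * g u x v"
  using g_linear1[OF assms(1,2,2,3), of b 0] by simp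

text \<open>Lowering loses nothing because \<open>g\<close> is nondegenerate.\<close>

lemma recurrent_at_iff:
  assumes u: "u \<in> slit_tb atl" and T: "tensor13 T" and h: "h \<in> tspace atl u" 
  shows "recurrent_at T u h b \<longleftrightarrow> (\<forall>X Y Z V. pi_field_near atl u X \<longrightarrow> pi_field_near atl u Y \<longrightarrow> pi_field_near atl u Z \<longrightarrow> pi_field_near atl u V \<longrightarrow>
     cov_deriv4 (lower T) u h X Y Z V = b * lower T u (X u) (Y u) (Z u) (V u))"
proof (intro iffI allI impI)
  fix X Y Z V assume r: "recurrent_at T u h b" and F: "pi_field_near atl u X" "pi_field_near atl u Y" "pi_field_near atl u Z" "pi_field_near atl u V"
  have "T u (X u) (Y u) (Z u) \<in> fibre atl u" using tensor13_in[OF T u] F pi_field_near_in by simp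
  then show "cov_deriv4 (lower T) u h X Y Z V = b * lower T u (X u) (Y u) (Z u) (V u)"
    using lower_cov_deriv[OF T h F] r F g_scale1[OF u] pi_field_near_in by (simp add: recurrent_at_def lower_def)
next
  assume *: "\<forall>X Y Z V. pi_field_near atl u X \<longrightarrow> pi_field_near atl u Y \<longrightarrow> pi_field_near atl u Z \<longrightarrow> pi_field_near atl u V \<longrightarrow>
     cov_deriv4 (lower T) u h X Y Z V = b * lower T u (X u) (Y u) (Z u) (V u)"
  show "recurrent_at T u h b"
    unfolding recurrent_at_def
  proof (intro allI impI, elim conjE)
    fix X Y Z assume F: "pi_field_near atl u X" "pi_field_near atl u Y" "pi_field_near atl u Z"
    have t: "T u (X u) (Y u) (Z u) \<in> fibre atl u" using tensor13_in[OF T u] F pi_field_near_in by simp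
    show "cov_deriv13 D T u h X Y Z = b *\<^sub>R T u (X u) (Y u) (Z u)"
    proof (rule vector_eq_by_lowering[OF u cov_deriv13_in[OF T h F] subspace_scale[OF subspace_fibre t]])
      fix V assume V: "pi_field_near atl u V"
      show "g u (cov_deriv13 D T u h X Y Z) (V u) = g u (b *\<^sub>R T u (X u) (Y u) (Z u)) (V u)"
        using lower_cov_deriv[OF T h F V] * F V g_scale1[OF u t pi_field_near_in[OF V], of b] by (simp add: lower_def)
    qed
  qed
qed

text \<open>Passing to the skew part in the last two slots commutes with the covariant derivative.\<close>

lemma P_recurrent_imp_H_recurrent:
  assumes u: "u \<in> slit_tb atl" and h: "h \<in> tspace atl u" and P: "recurrent_at P u h b"
  shows "recurrent_at H u h b"
  unfolding recurrent_at_iff[OF u tensor13_H h]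
proof (intro allI impI)
  fix X Y Z V assume F: "pi_field_near atl u X" "pi_field_near atl u Y" "pi_field_near atl u Z" "pi_field_near atl u V"
  note sm = smooth4_lower[OF tensor13_P]
  have "cov_deriv4 (lower H) u h X Y Z V = cov_deriv4 (\<lambda>w x y z v. 1/2 * lower P w x y z v + (- 1/2) * lower P w x y v z) u h X Y Z V"
    by (rule cov_deriv4_cong[OF H_skew_part_of_P h F])
  also have "\<dots> = 1/2 * cov_deriv4 (lower P) u h X Y Z V + (- 1/2) * cov_deriv4 (lower P) u h X Y V Z"
    unfolding cov_deriv4_linear[OF sm smooth4_swap'[OF sm] h F] cov_deriv4_swap'[of "lower P"] ..
  also have "\<dots> = b * (1/2 * lower P u (X u) (Y u) (Z u) (V u) + (- 1/2) * lower P u (X u) (Y u) (V u) (Z u))"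
    using P F unfolding recurrent_at_iff[OF u tensor13_P h] by (simp add: algebra_simps)
  also have "\<dots> = b * lower H u (X u) (Y u) (Z u) (V u)"
    using H_skew_part_of_P[OF u] F pi_field_near_in by simp
  finally show "cov_deriv4 (lower H) u h X Y Z V = b * lower H u (X u) (Y u) (Z u) (V u)" .
qed

text \<open>Contraction commutes with the covariant derivative: in a frame, the connection coefficients of
  the contracted vector slot and of the contracted output slot cancel.\<close>

lemma cov_deriv_ric:
  assumes h: "h \<in> tspace atl u" and X: "pi_field_near atl u X" and Y: "pi_field_near atl u Y" 
    and U: "(U, \<phi>) \<in> atl" "fst u \<in> U"
  shows "cov_deriv2 D ric u h X Y = (\<Sum>i\<in>UNIV. vec_coords \<phi> (cov_deriv13 D R u h X (frame U \<phi> i) Y) $ i)"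
proof -
  have u: "u \<in> slit_tb atl" using pi_field_near_slit[OF X] .
  have us: "u \<in> sdom U" using u U by simp
  let ?e = "frame U \<phi>" and ?vc = "vec_coords \<phi>"
  note e = frame_smooth[OF u U] and eu = frame_in[OF U]
  note Xu = pi_field_near_in[OF X] and Yu = pi_field_near_in[OF Y]
  note DX = D_in[OF u h X] and DY = D_in[OF u h Y]
  define \<Gamma> where "\<Gamma> = (\<lambda>j k. ?vc (D u h (?e j)) $ k)"
  define W where "W = (\<lambda>i w. R w (X w) (?e i w) (Y w))"
  have W: "pi_field_near atl u (W i)" for i unfolding W_def by (rule hcurv_smooth[OF X e Y])
  have DV: "?vc (D u h V) $ k = h (\<lambda>w. ?vc (V w) $ k) + (\<Sum>j\<in>UNIV. ?vc (V u) $ j * \<Gamma> j k)" 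
    if V: "pi_field_near atl u V" for V k
  proof -
    have sm: "smooth_near satl u (\<lambda>w. ?vc (V w) $ j)" for j
      using slit.smooth_near_component[OF pi_field_nearD(2)[OF V U]] .
    have "D u h V = D u h (\<lambda>w. \<Sum>j\<in>UNIV. (?vc (V w) $ j) *\<^sub>R ?e j w)"
    proof (rule D_cong[OF h V])
      show "near satl u (\<lambda>w. V w = (\<Sum>j\<in>UNIV. (?vc (V w) $ j) *\<^sub>R ?e j w))"
        by (rule slit.near_elim[OF slit_near_in[OF u U] pi_field_nearD(1)[OF V]]) (rule fibre_expand[OF U(1)], auto)
    qed
    also have "\<dots> = (\<Sum>j\<in>UNIV. D u h (\<lambda>w. (?vc (V w) $ j) *\<^sub>R ?e j w))"
      by (rule D_sum[OF h u]) (rule pi_field_near_scale[OF sm e])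
    also have "\<dots> = (\<Sum>j\<in>UNIV. h (\<lambda>w. ?vc (V w) $ j) *\<^sub>R ?e j u + (?vc (V u) $ j) *\<^sub>R D u h (?e j))"
      by (intro sum.cong refl D_leibniz[OF h sm e])
    finally have "?vc (D u h V) = (\<Sum>j\<in>UNIV. h (\<lambda>w. ?vc (V w) $ j) *\<^sub>R axis j 1 + (?vc (V u) $ j) *\<^sub>R ?vc (D u h (?e j)))"
      by (simp only: linear_sum[OF linear_vec_coords] vec_coords_linear vec_coords_self[OF U])
    then have "?vc (D u h V) $ k = (\<Sum>j\<in>UNIV. h (\<lambda>w. ?vc (V w) $ j) * axis j 1 $ k) + (\<Sum>j\<in>UNIV. ?vc (V u) $ j * \<Gamma> j k)"
      by (simp add: \<Gamma>_def sum.distrib)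
    also have "(\<Sum>j\<in>UNIV. h (\<lambda>w. ?vc (V w) $ j) * axis j 1 $ k) = h (\<lambda>w. ?vc (V w) $ k)"
      by (simp add: axis_def if_distrib cong: if_cong)
    finally show ?thesis .
  qed
  have "h (\<lambda>w. ric w (X w) (Y w)) = h (\<lambda>w. \<Sum>i\<in>UNIV. ?vc (W i w) $ i)"
  proof (rule slit.tangent_cong[OF h])
    show "near satl u (\<lambda>w. ric w (X w) (Y w) = (\<Sum>i\<in>UNIV. ?vc (W i w) $ i))"
      unfolding W_def
      by (rule slit.near_elim[OF slit.near_conj[OF pi_field_near_near[OF X] pi_field_near_near[OF Y]] slit_near_in[OF u U]])
        (rule ric_coords[OF _ U(1)], auto intro: pi_field_near_in)
  qed
  also have "\<dots> = (\<Sum>i\<in>UNIV. h (\<lambda>w. ?vc (W i w) $ i))"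
    by (rule slit.tangent_sum[OF h]) (rule slit.smooth_near_component[OF pi_field_nearD(2)[OF W U]])
  finally have h_ric: "h (\<lambda>w. ric w (X w) (Y w)) = (\<Sum>i\<in>UNIV. h (\<lambda>w. ?vc (W i w) $ i))" .
  have mid: "?vc (R u (X u) (D u h (?e i)) (Y u)) $ k = (\<Sum>j\<in>UNIV. \<Gamma> i j * ?vc (W j u) $ k)" for i k
    unfolding \<Gamma>_def W_def
  proof (rule bilinear_expand[where B="\<lambda>u z y. ?vc (R u (X u) z y) $ k" and u=u, OF _ U D_in[OF u h e] Yu])
    show "?vc (R u (X u) (a *\<^sub>R x + b *\<^sub>R x') y) $ k = a * ?vc (R u (X u) x y) $ k + b * ?vc (R u (X u) x' y) $ k"
      if "x \<in> fibre atl u" "x' \<in> fibre atl u" "y \<in> fibre atl u" for x x' y a b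
      unfolding hcurv_linear2[OF u Xu that] by (simp add: vec_coords_linear)
  qed
  have "(\<Sum>i\<in>UNIV. ?vc (cov_deriv13 D R u h X (?e i) Y) $ i) = 
     (\<Sum>i\<in>UNIV. ?vc (D u h (W i)) $ i - ?vc (R u (D u h X) (?e i u) (Y u)) $ i - ?vc (R u (X u) (D u h (?e i)) (Y u)) $ i
        - ?vc (R u (X u) (?e i u) (D u h Y)) $ i)"
    unfolding cov_deriv13_def W_def by (simp add: linear_diff[OF linear_vec_coords])
  also have "\<dots> = (\<Sum>i\<in>UNIV. ?vc (D u h (W i)) $ i) - ric u (D u h X) (Y u) 
     - (\<Sum>i\<in>UNIV. ?vc (R u (X u) (D u h (?e i)) (Y u)) $ i) - ric u (X u) (D u h Y)"
    unfolding ric_coords[OF u U DX Yu] ric_coords[OF u U Xu DY] by (simp add: sum_subtractf)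
  also have "(\<Sum>i\<in>UNIV. ?vc (D u h (W i)) $ i) = h (\<lambda>w. ric w (X w) (Y w)) + (\<Sum>i\<in>UNIV. \<Sum>j\<in>UNIV. ?vc (W i u) $ j * \<Gamma> j i)"
    unfolding DV[OF W] h_ric by (simp add: sum.distrib)
  finally have contracted: "(\<Sum>i\<in>UNIV. ?vc (cov_deriv13 D R u h X (?e i) Y) $ i) = 
     h (\<lambda>w. ric w (X w) (Y w)) + (\<Sum>i\<in>UNIV. \<Sum>j\<in>UNIV. ?vc (W i u) $ j * \<Gamma> j i) - ric u (D u h X) (Y u) 
     - (\<Sum>i\<in>UNIV. ?vc (R u (X u) (D u h (?e i)) (Y u)) $ i) - ric u (X u) (D u h Y)" .
  have "(\<Sum>i\<in>UNIV. \<Sum>j\<in>UNIV. ?vc (W i u) $ j * \<Gamma> j i) = (\<Sum>i\<in>UNIV. ?vc (R u (X u) (D u h (?e i)) (Y u)) $ i)"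
    unfolding mid by (subst sum.swap) (simp add: mult.commute)
  then show ?thesis using contracted by (simp add: cov_deriv2_def)
qed

text \<open>Contracting the Ricci part of $\mathbb H$ gives \<open>Ric\<close> and \<open>g\<close> back, because the trace of \<open>Z \<mapsto> g(Z, Y) Ric_o X\<close> is \<open>Ric(X, Y)\<close>.\<close>

lemma trace_ricci_term:
  assumes u: "u \<in> slit_tb atl" and x: "x \<in> fibre atl u" and y: "y \<in> fibre atl u" and U: "(U, \<phi>) \<in> atl" "fst u \<in> U"
  shows "(\<Sum>i\<in>UNIV. vec_coords \<phi> (ricci_term u x (frame U \<phi> i u) y) $ i) = 
    (real CARD('n) - 2) * ric u x y + (\<Sum>i\<in>UNIV. vec_coords \<phi> (rico u (frame U \<phi> i u)) $ i) * g u x y"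
proof -
  let ?e = "\<lambda>i. frame U \<phi> i u" and ?vc = "vec_coords \<phi>"
  have "(\<Sum>i\<in>UNIV. ?vc (ricci_term u x (?e i) y) $ i) = (\<Sum>i\<in>UNIV. ric u x y * axis i 1 $ i - ?vc x $ i * ric u (?e i) y
     + g u x y * ?vc (rico u (?e i)) $ i - ?vc (rico u x) $ i * g u (?e i) y)"
    unfolding ricci_term_def 
    by (simp add: linear_diff[OF linear_vec_coords] linear_add[OF linear_vec_coords] linear_scale[OF linear_vec_coords] vec_coords_self[OF U] mult.commute)
  also have "\<dots> = real CARD('n) * ric u x y - (\<Sum>i\<in>UNIV. ?vc x $ i * ric u (?e i) y) 
     + g u x y * (\<Sum>i\<in>UNIV. ?vc (rico u (?e i)) $ i) - (\<Sum>i\<in>UNIV. ?vc (rico u x) $ i * g u (?e i) y)"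
    by (simp add: sum.distrib sum_subtractf sum_distrib_left axis_def)
  also have "(\<Sum>i\<in>UNIV. ?vc x $ i * ric u (?e i) y) = ric u x y"
    by (rule bilinear_expand[where B=ric and u=u, OF ric_linear1[OF u] U x y, symmetric])
  also have "(\<Sum>i\<in>UNIV. ?vc (rico u x) $ i * g u (?e i) y) = ric u x y"
    unfolding rico_props(2)[OF u x y, symmetric]
    by (rule bilinear_expand[where B=g and u=u, OF g_linear1[OF u] U rico_props(1)[OF u x] y, symmetric])
  finally show ?thesis by (simp add: algebra_simps)
qed

text \<open>Here \<open>a\<close> and \<open>b\<close> are the values of the recurrence forms of \<open>Ric\<close> and $\mathbb H$. If they agree, then
  $\mathbb P$ is a sum of tensors that are recurrent with the same value. If they differ, then the contraction of
  \<open>\<nabla>R = b R + (a - b) \<dots>\<close> forces \<open>Ric\<close> to be a multiple of \<open>g\<close> at the point, where the difference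
  $\mathbb P-\mathbb H$ and its covariant derivative vanish.\<close>

lemma H_recurrent_imp_P_recurrent:
  assumes n: "CARD('n) \<ge> 2" and u: "u \<in> slit_tb atl" and h: "h \<in> tspace atl u" and H: "recurrent_at H u h b"
    and ric: "\<And>X Y. pi_field_near atl u X \<Longrightarrow> pi_field_near atl u Y \<Longrightarrow> cov_deriv2 D ric u h X Y = a * ric u (X u) (Y u)"
  shows "recurrent_at P u h b"
proof -
  note smH = smooth4_lower[OF tensor13_H]
  have dH: "cov_deriv4 (lower H) u h X Y Z V = b * lower H u (X u) (Y u) (Z u) (V u)"
    if "pi_field_near atl u X" "pi_field_near atl u Y" "pi_field_near atl u Z" "pi_field_near atl u V" for X Y Z V
    using H that unfolding recurrent_at_iff[OF u tensor13_H h] by simp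
  \<comment> \<open>A tensor that differs from \<open>H\<close> by Ricci terms is recurrent up to a multiple of \<open>a - b\<close>.\<close>
  have comb: "cov_deriv4 (lower T) u h X Y Z V = b * lower T u (X u) (Y u) (Z u) (V u) + k * (a - b) * ricci_product s u (X u) (Y u) (Z u) (V u)"
    if T: "\<And>w x y z v. w \<in> slit_tb atl \<Longrightarrow> x \<in> fibre atl w \<Longrightarrow> y \<in> fibre atl w \<Longrightarrow> z \<in> fibre atl w \<Longrightarrow> v \<in> fibre atl w \<Longrightarrow>
        lower T w x y z v = 1 * lower H w x y z v + k * ricci_product s w x y z v"
    and F: "pi_field_near atl u X" "pi_field_near atl u Y" "pi_field_near atl u Z" "pi_field_near atl u V" for T k s X Y Z V
  proof -
    note w = ricci_product_recurrent[OF h F ric, of s]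
    have "cov_deriv4 (lower T) u h X Y Z V = 
      cov_deriv4 (\<lambda>w x y z v. 1 * lower H w x y z v + k * ricci_product s w x y z v) u h X Y Z V"
      by (rule cov_deriv4_cong[OF T h F])
    also have "\<dots> = 1 * cov_deriv4 (lower H) u h X Y Z V + k * cov_deriv4 (ricci_product s) u h X Y Z V"
      by (rule cov_deriv4_linear[OF smH w(2) h F])
    finally show ?thesis
      using dH[OF F] w(1) T[OF u] F pi_field_near_in by (simp add: algebra_simps)
  qed
  have dR: "cov_deriv13 D R u h X Y Z = b *\<^sub>R R u (X u) (Y u) (Z u) + (proj_coeff / 2 * (a - b)) *\<^sub>R ricci_term u (X u) (Y u) (Z u)"
    if F: "pi_field_near atl u X" "pi_field_near atl u Y" "pi_field_near atl u Z" for X Y Z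
  proof -
    note Fu = F[THEN pi_field_near_in]
    note r = hcurv_in[OF u Fu] and s = ricci_term_in[OF u Fu]
    show ?thesis
    proof (rule vector_eq_by_lowering[OF u cov_deriv13_in[OF tensor13_R h F]])
      show "b *\<^sub>R R u (X u) (Y u) (Z u) + (proj_coeff / 2 * (a - b)) *\<^sub>R ricci_term u (X u) (Y u) (Z u) \<in> fibre atl u"
        by (intro subspace_add[OF subspace_fibre] subspace_scale[OF subspace_fibre] r s)
      fix V assume V: "pi_field_near atl u V"
      note Vu = pi_field_near_in[OF V]
      have "cov_deriv4 (lower R) u h X Y Z V = 
        b * lower R u (X u) (Y u) (Z u) (V u) + proj_coeff / 2 * (a - b) * ricci_product 1 u (X u) (Y u) (Z u) (V u)"
        by (rule comb[OF lower_R_H F V])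
      then show "g u (cov_deriv13 D R u h X Y Z) (V u) = g u (b *\<^sub>R R u (X u) (Y u) (Z u) + (proj_coeff / 2 * (a - b)) *\<^sub>R ricci_term u (X u) (Y u) (Z u)) (V u)"
        unfolding lower_cov_deriv[OF tensor13_R h F V] g_linear1[OF u r s Vu] 
          lower_ricci_term[OF u Fu Vu, symmetric] by (simp add: lower_def)
    qed
  qed
  have wedge0: "(a - b) * ricci_product (-1) u x y z v = 0" 
    if "x \<in> fibre atl u" "y \<in> fibre atl u" "z \<in> fibre atl u" "v \<in> fibre atl u" for x y z v
  proof (cases "a = b")
    case False
    obtain U \<phi> where U: "(U, \<phi>) \<in> atl" "fst u \<in> U" using chart_around by blast
    define r where "r = (\<Sum>i\<in>UNIV. vec_coords \<phi> (rico u (frame U \<phi> i u)) $ i)"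
    \<comment> \<open>Compare the coefficients of \<open>a - b\<close> in the contracted equation; \<open>r\<close> is the scalar curvature.\<close>
    have einstein: "real CARD('n) * ric u x y = r * g u x y" if x: "x \<in> fibre atl u" and y: "y \<in> fibre atl u" for x y
    proof -
      note X = pi_extension_works[OF u x] and Y = pi_extension_works[OF u y]
      have "a * ric u x y = (\<Sum>i\<in>UNIV. vec_coords \<phi> (b *\<^sub>R R u x (frame U \<phi> i u) y + (proj_coeff / 2 * (a - b)) *\<^sub>R ricci_term u x (frame U \<phi> i u) y) $ i)"
        using ric[OF X(1) Y(1)] cov_deriv_ric[OF h X(1) Y(1) U] dR[OF X(1) frame_smooth[OF u U] Y(1)] X(2) Y(2) by simp
      also have "\<dots> = b * ric u x y + proj_coeff / 2 * (a - b) * ((real CARD('n) - 2) * ric u x y + r * g u x y)"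
        unfolding ric_coords[OF u U x y] r_def trace_ricci_term[OF u x y U, unfolded ric_coords[OF u U x y], symmetric]
        by (simp add: vec_coords_linear sum.distrib sum_distrib_left)
      finally have "a * ric u x y - b * ric u x y = proj_coeff / 2 * (a - b) * ((real CARD('n) - 2) * ric u x y + r * g u x y)"
        by simp
      then have "(a - b) * ric u x y = (a - b) * (proj_coeff / 2 * ((real CARD('n) - 2) * ric u x y + r * g u x y))"
        unfolding left_diff_distrib[of a b "ric u x y", symmetric] by (simp only: mult.assoc mult.left_commute)
      then have "ric u x y = proj_coeff / 2 * ((real CARD('n) - 2) * ric u x y + r * g u x y)" using False by simp
      moreover have "real CARD('n) - 1 > 0" using n by simp
      ultimately show ?thesis by (simp add: proj_coeff_def field_simps)
    qed
    have "ric u x y = r / real CARD('n) * g u x y" if "x \<in> fibre atl u" "y \<in> fibre atl u" for x y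
      using einstein[OF that] by (simp add: field_simps)
    then show ?thesis using that by (simp add: ricci_product_def)
  qed simp
  show ?thesis
    unfolding recurrent_at_iff[OF u tensor13_P h]
  proof (intro allI impI)
    fix X Y Z V assume F: "pi_field_near atl u X" "pi_field_near atl u Y" "pi_field_near atl u Z" "pi_field_near atl u V"
    have "cov_deriv4 (lower P) u h X Y Z V = 
      b * lower P u (X u) (Y u) (Z u) (V u) + (- proj_coeff / 2) * (a - b) * ricci_product (-1) u (X u) (Y u) (Z u) (V u)"
      by (rule comb[OF lower_P_H F])
    then show "cov_deriv4 (lower P) u h X Y Z V = b * lower P u (X u) (Y u) (Z u) (V u)"
      using wedge0[OF F[THEN pi_field_near_in]] by simp
  qed
qed

end

text \<open>The topology of $M$ enters only here: overlaps of charts have open coordinate images.\<close>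

lemma smooth_manifold_imp_manifold_atlas:
  fixes atl :: "('m::{t2_space, second_countable_topology}, 'e::euclidean_space) chart set"
  assumes "smooth_manifold atl"
  shows "manifold_atlas atl"
proof
  have cov: "\<Union>(fst ` atl) = UNIV" 
    and ch: "\<And>U \<phi>. (U, \<phi>) \<in> atl \<Longrightarrow> open U \<and> open (\<phi> ` U) \<and> homeomorphism U (\<phi> ` U) \<phi> (inv_into U \<phi>)"
    and tr: "\<And>U \<phi> V \<psi>. (U, \<phi>) \<in> atl \<Longrightarrow> (V, \<psi>) \<in> atl \<Longrightarrow> smooth_on (\<phi> ` (U \<inter> V)) (\<psi> \<circ> inv_into U \<phi>)"
    using assms unfolding smooth_manifold_def by auto
  show "\<Union>(fst ` atl) = UNIV" by (rule cov)
  fix U \<phi> assume U: "(U, \<phi>) \<in> atl"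
  then have hom: "homeomorphism U (\<phi> ` U) \<phi> (inv_into U \<phi>)" using ch by blast
  show "inj_on \<phi> U"
    by (rule inj_on_inverseI[of _ "inv_into U \<phi>"]) (use hom in \<open>simp add: homeomorphism_def\<close>)
  fix V \<psi> assume V: "(V, \<psi>) \<in> atl"
  show "smooth_on (\<phi> ` (U \<inter> V)) (\<psi> \<circ> inv_into U \<phi>)" by (rule tr[OF U V])
  have "openin (top_of_set U) (U \<inter> V)" using ch[OF V] by (auto intro: openin_open_Int)
  then have "openin (top_of_set (\<phi> ` U)) (\<phi> ` (U \<inter> V))"
    by (rule homeomorphism_imp_open_map[OF hom])
  then show "open (\<phi> ` (U \<inter> V))" using ch[OF U] openin_open_eq by blast
qed

theorem theorem3p6:
  fixes atl :: "('m::{t2_space, second_countable_topology}, real^'n) chart set"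
    and L :: "'m tb \<Rightarrow> real"
    and D :: "'m connection"
  assumes finsler: "finsler_manifold atl L"
    and dim: "CARD('n) \<ge> 3"
    and cartan: "cartan_connection atl L D"
    and ricci: "\<exists>A. ricci_recurrent atl D A"
  shows "\<forall>B. m_projectively_recurrent atl L D B \<longleftrightarrow> projectively_recurrent atl D B"
proof
  fix B
  interpret manifold_atlas atl
    by (rule smooth_manifold_imp_manifold_atlas[OF conjunct1[OF finsler[unfolded finsler_manifold_def]]])
  interpret metric_conn atl D L
  proof
    show "regular_connection atl D" using cartan unfolding cartan_connection_def by (rule conjunct1)
    show "smooth_near (slit_atlas atl) u L" if "u \<in> slit_tb atl" for u
      using finsler that by (simp add: finsler_manifold_def)
    show "finsler_g L u x x > 0" if "u \<in> slit_tb atl" "x \<in> fibre atl u" "x \<noteq> 0" for u x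
      using finsler that by (simp add: finsler_manifold_def)
    show "cov_deriv2 D (finsler_g L) u v Y Z = 0" 
      if "u \<in> slit_tb atl" "v \<in> tspace atl u" "pi_field_near atl u Y" "pi_field_near atl u Z" for u v Y Z
      using cartan[unfolded cartan_connection_def, THEN conjunct2, THEN conjunct1] that by simp
  qed
  obtain A where A: "ricci_recurrent atl D A" using ricci by blast
  have ric: "cov_deriv2 D (Ric atl D) u (hmap atl D u w) X Y = A u w * Ric atl D u (X u) (Y u)"
    if "u \<in> slit_tb atl" "w \<in> fibre atl u" "pi_field_near atl u X" "pi_field_near atl u Y" for u w X Y
    using A[unfolded ricci_recurrent_def, THEN conjunct2, THEN conjunct2, THEN conjunct2] that by simp
  have rec: "recurrent13 atl D T B \<longleftrightarrow> pi_form atl B \<and> nonzero_form atl B \<and>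
      (\<forall>u\<in>slit_tb atl. \<forall>w\<in>fibre atl u. recurrent_at T u (hmap atl D u w) (B u w))" for T
    unfolding recurrent13_def recurrent_at_def ..
  have "recurrent_at (m_proj_curv atl L D) u (hmap atl D u w) (B u w) \<longleftrightarrow> recurrent_at (proj_curv atl D) u (hmap atl D u w) (B u w)"
    if "u \<in> slit_tb atl" "w \<in> fibre atl u" for u w
    using H_recurrent_imp_P_recurrent[OF _ that(1) hmap_props(1)[OF that] _ ric[OF that]]
      P_recurrent_imp_H_recurrent[OF that(1) hmap_props(1)[OF that]] dim by force
  then show "m_projectively_recurrent atl L D B \<longleftrightarrow> projectively_recurrent atl D B"
    unfolding m_projectively_recurrent_def projectively_recurrent_def rec by simp
qed

end
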